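(* Let $f\in L^1(T)$, where $T=[-\pi,\pi)$, and let $(n_j)_{j\ge 1}$ be a sequence of positive integers such that, for some $0<\delta<1/2$, $n_{j+1}\ge\left(1+\frac{1}{j^{\delta}}\right)n_j$ holds for every $j\ge 1$. Then for almost every $y\in T$ \[ \lim_{N\to\infty}\frac1N\sum_{j=1}^{N}S_{n_j}f(y)=f(y). \]
   Context: $T=[-\pi,\pi)$ with Lebesgue measure. For $f\in L^1(T)$ and $k\in\mathbb Z$, $\hat f(k)=\frac1{2\pi}\int_T f(t)e^{-\imath kt}\,dt$, and $S_nf(y)=\sum_{k=-n}^{n}\hat f(k)e^{\imath ky}$ is the $n$th partial sum of the trigonometric Fourier series of $f$. *)

theory Defs
  imports "HOL-Analysis.Analysis"
begin

abbreviation torus :: "real set" where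
  "torus \<equiv> {-pi..<pi}"

definition fourier_coeff :: "(real \<Rightarrow> complex) \<Rightarrow> int \<Rightarrow> complex" where
  "fourier_coeff f k =
     1 / (2 * of_real pi) * (LINT t:torus|lebesgue. f t * exp (- \<i> * of_int k * of_real t))"

definition fourier_partial_sum :: "nat \<Rightarrow> (real \<Rightarrow> complex) \<Rightarrow> real \<Rightarrow> complex" where
  "fourier_partial_sum n f y =
     (\<Sum>k = - int n..int n. fourier_coeff f k * exp (\<i> * of_int k * of_real y))"

end

theory Submission
  imports Defs
begin

text \<open>
  Polynomials are dense in \<open>L\<^sup>1\<close> and their partial sums converge at every interior point of the torus, so
  everything rests on a weak type (1,1) bound for the supremum over \<open>N\<close> of the averages of
  \<open>S_{n_j} f\<close>, \<open>j \<le> N\<close>. At height \<open>\<lambda>\<close> write \<open>f = g + \<Sum> b_I\<close> (Calderon--Zygmund).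

  On \<open>g\<close>, the difference of \<open>S_n\<close> and the Fejer mean is the multiplier \<open>|k| / (n + 1)\<close> on \<open>|k| \<le> n\<close>. Sparseness
  gives \<open>\<Sum>\<^sub>j j powr -\<delta> * min (n_j / k) (k / n_j) = O(1)\<close> by telescoping, so these differences are square
  summable with the weights \<open>1 / j\<close>, which controls the averages.

  On \<open>\<Sum> b_I\<close>, outside the exceptional set, the kernel \<open>1 / (e^{i (x - t)} - 1)\<close> may be replaced for \<open>t\<close> in
  \<open>I\<close> by its mean against a bump \<open>\<phi>_I\<close>. This turns \<open>S_{n_j} b\<close> into (the real part of) \<open>e^{i (n_j + 1) x}\<close> times
  the analytic projection of \<open>h_j = \<Sum> \<beta>_{j,I} \<phi>_I\<close>, where \<open>\<beta>_{j,I}\<close> is the Fourier coefficient of \<open>b_I\<close> at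
  \<open>n_j + 1\<close>. Intervals with \<open>n_j |I| \<le> j powr \<delta>\<close> are again square summable with weights \<open>1 / j\<close>, by the
  cancellation of \<open>b_I\<close> for the shortest of them. For the longer ones the frequencies below \<open>n_{j+1} - n_j\<close> of
  \<open>h_j\<close> give pairwise orthogonal functions, whose averages are controlled as in the strong law of large numbers,
  while the higher frequencies are small because \<open>\<phi>_I\<close> is Lipschitz. The hypothesis \<open>\<delta> < 1/2\<close> enters
  through \<open>j powr \<delta> / j \<le> j powr -\<delta>\<close>.
\<close>

section \<open>Fourier coefficients on the torus\<close>

text \<open>The mean zero of \<open>b_I\<close> is of no use when the interval is longer than 1 / n:
  \<open>b_I\<close> is met multiplied by an exponential of frequency n + 1, which has no
  cancellation left, and the kernel bound 1 / |x - t| is not integrable. Smearing the factor that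
  does not oscillate isolates this loss in one number \<open>\<beta>_{j,I}\<close> per interval; the
  remainder has Poisson size |I| / |x - t|^2 and is harmless. As \<open>\<beta>_{j,I}\<close> is
  O(lam |I|) and \<open>\<phi>_I\<close> is O(1 / |I|), the function \<open>h_j\<close> is bounded
  by a multiple of lam: an L^1 problem has become an L^2 problem, open to Bessel and Parseval. The
  power j^\<delta> has one source: the gap n_{j+1} - n_j may be as short as n_j / j^\<delta>, so the
  gap frequencies capture most of a bump only if |I| exceeds j^\<delta> / n_j. To avoid limits, N
  runs up to some N0, the intervals form a finite family and the analytic projection is cut at a
  frequency M; no final constant depends on N0, the family or M. Continuity of f serves this finite
  selection and is removed while N0 is fixed, when only finitely many operators are
  involved.\<close>

abbreviation torusM :: "real measure" where "torusM \<equiv> lebesgue_on torus"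

section \<open>The torus as a finite measure space\<close>

lemma finite_measure_torusM: "finite_measure torusM"
  by (rule finite_measureI) (simp add: emeasure_restrict_space)

lemma measure_torusM: "measure torusM (space torusM) = 2 * pi"
  by (simp add: measure_restrict_space)

abbreviation l1_int :: "(real \<Rightarrow> real) \<Rightarrow> real" where "l1_int f \<equiv> LINT t|torusM. \<bar>f t\<bar>"

abbreviation l2_int :: "(real \<Rightarrow> complex) \<Rightarrow> real" where "l2_int f \<equiv> LINT t|torusM. (cmod (f t))^2"

lemma borel_measurable_torusM:
  "f \<in> borel_measurable borel \<Longrightarrow> f \<in> borel_measurable torusM"
  by (intro measurable_restrict_space1 measurable_completion) simp

lemma continuous_measurable_torusM:
  fixes f :: "real \<Rightarrow> 'a::{topological_space}"
  shows "continuous_on UNIV f \<Longrightarrow> f \<in> borel_measurable torusM"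
  by (intro borel_measurable_torusM borel_measurable_continuous_onI)

lemma integrable_torusM_bounded:
  fixes f :: "real \<Rightarrow> 'a::{banach,second_countable_topology}"
  assumes "f \<in> borel_measurable torusM" "\<And>x. x \<in> torus \<Longrightarrow> norm (f x) \<le> B"
  shows "integrable torusM f"
  by (rule finite_measure.integrable_const_bound[OF finite_measure_torusM, of _ B])
     (use assms in auto)

lemma integrable_torusM_continuous:
  fixes f :: "real \<Rightarrow> real"
  assumes "continuous_on UNIV f"
  shows "integrable torusM f"
proof -
  have "continuous_on {-pi..pi} f" using assms by (rule continuous_on_subset) simp
  from compact_imp_bounded[OF compact_continuous_image[OF this compact_Icc]]
  obtain B where "\<forall>t\<in>{-pi..pi}. \<bar>f t\<bar> \<le> B" unfolding bounded_iff real_norm_def by blast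
  thus ?thesis
    by (intro integrable_torusM_bounded[OF continuous_measurable_torusM[OF assms], of B]) auto
qed

lemma integral_torusM_bound:
  fixes f :: "real \<Rightarrow> 'a::{banach,second_countable_topology}"
  assumes "integrable torusM f" "\<And>x. x \<in> torus \<Longrightarrow> norm (f x) \<le> B"
  shows "norm (integral\<^sup>L torusM f) \<le> 2 * pi * B"
proof -
  have "norm (integral\<^sup>L torusM f) \<le> (\<integral>x. norm (f x) \<partial>torusM)"
    by simp
  also have "\<dots> \<le> (\<integral>x. B \<partial>torusM)"
    by (intro integral_mono) (use assms finite_measure.integrable_const[OF finite_measure_torusM] in auto)
  also have "\<dots> = 2 * pi * B"
    by (simp add: measure_torusM[simplified])
  finally show ?thesis .
qed

lemma integrable_mult_bounded:
  fixes f g :: "'a \<Rightarrow> 'b::{real_normed_algebra,banach,second_countable_topology}"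
  assumes "integrable M f" "g \<in> borel_measurable M" "\<And>x. x \<in> space M \<Longrightarrow> norm (g x) \<le> B"
  shows "integrable M (\<lambda>x. f x * g x)"
proof (rule Bochner_Integration.integrable_bound)
  show "integrable M (\<lambda>x. B * norm (f x))" using assms(1) by simp
  show "(\<lambda>x. f x * g x) \<in> borel_measurable M" using assms by measurable
  show "AE x in M. norm (f x * g x) \<le> norm (B * norm (f x))"
  proof (rule AE_I2)
    fix x assume x: "x \<in> space M"
    have "norm (f x * g x) \<le> norm (f x) * norm (g x)" by (rule norm_mult_ineq)
    also have "\<dots> \<le> norm (f x) * B" using assms(3)[OF x] by (intro mult_left_mono) auto
    also have "\<dots> \<le> norm (B * norm (f x))" by (simp add: mult.commute)
    finally show "norm (f x * g x) \<le> norm (B * norm (f x))" .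
  qed
qed

text \<open>Half-open intervals fit the dyadic partition of the torus. Compared with the closed
  interval only a null set changes, and for Borel functions the integral over \<open>lborel\<close>
  and over its completion agree.\<close>

lemma has_bochner_integral_torusM_FTC:
  fixes F f :: "real \<Rightarrow> 'a::euclidean_space"
  assumes "- pi \<le> a" "a \<le> b" "b \<le> pi"
    and "\<And>x. a \<le> x \<Longrightarrow> x \<le> b \<Longrightarrow> (F has_vector_derivative f x) (at x within {a..b})"
    and "continuous_on {a..b} f"
  shows "has_bochner_integral torusM (\<lambda>x. indicator {a..<b} x *\<^sub>R f x) (F b - F a)"
proof -
  have "has_bochner_integral lborel (\<lambda>x. indicator {a..b} x *\<^sub>R f x) (F b - F a)"
    using assms by (intro has_bochner_integral_FTC_Icc) auto
  moreover have "AE x in lborel. indicator {a..b} x *\<^sub>R f x = indicator {a..<b} x *\<^sub>R f x"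
    by (rule AE_I'[of "{b}"]) (auto simp: indicator_def split: if_splits)
  moreover have m: "(\<lambda>x. indicator {a..<b} x *\<^sub>R f x) \<in> borel_measurable lborel"
  proof -
    have "(\<lambda>x. indicator {a..b} x *\<^sub>R f x) \<in> borel_measurable lborel"
      using calculation(1) by (rule borel_measurable_has_bochner_integral)
    hence "(\<lambda>x. indicator {a..<b} x *\<^sub>R (indicator {a..b} x *\<^sub>R f x)) \<in> borel_measurable lborel"
      by measurable
    thus ?thesis
      by (rule measurable_cong[THEN iffD1, rotated]) (auto simp: indicator_def)
  qed
  ultimately have "has_bochner_integral lborel (\<lambda>x. indicator {a..<b} x *\<^sub>R f x) (F b - F a)"
    by (subst has_bochner_integral_cong_AE[symmetric, OF borel_measurable_has_bochner_integral]) auto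
  hence "has_bochner_integral lebesgue (\<lambda>x. indicator {a..<b} x *\<^sub>R f x) (F b - F a)"
    using m by (simp add: has_bochner_integral_iff integrable_completion integral_completion)
  moreover have "(\<lambda>x. indicator torus x *\<^sub>R (indicator {a..<b} x *\<^sub>R f x)) = (\<lambda>x. indicator {a..<b} x *\<^sub>R f x)"
    using assms(1-3) by (intro ext) (auto simp: indicator_def)
  moreover have "torus \<inter> space lebesgue \<in> sets lebesgue" by simp
  ultimately show ?thesis
    by (simp only: has_bochner_integral_iff integrable_restrict_space integral_restrict_space simp_thms)
qed

section \<open>Orthogonality of the exponentials, Parseval and Bessel\<close>

lemma has_bochner_integral_torusM_cis:
  "has_bochner_integral torusM (\<lambda>x. cis (of_int k * x)) (if k = 0 then 2 * of_real pi else 0)"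
proof -
  have "has_bochner_integral torusM (\<lambda>x. indicator {-pi..<pi} x *\<^sub>R cis (of_int k * x)) (if k = 0 then 2 * of_real pi else 0)"
  proof (cases "k = 0")
    case True
    have "has_bochner_integral torusM (\<lambda>x. indicator {-pi..<pi} x *\<^sub>R (1::complex)) (of_real pi - of_real (- pi))"
      by (rule has_bochner_integral_torusM_FTC) (auto intro!: derivative_eq_intros simp: has_vector_derivative_def scaleR_conv_of_real)
    thus ?thesis using True by simp
  next
    case False
    have "has_bochner_integral torusM (\<lambda>x. indicator {-pi..<pi} x *\<^sub>R cis (of_int k * x))
       (cis (of_int k * pi) / (\<i> * of_int k) - cis (of_int k * (-pi)) / (\<i> * of_int k))"
      using False
      by (intro has_bochner_integral_torusM_FTC)
         (auto intro!: derivative_eq_intros continuous_intros simp: has_vector_derivative_def scaleR_conv_of_real field_simps)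
    moreover have "cis (of_int k * pi) = cis (of_int k * (-pi))"
      by (simp add: complex_eq_iff mult.commute)
    ultimately show ?thesis using False by simp
  qed
  thus ?thesis
    by (rule has_bochner_integral_cong[THEN iffD1, rotated -1]) auto
qed

text \<open>Stated with \<open>has_bochner_integral\<close>, so that integrability of the square
  comes along with its value; the factor 2 pi is the total mass of the torus.\<close>

lemma parseval_trig:
  assumes "finite K"
  shows "has_bochner_integral torusM (\<lambda>x. (cmod (\<Sum>k\<in>K. c k * cis (of_int k * x)))^2) (2 * pi * (\<Sum>k\<in>K. (cmod (c k))^2))"
proof -
  have eq: "complex_of_real ((cmod (\<Sum>k\<in>K. c k * cis (of_int k * x)))^2)
     = (\<Sum>k\<in>K. \<Sum>l\<in>K. (c k * cnj (c l)) * cis (of_int (k - l) * x))" for x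
  proof -
    have "complex_of_real ((cmod (\<Sum>k\<in>K. c k * cis (of_int k * x)))^2)
       = (\<Sum>k\<in>K. c k * cis (of_int k * x)) * (\<Sum>l\<in>K. cnj (c l) * cis (- (of_int l * x)))"
      by (simp add: complex_norm_square cis_cnj del: of_real_power)
    also have "\<dots> = (\<Sum>k\<in>K. \<Sum>l\<in>K. (c k * cnj (c l)) * (cis (of_int k * x) * cis (- (of_int l * x))))"
      by (simp add: sum_product mult_ac)
    finally show ?thesis by (simp add: cis_mult algebra_simps)
  qed
  have "has_bochner_integral torusM (\<lambda>x. \<Sum>k\<in>K. \<Sum>l\<in>K. (c k * cnj (c l)) * cis (of_int (k - l) * x))
     (\<Sum>k\<in>K. \<Sum>l\<in>K. (c k * cnj (c l)) * (if k - l = 0 then 2 * of_real pi else 0))"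
    by (intro has_bochner_integral_sum has_bochner_integral_mult_right has_bochner_integral_torusM_cis)
  also have "(\<Sum>k\<in>K. \<Sum>l\<in>K. (c k * cnj (c l)) * (if k - l = 0 then 2 * of_real pi else 0))
      = (\<Sum>k\<in>K. \<Sum>l\<in>K. if k = l then (c k * cnj (c l)) * (2 * of_real pi) else 0)"
    by (intro sum.cong) auto
  also have "\<dots> = of_real (2 * pi * (\<Sum>k\<in>K. (cmod (c k))^2))"
    using assms by (simp add: complex_norm_square sum_distrib_left sum_distrib_right mult_ac del: of_real_power)
  finally have "has_bochner_integral torusM (\<lambda>x. complex_of_real ((cmod (\<Sum>k\<in>K. c k * cis (of_int k * x)))^2))
     (of_real (2 * pi * (\<Sum>k\<in>K. (cmod (c k))^2)))"
    by (simp only: eq)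
  from has_bochner_integral_bounded_linear[OF bounded_linear_Re this] show ?thesis by simp
qed

text \<open>Fourier coefficient without the factor 1 / (2 pi), which is restored only in
  \<open>fourier_coeff_eq\<close>.\<close>

definition tcoeff :: "(real \<Rightarrow> complex) \<Rightarrow> int \<Rightarrow> complex" where
  "tcoeff h k = (LINT t|torusM. h t * cis (- (of_int k * t)))"

lemma measurable_cis [measurable]: "cis \<in> borel_measurable borel"
  by (intro borel_measurable_continuous_onI continuous_intros)

lemma measurable_id_torusM [measurable]: "(\<lambda>x. x) \<in> borel_measurable torusM"
  by (rule borel_measurable_torusM) simp

lemma integrable_mult_cis:
  assumes "integrable M h" "g \<in> borel_measurable M"
  shows "integrable M (\<lambda>t. h t * cis (g t))"
  using assms(1) by (rule integrable_mult_bounded[where B = 1]) (use assms(2) in auto)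

text \<open>The squared distance from \<open>h\<close> to its projection \<open>s\<close> is
  nonnegative. The bound \<open>B\<close> supplies the integrability of the square; the factor 2 pi
  is due to the unnormalised coefficients.\<close>

lemma bessel_torus:
  assumes "finite K" and [measurable]: "h \<in> borel_measurable torusM"
    and B: "\<And>t. t \<in> torus \<Longrightarrow> cmod (h t) \<le> B"
  shows "(\<Sum>k\<in>K. (cmod (tcoeff h k))^2) \<le> 2 * pi * (l2_int h)"
proof -
  define c where "c k = tcoeff h k / (2 * of_real pi)" for k
  define s where "s x = (\<Sum>k\<in>K. c k * cis (of_int k * x))" for x
  have s_meas [measurable]: "s \<in> borel_measurable torusM"
    unfolding s_def by measurable
  have h_int: "integrable torusM h" using assms(2) B by (rule integrable_torusM_bounded)
  have h2: "integrable torusM (\<lambda>t. (cmod (h t))^2)"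
    by (rule integrable_torusM_bounded[where B = "B^2"]) (use B in \<open>auto intro!: power_mono\<close>)
  have s2: "has_bochner_integral torusM (\<lambda>t. (cmod (s t))^2) (2 * pi * (\<Sum>k\<in>K. (cmod (c k))^2))"
    unfolding s_def by (rule parseval_trig[OF assms(1)])
  have hs_eq: "h t * cnj (s t) = (\<Sum>k\<in>K. cnj (c k) * (h t * cis (- (of_int k * t))))" for t
    unfolding s_def by (simp add: sum_distrib_left cis_cnj mult_ac)
  have hs: "has_bochner_integral torusM (\<lambda>t. h t * cnj (s t)) (\<Sum>k\<in>K. cnj (c k) * tcoeff h k)"
    unfolding hs_eq tcoeff_def
    by (intro has_bochner_integral_sum has_bochner_integral_mult_right has_bochner_integral_integrable
        integrable_mult_cis h_int) measurable
  have "(\<Sum>k\<in>K. cnj (c k) * tcoeff h k) = of_real (2 * pi * (\<Sum>k\<in>K. (cmod (c k))^2))"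
    unfolding of_real_mult of_real_sum complex_norm_square
    by (simp add: c_def sum_distrib_left field_simps)
  with hs have hs': "has_bochner_integral torusM (\<lambda>t. Re (h t * cnj (s t))) (2 * pi * (\<Sum>k\<in>K. (cmod (c k))^2))"
    using has_bochner_integral_bounded_linear[OF bounded_linear_Re hs] by simp
  have "has_bochner_integral torusM (\<lambda>t. (cmod (h t))^2 - 2 * Re (h t * cnj (s t)) + (cmod (s t))^2)
    ((l2_int h) - 2 * (2 * pi * (\<Sum>k\<in>K. (cmod (c k))^2)) + 2 * pi * (\<Sum>k\<in>K. (cmod (c k))^2))"
    by (intro has_bochner_integral_add has_bochner_integral_diff has_bochner_integral_mult_right
        has_bochner_integral_integrable h2 hs' s2)
  moreover have "(cmod (h t))^2 - 2 * Re (h t * cnj (s t)) + (cmod (s t))^2 = (cmod (h t - s t))^2" for t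
    unfolding cmod_power2 by (simp add: power2_eq_square algebra_simps)
  ultimately have "(LINT t|torusM. (cmod (h t - s t))^2) = (l2_int h) - 2 * pi * (\<Sum>k\<in>K. (cmod (c k))^2)"
    by (simp add: has_bochner_integral_iff)
  moreover have "0 \<le> (LINT t|torusM. (cmod (h t - s t))^2)" by simp
  moreover have "2 * pi * (\<Sum>k\<in>K. (cmod (c k))^2) = (\<Sum>k\<in>K. (cmod (tcoeff h k))^2) / (2 * pi)"
    unfolding c_def by (simp add: norm_divide power_divide sum_divide_distrib[symmetric] power2_eq_square)
  ultimately have "(\<Sum>k\<in>K. (cmod (tcoeff h k))^2) / (2 * pi) \<le> (l2_int h)"
    by linarith
  thus ?thesis by (simp add: pos_divide_le_eq mult.commute)
qed

text \<open>By Bessel the squares of the coefficients are summable, hence tend to 0. Bounded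
  functions suffice for the difference quotient to which this is applied.\<close>

lemma riemann_lebesgue_bounded:
  assumes "h \<in> borel_measurable torusM" "\<And>t. t \<in> torus \<Longrightarrow> cmod (h t) \<le> B"
  shows "(\<lambda>n. tcoeff h (int n)) \<longlonglongrightarrow> 0"
proof -
  have "summable (\<lambda>n. (cmod (tcoeff h (int n)))^2)"
  proof (rule summableI_nonneg_bounded)
    fix N
    have "(\<Sum>n<N. (cmod (tcoeff h (int n)))^2) = (\<Sum>k\<in>int ` {..<N}. (cmod (tcoeff h k))^2)"
      by (subst sum.reindex) auto
    also have "\<dots> \<le> 2 * pi * (l2_int h)"
      by (rule bessel_torus) (use assms in auto)
    finally show "(\<Sum>n<N. (cmod (tcoeff h (int n)))^2) \<le> 2 * pi * (l2_int h)" .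
  qed auto
  from summable_LIMSEQ_zero[OF this] have "(\<lambda>n. cmod (tcoeff h (int n))) \<longlonglongrightarrow> 0"
    using tendsto_real_sqrt by fastforce
  thus ?thesis by (rule tendsto_norm_zero_cancel)
qed

section \<open>Weights of a sparse sequence\<close>

lemma powr_ge_one_div: "1 / real j \<le> 1 / real j powr \<delta>" if "j \<ge> 1" "\<delta> \<le> 1" 
  using that powr_mono[of \<delta> 1 "real j"] by (intro divide_left_mono) auto

locale sparse_sequence =
  fixes n :: "nat \<Rightarrow> nat" and \<delta> :: real
  assumes npos: "\<And>j. j \<ge> 1 \<Longrightarrow> n j > 0"
    and \<delta>: "0 < \<delta>" "\<delta> < 1 / 2"
    and growth: "\<And>j. j \<ge> 1 \<Longrightarrow> real (n (Suc j)) \<ge> (1 + 1 / real j powr \<delta>) * real (n j)"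
begin

lemma growth_strict: assumes "j \<ge> 1" shows "n j < n (Suc j)"
proof -
  have "real (n j) < (1 + 1 / real j powr \<delta>) * real (n j)"
    using npos[OF assms] assms by (simp add: field_simps)
  also have "\<dots> \<le> real (n (Suc j))" using growth[OF assms] .
  finally show ?thesis by simp
qed

lemma growth_mono: assumes "1 \<le> i" "i \<le> j" shows "n i \<le> n j"
  using assms(2,1) by (induction rule: dec_induct) (use growth_strict in \<open>auto intro: order.trans less_imp_le\<close>)

lemma growth_ge: assumes "j \<ge> 1" shows "j \<le> n j"
  using assms by (induction rule: nat_induct_at_least) (use npos[of 1] growth_strict in \<open>force+\<close>)

text \<open>The weight j^{-\<delta>} times the smaller of n_j l and 1 / (n_j l), split at n_j l = 1
  because the two halves telescope differently. The argument l is an interval length in the bad part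
  and 1 / |k| for a frequency k in the good part.\<close>

definition low_wt :: "nat \<Rightarrow> real \<Rightarrow> real" where
  "low_wt j l = (if real (n j) * l \<le> 1 then 1 / real j powr \<delta> * (real (n j) * l) else 0)"

definition high_wt :: "nat \<Rightarrow> real \<Rightarrow> real" where
  "high_wt j l = (if real (n j) * l \<ge> 1 then 1 / real j powr \<delta> / (real (n j) * l) else 0)"

text \<open>By \<open>growth\<close> each term is at most the increment of \<open>n j * l\<close>,
  so the sum telescopes up to the last j with \<open>n j * l \<le> 1\<close>; that last term is
  estimated by itself, hence 1 + 1.\<close>

lemma sum_low_frequencies:
  fixes l :: real
  assumes "0 < l"
  shows "(\<Sum>j=1..N. low_wt j l) \<le> 2"
proof -
  define s where "s N = (\<Sum>j=1..N. low_wt j l)" for N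
  have step: "1 / real j powr \<delta> * (n j * l) \<le> n (Suc j) * l - n j * l" if "j \<ge> 1" for j
    using mult_right_mono[OF growth[OF that], of l] assms by (simp add: algebra_simps)
  have q: "1 / real j powr \<delta> \<le> 1" if "j \<ge> 1" for j
    using that \<delta> by (simp add: ge_one_powr_ge_zero)
  have a: "s N \<le> n (Suc N) * l" for N
  proof (induction N)
    case (Suc N)
    have "n (Suc N) * l \<le> n (Suc (Suc N)) * l"
      using growth_strict[of "Suc N"] assms by (intro mult_right_mono) auto
    with Suc step[of "Suc N"] show ?case by (auto simp: s_def low_wt_def)
  qed (use assms in \<open>auto simp: s_def low_wt_def\<close>)
  have "s N \<le> 2"
  proof (induction N)
    case (Suc N)
    have "1 / real (Suc N) powr \<delta> * (n (Suc N) * l) \<le> 1 * (n (Suc N) * l)"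
      using q[of "Suc N"] assms by (intro mult_right_mono) auto
    with Suc a[of N] show ?case by (auto simp: s_def low_wt_def)
  qed (simp add: s_def low_wt_def)
  thus ?thesis by (simp add: s_def)
qed

text \<open>Telescoping of 2 / (n_j l): a step from x to y \<ge> (1 + q) x with 0 < q \<le> 1 lowers
  2 / x by at least q / x, the term to be added.\<close>

lemma sum_high_frequencies:
  fixes l :: real
  assumes "0 < l"
  shows "(\<Sum>j=1..N. high_wt j l) \<le> 2"
proof -
  define s where "s N = (\<Sum>j=1..N. high_wt j l)" for N
  \<comment> \<open>Of the budget 2, the amount 2 / (n_{N+1} l) is still unspent; as long as
    \<open>n j * l\<close> stays below 1, nothing has been counted.\<close>
  have "s N \<le> (if n (Suc N) * l \<ge> 1 then 2 - 2 / (n (Suc N) * l) else 0)" for N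
  proof (induction N)
    case 0
    thus ?case using assms npos[of 1] by (auto simp: s_def field_simps)
  next
    case (Suc N)
    define x where "x = n (Suc N) * l"
    define y where "y = n (Suc (Suc N)) * l"
    define q where "q = 1 / real (Suc N) powr \<delta>"
    have q: "0 < q" "q \<le> 1" using \<delta> by (auto simp: q_def ge_one_powr_ge_zero)
    have x: "x > 0" using npos assms by (auto simp: x_def)
    have y: "y \<ge> (1 + q) * x"
      using mult_right_mono[OF growth[of "Suc N"], of l] assms by (simp add: algebra_simps x_def y_def q_def)
    have yx: "y \<ge> x" using y q x by (smt (verit) mult_le_cancel_right1)
    have s: "s (Suc N) = s N + (if x \<ge> 1 then q / x else 0)" by (simp add: s_def x_def q_def high_wt_def)
    show ?case
    proof (cases "x \<ge> 1")
      case True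
      have "2 / y \<le> 2 / ((1 + q) * x)" using y q x yx by (intro divide_left_mono mult_pos_pos) auto
      also have "\<dots> \<le> (2 - q) / x"
      proof -
        \<comment> \<open>Expands to q (1 - q) \<ge> 0. With c in place of 2 it would read q \<le> c
          - 1, so 2 is the value matching q \<le> 1.\<close>
        have "2 \<le> (2 - q) * (1 + q)" using q mult_nonneg_nonneg[of q "1 - q"] by (simp add: algebra_simps)
        hence "2 / (1 + q) \<le> 2 - q" using q by (simp add: pos_divide_le_eq)
        from divide_right_mono[OF this, of x] show ?thesis using x by (simp add: divide_divide_eq_left)
      qed
      finally show ?thesis using Suc True yx s unfolding x_def[symmetric] y_def[symmetric] by (simp add: diff_divide_distrib)
    next
      case False
      have "s (Suc N) \<le> 0" using False Suc s unfolding x_def[symmetric] by simp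
      moreover have "2 / y \<le> 2" if "y \<ge> 1" using that by (simp add: field_simps)
      ultimately show ?thesis unfolding y_def[symmetric] by force
    qed
  qed
  hence "s N \<le> (if n (Suc N) * l \<ge> 1 then 2 - 2 / (n (Suc N) * l) else 0)" .
  also have "\<dots> \<le> 2" using assms by (auto simp: field_simps)
  finally show ?thesis by (simp add: s_def)
qed

end

section \<open>The Cauchy kernel on the circle\<close>

text \<open>A crude form of Jordan's inequality: in sin x = 2 sin y cos y with y = x / 2 \<le> pi /
  4, both sin y / y and cos y are at least sqrt 2 / 2.\<close>

lemma sin_ge_half: assumes "0 \<le> x" "x \<le> pi / 2" shows "x / 2 \<le> sin x"
proof -
  define y where "y = x / 2"
  have y: "0 \<le> y" "y \<le> pi / 4" "x = 2 * y" using assms by (auto simp: y_def)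
  have c: "sqrt 2 / 2 \<le> cos z" if "0 \<le> z" "z \<le> y" for z
    using cos_monotone_0_pi_le[of z "pi/4"] that y by (simp add: cos_45)
  have "y * (sqrt 2 / 2) \<le> sin y"
  proof (cases "y = 0")
    case False
    then obtain z where z: "0 < z" "z < y" "sin y - sin 0 = (y - 0) * cos z"
      using MVT2[of 0 y sin cos] y by auto
    thus ?thesis using c[of z] y by (simp add: mult_left_mono)
  qed simp
  hence "(y * (sqrt 2 / 2)) * (sqrt 2 / 2) \<le> sin y * cos y"
    using c[of y] y sin_ge_zero[of y] by (intro mult_mono) auto
  moreover have "(y * (sqrt 2 / 2)) * (sqrt 2 / 2) = y / 2" by (simp add: mult.assoc[symmetric])
  moreover have "sin x = 2 * (sin y * cos y)" unfolding y(3) by (simp add: sin_double)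
  ultimately show ?thesis using y(3) by linarith
qed

text \<open>Distances on the circle are measured by the chord \<open>|cis s - cis t|\<close>, which takes care of periodicity.\<close>

lemma chord_eq: "cmod (cis s - cis t) = 2 * \<bar>sin ((s - t) / 2)\<bar>"
proof -
  have "cis s - cis t = cis t * (cis (s - t) - 1)" by (simp add: algebra_simps cis_mult)
  thus ?thesis using dist_exp_i_1[of "s - t"] by (simp add: norm_mult cis_conv_exp)
qed

lemma chord_le: "cmod (cis s - cis t) \<le> \<bar>s - t\<bar>"
  using abs_sin_x_le_abs_x[of "(s - t) / 2"] by (simp add: chord_eq)

lemma chord_ge: assumes "\<bar>s - t\<bar> \<le> pi" shows "\<bar>s - t\<bar> / 2 \<le> cmod (cis s - cis t)"
proof -
  have "\<bar>(s - t) / 2\<bar> / 2 \<le> sin \<bar>(s - t) / 2\<bar>" using assms by (intro sin_ge_half) auto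
  also have "\<dots> \<le> \<bar>sin ((s - t) / 2)\<bar>" by (cases "s \<ge> t") (auto simp: abs_if)
  finally show ?thesis by (simp add: chord_eq)
qed

section \<open>Poisson-type majorants\<close>

lemma cis_shift_2pi: "cis (x + 2 * pi) = cis x" "cis (x - 2 * pi) = cis x"
  by (auto simp: complex_eq_iff cos_diff sin_diff)

text \<open>The antiderivative 2 arctan ((x - c) / (2 l)) has total variation 2 pi for all c and l.
  The divisor 4 is the square of the constant in \<open>chord_ge\<close>.\<close>

lemma poisson_integral_bound:
  assumes "0 < l"
  shows "(LINT x|torusM. l / (l^2 + (x - c)^2 / 4)) \<le> 2 * pi"
proof -
  define F where "F x = 2 * arctan ((x - c) / (2 * l))" for x
  have "has_bochner_integral torusM (\<lambda>x. indicator {-pi..<pi} x *\<^sub>R (l / (l^2 + (x - c)^2 / 4))) (F pi - F (-pi))"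
  proof (rule has_bochner_integral_torusM_FTC)
    fix x
    have "(F has_real_derivative (2 * ((1 / (2 * l)) * inverse (1 + ((x - c) / (2 * l))^2)))) (at x within {-pi..pi})"
      unfolding F_def using assms by (auto intro!: derivative_eq_intros simp: field_simps)
    moreover have "(2 * ((1 / (2 * l)) * inverse (1 + ((x - c) / (2 * l))^2))) = l / (l^2 + (x - c)^2 / 4)"
    proof -
      have "1 + ((x - c) / (2 * l))^2 = (l^2 + (x - c)^2 / 4) / l^2"
        using assms by (simp add: field_simps)
      moreover have "2 * (1 / (2 * l) * inverse (D / l^2)) = l / D" for D
        using assms by (simp add: power2_eq_square field_simps)
      ultimately show ?thesis by simp
    qed
    ultimately show "(F has_vector_derivative l / (l^2 + (x - c)^2 / 4)) (at x within {-pi..pi})"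
      by (simp add: has_real_derivative_iff_has_vector_derivative)
  next
    have "l^2 + (x - c)^2 / 4 \<noteq> 0" for x
      using assms by (smt (verit) zero_less_power2 zero_le_power2 divide_nonneg_nonneg)
    thus "continuous_on {-pi..pi} (\<lambda>x. l / (l^2 + (x - c)^2 / 4))"
      by (intro continuous_intros) auto
  qed auto
  hence "has_bochner_integral torusM (\<lambda>x. l / (l^2 + (x - c)^2 / 4)) (F pi - F (-pi))"
    by (rule has_bochner_integral_cong[THEN iffD1, rotated -1]) auto
  hence "(LINT x|torusM. l / (l^2 + (x - c)^2 / 4)) = F pi - F (-pi)"
    by (simp add: has_bochner_integral_iff)
  also have "\<dots> \<le> 2 * pi"
    unfolding F_def using arctan_bounded[of "(pi - c) / (2 * l)"] arctan_bounded[of "(- pi - c) / (2 * l)"] by linarith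
  finally show ?thesis .
qed

lemma measurable_poisson [measurable]:
  "(\<lambda>x. l / (l^2 + (x - c)^2 / 4)) \<in> borel_measurable torusM"
  "(\<lambda>x. l / (l^2 + (cmod (cis x - cis c))^2)) \<in> borel_measurable torusM"
  by (rule borel_measurable_torusM; measurable)+

lemma integrable_poisson:
  assumes "0 < l"
  shows "integrable torusM (\<lambda>x. l / (l^2 + (x - c)^2 / 4))"
    "integrable torusM (\<lambda>x. l / (l^2 + (cmod (cis x - cis c))^2))"
proof -
  have *: "norm (l / (l^2 + z)) \<le> 1 / l" if "z \<ge> 0" for z
  proof -
    have "l / (l^2 + z) \<le> l / l^2" using assms that by (intro divide_left_mono) (auto intro!: mult_pos_pos add_pos_nonneg)
    thus ?thesis using assms that by (simp add: power2_eq_square)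
  qed
  show "integrable torusM (\<lambda>x. l / (l^2 + (x - c)^2 / 4))"
    by (rule integrable_torusM_bounded[where B = "1/l"]) (use * in auto)
  show "integrable torusM (\<lambda>x. l / (l^2 + (cmod (cis x - cis c))^2))"
    by (rule integrable_torusM_bounded[where B = "1/l"]) (use * in auto)
qed

text \<open>The chord does not see shifts by 2 pi, and every x on the torus lies within pi of c, c +
  2 pi or c - 2 pi; hence three kernels on the line, of mass at most 2 pi each.\<close>

lemma chord_poisson_integral_bound:
  assumes l: "0 < l" and c: "\<bar>c\<bar> \<le> pi"
  shows "(LINT x|torusM. l / (l^2 + (cmod (cis x - cis c))^2)) \<le> 6 * pi"
proof -
  let ?P = "\<lambda>c x. l / (l^2 + (x - c)^2 / 4)"
  have nn: "?P c x \<ge> 0" for c x using l by simp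
  have le: "l / (l^2 + (cmod (cis x - cis c))^2) \<le> ?P c' x" if "cis c' = cis c" "\<bar>x - c'\<bar> \<le> pi" for x c'
  proof -
    have "(\<bar>x - c'\<bar> / 2)^2 \<le> (cmod (cis x - cis c))^2"
      using chord_ge[OF that(2)] that(1) by (intro power_mono) auto
    thus ?thesis using l by (intro divide_left_mono mult_pos_pos add_pos_nonneg) (auto simp: power_divide)
  qed
  have "(LINT x|torusM. l / (l^2 + (cmod (cis x - cis c))^2)) \<le> (LINT x|torusM. ?P c x + ?P (c + 2 * pi) x + ?P (c - 2 * pi) x)"
  proof (rule integral_mono)
    fix x assume "x \<in> space torusM"
    hence x: "-pi \<le> x" "x < pi" by auto
    consider "\<bar>x - c\<bar> \<le> pi" | "\<bar>x - (c + 2 * pi)\<bar> \<le> pi" | "\<bar>x - (c - 2 * pi)\<bar> \<le> pi"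
      using x c by linarith
    thus "l / (l^2 + (cmod (cis x - cis c))^2) \<le> ?P c x + ?P (c + 2 * pi) x + ?P (c - 2 * pi) x"
    proof cases
      case 1
      show ?thesis using le[OF refl 1] nn[where c="c + 2 * pi" and x=x] nn[where c="c - 2 * pi" and x=x] by linarith
    next
      case 2
      show ?thesis using le[OF cis_shift_2pi(1) 2] nn[where c="c" and x=x] nn[where c="c - 2 * pi" and x=x] by linarith
    next
      case 3
      show ?thesis using le[OF cis_shift_2pi(2) 3] nn[where c="c + 2 * pi" and x=x] nn[where c="c" and x=x] by linarith
    qed
  qed (intro integrable_poisson Bochner_Integration.integrable_add l)+
  also have "\<dots> = (LINT x|torusM. ?P c x) + (LINT x|torusM. ?P (c + 2 * pi) x) + (LINT x|torusM. ?P (c - 2 * pi) x)"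
    by (simp only: Bochner_Integration.integral_add integrable_poisson[OF l] Bochner_Integration.integrable_add)
  also have "\<dots> \<le> 6 * pi"
    using poisson_integral_bound[OF l, of c] poisson_integral_bound[OF l, of "c + 2 * pi"] poisson_integral_bound[OF l, of "c - 2 * pi"] by linarith
  finally show ?thesis .
qed

text \<open>Formally minus the geometric series of \<open>cis (k * u)\<close> over k \<ge> 0, so
  convolution with it is, up to a negative factor, the projection onto nonnegative frequencies. At
  multiples of 2 pi the value is the default 0.\<close>

definition ckern :: "real \<Rightarrow> complex" where "ckern u = 1 / (cis u - 1)"

lemma ckern_chord: "cmod (ckern (x - t)) = 1 / cmod (cis x - cis t)"
proof -
  have "cis x - cis t = cis t * (cis (x - t) - 1)" by (simp add: algebra_simps cis_mult)
  thus ?thesis by (simp add: ckern_def norm_divide norm_mult)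
qed

lemma cis_neq_iff: "cis (x - t) - 1 = 0 \<longleftrightarrow> cis x = cis t"
proof -
  have "cis x - cis t = cis t * (cis (x - t) - 1)" by (simp add: algebra_simps cis_mult)
  thus ?thesis by (metis eq_iff_diff_eq_0 mult_eq_0_iff cis_neq_zero)
qed

text \<open>Resolvent identity: the difference of two reciprocals is the difference of the
  denominators times both reciprocals.\<close>

lemma ckern_diff:
  assumes "cis x \<noteq> cis t" "cis x \<noteq> cis s"
  shows "cmod (ckern (x - t) - ckern (x - s)) \<le> \<bar>s - t\<bar> / (cmod (cis x - cis t) * cmod (cis x - cis s))"
proof -
  have "ckern (x - t) - ckern (x - s) = (cis (x - s) - cis (x - t)) * (ckern (x - t) * ckern (x - s))"
    using assms by (simp add: ckern_def field_simps cis_neq_iff[symmetric])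
  hence "cmod (ckern (x - t) - ckern (x - s)) = cmod (cis (x - s) - cis (x - t)) * (1 / cmod (cis x - cis t) * (1 / cmod (cis x - cis s)))"
    by (simp add: norm_mult ckern_chord)
  also have "\<dots> \<le> \<bar>s - t\<bar> * (1 / cmod (cis x - cis t) * (1 / cmod (cis x - cis s)))"
    using chord_le[of "x - s" "x - t"] by (intro mult_right_mono) (auto simp: abs_minus_commute)
  finally show ?thesis by simp
qed

abbreviation dirichlet :: "nat \<Rightarrow> real \<Rightarrow> complex" where
  "dirichlet n u \<equiv> \<Sum>k=-int n..int n. cis (of_int k * u)"

text \<open>The functions \<open>cis (m * u) * ckern u\<close> have increments
  \<open>cis (m * u)\<close>, whose doubled real part is the pair of terms added to the kernel. All
  dependence on n now sits in one modulation, whose frequency n + 1 is the shift seen in everything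
  that follows.\<close>

lemma dirichlet_kernel_eq_ckern:
  assumes "cis u \<noteq> 1"
  shows "dirichlet n u = of_real (2 * Re (cis (real (n + 1) * u) * ckern u))"
proof (induction n)
  case 0
  define z where "z = cis u"
  have z: "z \<noteq> 1" "Re z ^ 2 + Im z ^ 2 = 1" using assms by (auto simp: z_def)
  hence "Re z \<noteq> 1" by (auto simp: complex_eq_iff)
  moreover have d: "(Re z - 1)^2 + (Im z)^2 = 2 * (1 - Re z)" using z by (simp add: power2_eq_square algebra_simps)
  moreover have "Re z * (Re z - 1) + Im z * Im z = 1 - Re z" using z by (simp add: power2_eq_square algebra_simps)
  \<comment> \<open>On the unit circle z / (z - 1) has real part 1/2.\<close>
  ultimately have "2 * Re (z * (1 / (z - 1))) = 1"
    by (simp add: Re_divide d) 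
  thus ?case by (simp add: z_def ckern_def)
next
  case (Suc n)
  have eq: "{-int (Suc n)..int (Suc n)} = insert (int (Suc n)) (insert (- int (Suc n)) {-int n..int n})" by auto
  have "dirichlet (Suc n) u = cis (real (Suc n) * u) + cis (- (real (Suc n) * u)) + dirichlet n u"
    unfolding eq by (subst sum.insert) (auto simp: algebra_simps)
  also have "cis (real (Suc n) * u) + cis (- (real (Suc n) * u)) = of_real (2 * Re (cis (real (Suc n) * u)))"
    by (simp add: complex_eq_iff)
  also have "cis (real (Suc n) * u) = cis (real (Suc n + 1) * u) * ckern u - cis (real (n + 1) * u) * ckern u"
  proof -
    have "cis (real (Suc n + 1) * u) = cis (real (Suc n) * u) * cis u" by (simp add: cis_mult algebra_simps)
    moreover have "w * cis u * ckern u - w * ckern u = w" for w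
    proof -
      have "w * cis u * ckern u - w * ckern u = w * ((cis u - 1) * ckern u)" by (simp add: algebra_simps)
      also have "(cis u - 1) * ckern u = 1" using assms by (simp add: ckern_def)
      finally show ?thesis by simp
    qed
    ultimately show ?thesis by simp
  qed
  also have "complex_of_real (2 * Re (cis (real (Suc n + 1) * u) * ckern u - cis (real (n + 1) * u) * ckern u)) + dirichlet n u
      = of_real (2 * Re (cis (real (Suc n + 1) * u) * ckern u))"
    unfolding Suc of_real_add[symmetric] minus_complex.simps by (simp only: right_diff_distrib diff_add_cancel)
  finally show ?case .
qed

text \<open>Adding w of modulus 1 to the sum s raises its squared modulus by 2 Re (s * cnj w) + 1,
  which is the next Dirichlet kernel. As a squared modulus the kernel is visibly nonnegative, its
  integral follows from Parseval, and u = 0 is no exception.\<close>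

lemma fejer_kernel_eq:
  "(\<Sum>m\<le>n. \<Sum>k=-int m..int m. cis (of_int k * u)) = of_real ((cmod (\<Sum>k\<in>{0..int n}. cis (of_int k * u)))^2)"
proof (induction n)
  case (Suc n)
  define s where "s = (\<Sum>k\<in>{0..int n}. cis (of_int k * u))"
  define w where "w = cis (real (Suc n) * u)"
  have s': "(\<Sum>k\<in>{0..int (Suc n)}. cis (of_int k * u)) = s + w"
  proof -
    have "{0..int (Suc n)} = insert (int (Suc n)) {0..int n}" by auto
    thus ?thesis by (simp add: s_def w_def add_ac)
  qed
  have d: "dirichlet m u = of_real (1 + 2 * Re (\<Sum>k\<in>{1..int m}. cis (of_int k * u)))" for m
  proof (induction m)
    case (Suc m)
    have eq: "{-int (Suc m)..int (Suc m)} = insert (int (Suc m)) (insert (- int (Suc m)) {-int m..int m})"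
      "{1..int (Suc m)} = insert (int (Suc m)) {1..int m}" by auto
    define z where "z = cis (of_int (int (Suc m)) * u)"
    have neg: "cis (of_int (- int (Suc m)) * u) = cnj z" by (simp add: cis_cnj z_def algebra_simps)
    have "dirichlet (Suc m) u = z + (cis (of_int (- int (Suc m)) * u) + dirichlet m u)"
      unfolding eq z_def by simp
    also have "\<dots> = of_real (2 * Re z) + of_real (1 + 2 * Re (\<Sum>k\<in>{1..int m}. cis (of_int k * u)))"
      unfolding neg Suc add.assoc[symmetric] complex_add_cnj ..
    also have "\<dots> = of_real (1 + 2 * Re (z + (\<Sum>k\<in>{1..int m}. cis (of_int k * u))))"
      by simp
    also have "z + (\<Sum>k\<in>{1..int m}. cis (of_int k * u)) = (\<Sum>k\<in>{1..int (Suc m)}. cis (of_int k * u))"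
      unfolding eq z_def by simp
    finally show ?case .
  qed simp
  have "s * cnj w = (\<Sum>k\<in>{0..int n}. cis (of_int k * u - real (Suc n) * u))"
    unfolding s_def w_def by (simp add: sum_distrib_right cis_cnj cis_mult)
  \<comment> \<open>The substitution k -> n + 1 - k turns the cross term into one half of the next
    Dirichlet kernel.\<close>
  also have "\<dots> = (\<Sum>k\<in>{1..int (Suc n)}. cis (- (of_int k * u)))"
    by (rule sum.reindex_bij_witness[of _ "\<lambda>k. int (Suc n) - k" "\<lambda>k. int (Suc n) - k"])
       (auto simp: algebra_simps)
  finally have "Re (s * cnj w) = Re (\<Sum>k\<in>{1..int (Suc n)}. cis (of_int k * u))" by (simp add: )
  moreover have "(cmod (s + w))^2 = (cmod s)^2 + 2 * Re (s * cnj w) + (cmod w)^2"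
    unfolding cmod_power2 by (simp add: power2_eq_square algebra_simps)
  moreover have "cmod w = 1" by (simp add: w_def)
  ultimately show ?case unfolding sum.atMost_Suc Suc.IH s' d[of "Suc n"] s_def[symmetric] by simp
qed simp


text \<open>\<open>F\<close> vanishes at both ends, so there are no boundary terms; the decay in
  frequency of bumps and of smeared kernels comes from here.\<close>

lemma integral_by_parts_cis:
  fixes F F' :: "real \<Rightarrow> complex"
  assumes ab: "- pi \<le> a" "a \<le> b" "b \<le> pi"
    and der: "\<And>x. a \<le> x \<Longrightarrow> x \<le> b \<Longrightarrow> (F has_vector_derivative F' x) (at x within {a..b})"
    and cont: "continuous_on {a..b} F'" and zero: "F a = 0" "F b = 0"
  shows "\<i> * of_real m * (LINT s|torusM. (indicator {a..<b} s *\<^sub>R F s) * cis (- (m * s)))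
    = (LINT s|torusM. (indicator {a..<b} s *\<^sub>R F' s) * cis (- (m * s)))"
proof -
  have contF: "continuous_on {a..b} F"
    using der by (intro continuous_on_vector_derivative) auto
  define G where "G s = F s * cis (- (m * s))" for s
  define A where "A s = F' s * cis (- (m * s))" for s
  have contA: "continuous_on {a..b} A" "continuous_on {a..b} G"
    unfolding A_def G_def by (intro continuous_intros cont contF)+
  have int: "integrable torusM (\<lambda>x. indicator {a..<b} x *\<^sub>R H x)" if H: "continuous_on {a..b} H" for H :: "real \<Rightarrow> complex"
  proof -
    \<comment> \<open>The antiderivative is used only to read off integrability from the fundamental
      theorem.\<close>
    obtain P where P: "\<And>x. x \<in> {a..b} \<Longrightarrow> (P has_vector_derivative H x) (at x within {a..b})"
      using antiderivative_continuous[OF H] by blast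
    have "has_bochner_integral torusM (\<lambda>x. indicator {a..<b} x *\<^sub>R H x) (P b - P a)"
      using ab P H by (intro has_bochner_integral_torusM_FTC) auto
    thus ?thesis by (rule integrable.intros)
  qed
  have "has_bochner_integral torusM (\<lambda>x. indicator {a..<b} x *\<^sub>R (A x - \<i> * of_real m * G x)) (G b - G a)"
  proof (rule has_bochner_integral_torusM_FTC[OF ab])
    fix x assume x: "a \<le> x" "x \<le> b"
    have "((\<lambda>s. cis (- (m * s))) has_vector_derivative (- (\<i> * of_real m * cis (- (m * x))))) (at x within {a..b})"
      by (auto intro!: derivative_eq_intros simp: has_vector_derivative_def scaleR_conv_of_real field_simps)
    from has_vector_derivative_mult[OF der[OF x] this]
    show "(G has_vector_derivative (A x - \<i> * of_real m * G x)) (at x within {a..b})"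
      unfolding G_def A_def by (simp add: algebra_simps)
  qed (intro continuous_intros contA)
  hence "(LINT x|torusM. indicator {a..<b} x *\<^sub>R A x - \<i> * of_real m * (indicator {a..<b} x *\<^sub>R G x)) = 0"
    using zero by (simp add: has_bochner_integral_iff G_def scaleR_diff_right)
  also have "(LINT x|torusM. indicator {a..<b} x *\<^sub>R A x - \<i> * of_real m * (indicator {a..<b} x *\<^sub>R G x))
     = (LINT x|torusM. indicator {a..<b} x *\<^sub>R A x) - \<i> * of_real m * (LINT x|torusM. indicator {a..<b} x *\<^sub>R G x)"
    by (simp only: Bochner_Integration.integral_diff int[OF contA(1)] int[OF contA(2)] integrable_mult_right integral_mult_right_zero)
  finally show ?thesis by (simp add: A_def G_def scaleR_conv_of_real mult_ac)
qed

text \<open>A parabola that vanishes at both ends, which is enough for one integration by parts; the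
  factor 6 / l^3 normalises its integral over the interval to 1.\<close>

definition bump :: "real \<Rightarrow> real \<Rightarrow> real \<Rightarrow> real" where
  "bump c l s = 6 * (s - c) * (c + l - s) / l ^ 3"

definition bump' :: "real \<Rightarrow> real \<Rightarrow> real \<Rightarrow> real" where
  "bump' c l s = 6 * (2 * c + l - 2 * s) / l ^ 3"

lemma bump_deriv: "(bump c l has_real_derivative bump' c l s) (at s within S)"
  unfolding bump_def [abs_def] bump'_def
  by (intro DERIV_cdivide) (auto intro!: derivative_eq_intros simp: algebra_simps)

lemma bump_zero: "bump c l c = 0" "bump c l (c + l) = 0"
  by (auto simp: bump_def)

lemma bump_bounds:
  assumes "0 < l" "c \<le> s" "s \<le> c + l"
  shows "0 \<le> bump c l s" "bump c l s \<le> 2 / l" "\<bar>bump' c l s\<bar> \<le> 6 / l^2"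
proof -
  show "0 \<le> bump c l s" using assms by (simp add: bump_def)
  have "(s - c) * (c + l - s) \<le> l^2 / 4"
  proof -
    have "l^2 / 4 - (s - c) * (c + l - s) = (s - c - l / 2)^2" by (simp add: power2_eq_square field_simps)
    thus ?thesis by (smt (verit) zero_le_power2)
  qed
  hence "bump c l s \<le> 6 * (l^2 / 4) / l ^ 3" unfolding bump_def mult.assoc using assms by (intro divide_right_mono mult_left_mono) auto
  also have "\<dots> \<le> 2 / l" using assms by (simp add: power2_eq_square power3_eq_cube field_simps)
  finally show "bump c l s \<le> 2 / l" .
  have "\<bar>bump' c l s\<bar> = 6 * \<bar>2 * c + l - 2 * s\<bar> / l ^ 3" unfolding bump'_def abs_divide abs_mult using assms by simp
  also have "\<dots> \<le> 6 * l / l ^ 3" using assms by (intro divide_right_mono) auto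
  also have "\<dots> = 6 / l^2" using assms by (simp add: power2_eq_square power3_eq_cube)
  finally show "\<bar>bump' c l s\<bar> \<le> 6 / l^2" .
qed

lemma bump_integral:
  assumes "- pi \<le> c" "0 < l" "c + l \<le> pi"
  shows "has_bochner_integral torusM (\<lambda>s. indicator {c..<c + l} s *\<^sub>R bump c l s) 1"
proof -
  define F where "F s = (3 * (s - c)^2 * l - 2 * (s - c) ^ 3) / l ^ 3" for s
  have "has_bochner_integral torusM (\<lambda>s. indicator {c..<c + l} s *\<^sub>R bump c l s) (F (c + l) - F c)"
  proof (rule has_bochner_integral_torusM_FTC)
    fix x
    have "(F has_real_derivative (3 * (2 * (x - c)) * l - 2 * (3 * (x - c)^2)) / l ^ 3) (at x within {c..c + l})"
      unfolding F_def by (intro DERIV_cdivide) (auto intro!: derivative_eq_intros)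
    also have "3 * (2 * (x - c)) * l - 2 * (3 * (x - c)^2) = 6 * (x - c) * (c + l - x)"
      by (simp add: power2_eq_square algebra_simps)
    also have "6 * (x - c) * (c + l - x) / l ^ 3 = bump c l x" by (simp add: bump_def)
    finally have "(F has_real_derivative bump c l x) (at x within {c..c + l})" .
    thus "(F has_vector_derivative bump c l x) (at x within {c..c + l})"
      by (simp add: has_real_derivative_iff_has_vector_derivative)
  next
    show "continuous_on {c..c + l} (bump c l)" unfolding bump_def using assms by (intro continuous_intros) auto
  qed (use assms in auto)
  moreover have "F (c + l) - F c = 1"
  proof -
    have "3 * l^2 * l - 2 * l ^ 3 = l ^ 3" by (simp add: power2_eq_square power3_eq_cube)
    thus ?thesis using assms by (simp add: F_def)
  qed
  ultimately show ?thesis by simp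
qed

section \<open>Partial sums and Fejer means\<close>

lemma fourier_coeff_eq: "fourier_coeff f k = tcoeff f k / (2 * of_real pi)"
proof -
  have "exp (- \<i> * of_int k * of_real t) = cis (- (of_int k * t))" for t
    by (simp add: cis_conv_exp mult_ac)
  thus ?thesis
    unfolding fourier_coeff_def tcoeff_def set_lebesgue_integral_def
    by (subst integral_restrict_space) auto
qed

lemma fourier_partial_sum_eq:
  "fourier_partial_sum n f y = (\<Sum>k=-int n..int n. tcoeff f k * cis (of_int k * y)) / (2 * of_real pi)"
  unfolding fourier_partial_sum_def fourier_coeff_eq sum_divide_distrib
  by (intro sum.cong) (auto simp: cis_conv_exp mult_ac)

section \<open>Linearity of coefficients and partial sums\<close>

lemma integrable_tcoeff:
  assumes "integrable torusM f"
  shows "integrable torusM (\<lambda>t. f t * cis (- (of_int k * t)))"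
  by (rule integrable_mult_cis[OF assms]) measurable

lemma tcoeff_norm_le: "cmod (tcoeff f k) \<le> (LINT t|torusM. cmod (f t))"
  unfolding tcoeff_def by (rule order.trans[OF integral_norm_bound]) (simp add: norm_mult)

lemma tcoeff_add:
  "integrable torusM f \<Longrightarrow> integrable torusM g \<Longrightarrow> tcoeff (\<lambda>t. f t + g t) k = tcoeff f k + tcoeff g k"
  unfolding tcoeff_def by (simp add: distrib_right integrable_tcoeff)

lemma tcoeff_diff:
  "integrable torusM f \<Longrightarrow> integrable torusM g \<Longrightarrow> tcoeff (\<lambda>t. f t - g t) k = tcoeff f k - tcoeff g k"
  unfolding tcoeff_def by (simp add: left_diff_distrib integrable_tcoeff)

lemma tcoeff_cmult: "tcoeff (\<lambda>t. c * f t) k = c * tcoeff f k"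
  unfolding tcoeff_def by (simp add: mult.assoc)

lemma tcoeff_sum:
  assumes "\<And>i. i \<in> I \<Longrightarrow> integrable torusM (f i)"
  shows "tcoeff (\<lambda>t. \<Sum>i\<in>I. f i t) k = (\<Sum>i\<in>I. tcoeff (f i) k)"
  unfolding tcoeff_def sum_distrib_right
  by (intro Bochner_Integration.integral_sum integrable_tcoeff assms)

lemma fourier_partial_sum_integral:
  assumes "integrable torusM f"
  shows "fourier_partial_sum n f y = (LINT t|torusM. f t * dirichlet n (y - t)) / (2 * of_real pi)"
proof -
  have "(\<Sum>k=-int n..int n. tcoeff f k * cis (of_int k * y))
    = (LINT t|torusM. (\<Sum>k=-int n..int n. f t * cis (- (of_int k * t)) * cis (of_int k * y)))"
    unfolding tcoeff_def
    by (subst Bochner_Integration.integral_sum) (auto intro!: integrable_tcoeff assms)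
  also have "\<dots> = (LINT t|torusM. f t * dirichlet n (y - t))"
    by (simp add: sum_distrib_left mult.assoc cis_mult algebra_simps)
  finally show ?thesis by (simp add: fourier_partial_sum_eq)
qed

lemma fourier_partial_sum_add:
  "integrable torusM f \<Longrightarrow> integrable torusM g \<Longrightarrow>
    fourier_partial_sum n (\<lambda>t. f t + g t) y = fourier_partial_sum n f y + fourier_partial_sum n g y"
  by (simp add: fourier_partial_sum_eq tcoeff_add distrib_right sum.distrib add_divide_distrib)

lemma fourier_partial_sum_diff:
  "integrable torusM f \<Longrightarrow> integrable torusM g \<Longrightarrow>
    fourier_partial_sum n (\<lambda>t. f t - g t) y = fourier_partial_sum n f y - fourier_partial_sum n g y"
  by (simp add: fourier_partial_sum_eq tcoeff_diff left_diff_distrib sum_subtractf diff_divide_distrib)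

lemma fourier_partial_sum_cmult:
  "fourier_partial_sum n (\<lambda>t. c * f t) y = c * fourier_partial_sum n f y"
  by (simp add: fourier_partial_sum_eq tcoeff_cmult sum_distrib_left mult.assoc)

lemma fourier_partial_sum_sum:
  assumes "\<And>i. i \<in> I \<Longrightarrow> integrable torusM (f i)"
  shows "fourier_partial_sum n (\<lambda>t. \<Sum>i\<in>I. f i t) y = (\<Sum>i\<in>I. fourier_partial_sum n (f i) y)"
proof -
  have "(\<Sum>k=-int n..int n. tcoeff (\<lambda>t. \<Sum>i\<in>I. f i t) k * cis (of_int k * y))
    = (\<Sum>i\<in>I. \<Sum>k=-int n..int n. tcoeff (f i) k * cis (of_int k * y))"
    by (subst sum.swap) (simp add: tcoeff_sum[OF assms] sum_distrib_right)
  thus ?thesis by (simp add: fourier_partial_sum_eq sum_divide_distrib)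
qed

text \<open>The term k occurs for m = |k|, ..., n, that is n + 1 - |k| times: the Fejer weights
  before normalisation.\<close>

lemma sum_symmetric_partial_sums:
  fixes a :: "int \<Rightarrow> complex"
  shows "(\<Sum>m\<le>n. \<Sum>k=-int m..int m. a k) = (\<Sum>k=-int n..int n. of_real (real n + 1 - \<bar>of_int k\<bar>) * a k)"
proof (induction n)
  case (Suc n)
  let ?J = "{-int n..int n}"
  have eq: "{-int (Suc n)..int (Suc n)} = insert (int (Suc n)) (insert (- int (Suc n)) ?J)" by auto
  have "(\<Sum>k=-int (Suc n)..int (Suc n). of_real (real (Suc n) + 1 - \<bar>of_int k\<bar>) * a k)
    = a (int (Suc n)) + (a (- int (Suc n)) + (\<Sum>k\<in>?J. of_real (real (Suc n) + 1 - \<bar>of_int k\<bar>) * a k))"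
    unfolding eq by (subst sum.insert; simp)
  also have "(\<Sum>k\<in>?J. of_real (real (Suc n) + 1 - \<bar>of_int k\<bar>) * a k)
     = (\<Sum>k\<in>?J. of_real (real n + 1 - \<bar>of_int k\<bar>) * a k) + (\<Sum>k\<in>?J. a k)"
    by (simp add: sum.distrib[symmetric] algebra_simps)
  also have "a (int (Suc n)) + (a (- int (Suc n)) + ((\<Sum>k\<in>?J. of_real (real n + 1 - \<bar>of_int k\<bar>) * a k) + (\<Sum>k\<in>?J. a k)))
     = (\<Sum>k\<in>?J. of_real (real n + 1 - \<bar>of_int k\<bar>) * a k) + (\<Sum>k=-int (Suc n)..int (Suc n). a k)"
    unfolding eq by simp
  finally show ?case using Suc by simp
qed simp

text \<open>The part of \<open>S_n g\<close> that is left after subtracting the \<open>n\<close>th Fejer mean.\<close>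

definition fejer_rest :: "nat \<Rightarrow> (real \<Rightarrow> complex) \<Rightarrow> real \<Rightarrow> complex" where
  "fejer_rest n g x = (\<Sum>k=-int n..int n. (of_real (\<bar>of_int k\<bar> / (real n + 1)) * (tcoeff g k / (2 * of_real pi))) * cis (of_int k * x))"

text \<open>Times n + 1, the difference is the sum of the partial sums of orders 0 to n, hence an
  integral of g against the nonnegative Fejer kernel. An average cannot exceed the bound on
  g.\<close>

lemma fejer_mean_bound:
  assumes g [measurable]: "g \<in> borel_measurable torusM" and B: "\<And>t. t \<in> torus \<Longrightarrow> cmod (g t) \<le> B"
  shows "cmod (fourier_partial_sum n g x - fejer_rest n g x) \<le> B"
proof -
  have gi: "integrable torusM g" using g B by (rule integrable_torusM_bounded)
  define F where "F t = (cmod (\<Sum>k\<in>{0..int n}. cis (of_int k * (x - t))))^2" for t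
  \<comment> \<open>As a polynomial in t the kernel has n + 1 coefficients of modulus 1; Parseval
    then gives its mass 2 pi (n + 1).\<close>
  have "(\<Sum>k\<in>{0..int n}. cis (of_int k * (x - t))) = (\<Sum>k\<in>{-int n..0}. cis (- (of_int k * x)) * cis (of_int k * t))" for t
    by (rule sum.reindex_bij_witness[of _ "\<lambda>k. -k" "\<lambda>k. -k"]) (auto simp: cis_mult algebra_simps)
  hence F: "has_bochner_integral torusM F (2 * pi * (real n + 1))"
    using parseval_trig[of "{-int n..0}" "\<lambda>k. cis (- (of_int k * x))"] by (simp add: F_def [abs_def])
  have "of_real (real n + 1) * (fourier_partial_sum n g x - fejer_rest n g x)
    = (\<Sum>k=-int n..int n. of_real (real n + 1 - \<bar>of_int k\<bar>) * (tcoeff g k / (2 * of_real pi) * cis (of_int k * x)))"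
  proof -
    have "of_real (real n + 1) * (z - of_real (\<bar>of_int k\<bar> / (real n + 1)) * z) = of_real (real n + 1 - \<bar>of_int k\<bar>) * z" for z :: complex and k :: int
    proof -
      have gen: "of_real a * (z - of_real b * z) = of_real (a * (1 - b)) * z" for a b
        by (simp add: algebra_simps)
      have "of_real (real n + 1) * (z - of_real (\<bar>of_int k\<bar> / (real n + 1)) * z) = of_real ((real n + 1) * (1 - (\<bar>of_int k\<bar> / (real n + 1)))) * z"
        by (rule gen)
      also have "(real n + 1) * (1 - (\<bar>of_int k\<bar> / (real n + 1))) = real n + 1 - \<bar>of_int k\<bar>"
        by (simp add: field_simps)
      finally show ?thesis .
    qed
    from this[of "tcoeff g k / (2 * of_real pi) * cis (of_int k * x)" k for k] show ?thesis
      unfolding fourier_partial_sum_eq fejer_rest_def sum_divide_distrib sum_subtractf[symmetric] sum_distrib_left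
      by (intro sum.cong refl) (simp add: mult.assoc)
  qed
  also have "\<dots> = (\<Sum>m\<le>n. fourier_partial_sum m g x)"
    unfolding sum_symmetric_partial_sums[symmetric] fourier_partial_sum_eq sum_divide_distrib by simp
  also have "\<dots> = (LINT t|torusM. (\<Sum>m\<le>n. g t * dirichlet m (x - t))) / (2 * of_real pi)"
    unfolding fourier_partial_sum_integral[OF gi] sum_divide_distrib[symmetric]
    by (subst Bochner_Integration.integral_sum) (auto simp: sum_distrib_left intro!: integrable_mult_cis gi)
  also have "(\<lambda>t. \<Sum>m\<le>n. g t * dirichlet m (x - t)) = (\<lambda>t. g t * of_real (F t))"
    unfolding sum_distrib_left[symmetric] fejer_kernel_eq F_def ..
  finally have eq: "of_real (real n + 1) * (fourier_partial_sum n g x - fejer_rest n g x) = (LINT t|torusM. g t * of_real (F t)) / (2 * of_real pi)" .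
  have Fi: "integrable torusM F" using F by (rule integrable.intros)
  have F0: "F t \<ge> 0" for t by (simp add: F_def)
  have "cmod (LINT t|torusM. g t * of_real (F t)) \<le> (LINT t|torusM. cmod (g t * of_real (F t)))"
    by simp
  also have "\<dots> \<le> (LINT t|torusM. B * F t)"
  proof (rule integral_mono_AE')
    show "integrable torusM (\<lambda>t. B * F t)" using Fi by simp
    show "AE t in torusM. cmod (g t * of_real (F t)) \<le> B * F t"
      by (rule AE_I2) (use B F0 in \<open>auto simp: norm_mult intro!: mult_right_mono\<close>)
    show "AE t in torusM. 0 \<le> B * F t"
      by (rule AE_I2) (use B F0 order.trans[OF norm_ge_zero B] in \<open>auto intro!: mult_nonneg_nonneg\<close>)
  qed
  also have "\<dots> = B * (2 * pi * (real n + 1))" using F by (simp add: has_bochner_integral_iff)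
  finally have "cmod (of_real (real n + 1) * (fourier_partial_sum n g x - fejer_rest n g x)) \<le> B * (2 * pi * (real n + 1)) / (2 * pi)"
    unfolding eq norm_divide by (simp add: field_simps)
  hence "(real n + 1) * cmod (fourier_partial_sum n g x - fejer_rest n g x) \<le> (real n + 1) * B"
    unfolding norm_mult norm_of_real by simp
  thus ?thesis by (rule mult_left_le_imp_le) simp
qed

context sparse_sequence
begin

text \<open>After exchanging the sums, the frequency k collects the squared multipliers of all j
  with n_j \<ge> |k|. With weights 1 / j they are dominated by \<open>high_wt j (1 / |k|)\<close>,
  so their total is at most 2, and Bessel finishes.\<close>

lemma fejer_rest_square_sum:
  assumes g [measurable]: "g \<in> borel_measurable torusM" and B: "\<And>t. t \<in> torus \<Longrightarrow> cmod (g t) \<le> B"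
  shows "(\<Sum>j=1..N. (1 / real j) * (l2_int (fejer_rest (n j) g))) \<le> 2 * (l2_int g)"
proof -
  define A where "A k = (cmod (tcoeff g k))^2 / (4 * pi^2)" for k
  define m where "m = n N"
  let ?K = "{-int m..int m}"
  have L2: "(l2_int (fejer_rest q g)) = 2 * pi * (\<Sum>k=-int q..int q. (\<bar>of_int k\<bar> / (real q + 1))^2 * A k)" for q
  proof -
    have "(l2_int (fejer_rest q g)) = 2 * pi * (\<Sum>k=-int q..int q. (cmod (of_real (\<bar>of_int k\<bar> / (real q + 1)) * (tcoeff g k / (2 * of_real pi))))^2)"
      unfolding fejer_rest_def by (rule has_bochner_integral_integral_eq, rule parseval_trig) simp
    also have "(\<Sum>k=-int q..int q. (cmod (of_real (\<bar>of_int k\<bar> / (real q + 1)) * (tcoeff g k / (2 * of_real pi))))^2) = (\<Sum>k=-int q..int q. (\<bar>of_int k\<bar> / (real q + 1))^2 * A k)"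
      unfolding A_def
      by (intro sum.cong refl)
         (simp only: norm_mult norm_of_real norm_divide power_mult_distrib power_divide power2_abs norm_numeral, simp add: field_simps)
    finally show ?thesis .
  qed
  have A0: "A k \<ge> 0" for k by (simp add: A_def)
  have "(1 / real j) * (\<Sum>k=-int (n j)..int (n j). (\<bar>of_int k\<bar> / (real (n j) + 1))^2 * A k)
     \<le> (\<Sum>k\<in>?K. high_wt j (1 / \<bar>of_int k\<bar>) * A k)" (is "?l \<le> ?r") if j: "j \<in> {1..N}" for j
  proof -
    have nj: "n j \<le> m" unfolding m_def using j growth_mono[of j N] by auto
    have nj0: "n j > 0" using npos j by auto
    have "?l = (\<Sum>k=-int (n j)..int (n j). (1 / real j) * (\<bar>of_int k\<bar> / (real (n j) + 1))^2 * A k)"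
      by (simp add: sum_distrib_left mult.assoc)
    also have "\<dots> \<le> (\<Sum>k=-int (n j)..int (n j). high_wt j (1 / \<bar>of_int k\<bar>) * A k)"
    proof (rule sum_mono)
      fix k assume k: "k \<in> {-int (n j)..int (n j)}"
      \<comment> \<open>Of the two factors |k| / (n_j + 1) one is at most 1 and is given up. For k =
        0 both sides vanish, as 1 / 0 = 0 makes \<open>high_wt\<close> zero.\<close>
      have "(1 / real j) * (\<bar>of_int k\<bar> / (real (n j) + 1))^2 \<le> high_wt j (1 / \<bar>of_int k\<bar>)"
      proof (cases "k = 0")
        case False
        have kn: "\<bar>of_int k\<bar> \<le> real (n j)" using k by auto
        hence "1 \<le> n j * (1 / \<bar>of_int k\<bar>)" using False by (simp add: field_simps)
        moreover have "(1 / real j) * (\<bar>of_int k\<bar> / (real (n j) + 1))^2 \<le> 1 / real j powr \<delta> * (\<bar>of_int k\<bar> / real (n j))"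
        proof (rule mult_mono)
          show "1 / real j \<le> 1 / real j powr \<delta>" using j \<delta> by (intro powr_ge_one_div) auto
          have "(\<bar>of_int k\<bar> / (real (n j) + 1))^2 \<le> \<bar>of_int k\<bar> / (real (n j) + 1)"
            unfolding power2_eq_square using kn by (intro mult_left_le) (auto simp: field_simps)
          also have "\<dots> \<le> \<bar>of_int k\<bar> / real (n j)" using nj0 by (intro divide_left_mono) auto
          finally show "(\<bar>of_int k\<bar> / (real (n j) + 1))^2 \<le> \<bar>of_int k\<bar> / real (n j)" .
        qed auto
        ultimately show ?thesis by (simp add: high_wt_def)
      qed (simp add: high_wt_def)
      thus "(1 / real j) * (\<bar>of_int k\<bar> / (real (n j) + 1))^2 * A k \<le> high_wt j (1 / \<bar>of_int k\<bar>) * A k"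
        using A0 by (rule mult_right_mono)
    qed
    also have "\<dots> \<le> ?r" using nj A0 by (intro sum_mono2) (auto simp: high_wt_def)
    finally show ?thesis .
  qed
  hence "(\<Sum>j=1..N. (1 / real j) * (\<Sum>k=-int (n j)..int (n j). (\<bar>of_int k\<bar> / (real (n j) + 1))^2 * A k))
     \<le> (\<Sum>j=1..N. \<Sum>k\<in>?K. high_wt j (1 / \<bar>of_int k\<bar>) * A k)"
    by (rule sum_mono)
  also have "\<dots> = (\<Sum>k\<in>?K. (\<Sum>j=1..N. high_wt j (1 / \<bar>of_int k\<bar>)) * A k)"
    by (subst sum.swap) (simp add: sum_distrib_right)
  also have "\<dots> \<le> (\<Sum>k\<in>?K. 2 * A k)"
  proof (intro sum_mono mult_right_mono A0)
    fix k :: int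
    show "(\<Sum>j=1..N. high_wt j (1 / \<bar>of_int k\<bar>)) \<le> 2"
    proof (cases "k = 0")
      case False
      thus ?thesis by (intro sum_high_frequencies) auto
    qed (simp add: high_wt_def)
  qed
  also have "\<dots> = (\<Sum>k\<in>?K. (cmod (tcoeff g k))^2) / (2 * pi^2)"
    by (simp add: A_def sum_divide_distrib)
  also have "\<dots> \<le> 2 * pi * (l2_int g) / (2 * pi^2)"
    by (intro divide_right_mono bessel_torus[OF _ g B]) auto
  also have "\<dots> = (l2_int g) / pi"
    by (simp add: power2_eq_square)
  finally have "2 * pi * (\<Sum>j=1..N. (1 / real j) * (\<Sum>k=-int (n j)..int (n j). (\<bar>of_int k\<bar> / (real (n j) + 1))^2 * A k)) \<le> 2 * pi * ((l2_int g) / pi)"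
    by (intro mult_left_mono) auto
  thus ?thesis unfolding L2 by (simp add: sum_distrib_left mult_ac)
qed

end

section \<open>Calderon--Zygmund selection\<close>

definition iv :: "real \<times> real \<Rightarrow> real set" where "iv p = {fst p..<fst p + snd p}"

text \<open>Dyadic stopping time with only \<open>K\<close> bisections, which keeps the family
  finite; \<open>m\<close> will be the integral of |f| over the interval. The factor 2 arises
  because a selected interval is half of one that was not selected. Points never covered end up in
  intervals of the last generation with small mean.\<close>

lemma calderon_zygmund_selection:
  fixes m :: "real \<times> real \<Rightarrow> real"
  assumes mono: "\<And>p q. iv p \<subseteq> iv q \<Longrightarrow> m p \<le> m q"
    and "0 < L" "m (a, L) \<le> lam * L"
  shows "\<exists>II. finite II \<and>
    (\<forall>p\<in>II. 0 < snd p \<and> iv p \<subseteq> {a..<a + L} \<and> lam * snd p < m p \<and> m p \<le> 2 * lam * snd p) \<and>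
    pairwise (\<lambda>p q. iv p \<inter> iv q = {}) II \<and>
    (\<forall>x\<in>{a..<a + L} - (\<Union>p\<in>II. iv p). \<exists>c. x \<in> iv (c, L / 2 ^ K) \<and> iv (c, L / 2 ^ K) \<subseteq> {a..<a + L}
       \<and> m (c, L / 2 ^ K) \<le> lam * (L / 2 ^ K))"
  using assms(2,3)
proof (induction K arbitrary: a L)
  case 0
  have "\<exists>c. x \<in> iv (c, L / 2 ^ 0) \<and> iv (c, L / 2 ^ 0) \<subseteq> {a..<a + L} \<and> m (c, L / 2 ^ 0) \<le> lam * (L / 2 ^ 0)"
    if "x \<in> {a..<a + L}" for x
    using 0 that by (intro exI[of _ a]) (simp add: iv_def)
  thus ?case by (intro exI[of _ "{}"]) simp
next
  case (Suc K)
  define good where "good a L II \<longleftrightarrow> finite II \<and>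
    (\<forall>p\<in>II. 0 < snd p \<and> iv p \<subseteq> {a..<a + L} \<and> lam * snd p < m p \<and> m p \<le> 2 * lam * snd p) \<and>
    pairwise (\<lambda>p q. iv p \<inter> iv q = {}) II" for a L :: real and II
  define rest where "rest a L II l \<longleftrightarrow> (\<forall>x\<in>{a..<a + L} - (\<Union>p\<in>II. iv p). \<exists>c. x \<in> iv (c, l) \<and> iv (c, l) \<subseteq> {a..<a + L}
       \<and> m (c, l) \<le> lam * l)" for a L l :: real and II
  have half: "\<exists>II. good b (L / 2) II \<and> rest b (L / 2) II (L / 2 / 2 ^ K)"
    if b: "{b..<b + L / 2} \<subseteq> {a..<a + L}" for b
  proof (cases "m (b, L / 2) \<le> lam * (L / 2)")
    case True
    have "0 < L / 2" using Suc.prems by simp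
    from Suc.IH[OF this True] show ?thesis unfolding good_def rest_def conj_assoc .
  next
    case False
    \<comment> \<open>The parent was kept because its mean is at most \<open>lam\<close>; relative
      to the half length this becomes 2 \<open>lam\<close>.\<close>
    have "m (b, L / 2) \<le> m (a, L)" using b by (intro mono) (auto simp: iv_def)
    also have "\<dots> \<le> lam * L" using Suc.prems by simp
    finally have "m (b, L / 2) \<le> 2 * lam * (L / 2)" by simp
    hence "good b (L / 2) {(b, L / 2)}" using False Suc.prems
      by (simp add: good_def iv_def)
    moreover have "rest b (L / 2) {(b, L / 2)} l" for l by (simp add: rest_def iv_def)
    ultimately show ?thesis by blast
  qed
  obtain II1 where 1: "good a (L / 2) II1" "rest a (L / 2) II1 (L / 2 / 2 ^ K)"
    using half[of a] Suc.prems by auto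
  obtain II2 where 2: "good (a + L / 2) (L / 2) II2" "rest (a + L / 2) (L / 2) II2 (L / 2 / 2 ^ K)"
    using half[of "a + L / 2"] Suc.prems by auto
  have split: "{a..<a + L} = {a..<a + L / 2} \<union> {a + L / 2..<a + L / 2 + L / 2}" using Suc.prems by auto
  have disj: "iv p \<inter> iv q = {}" if "p \<in> II1" "q \<in> II2" for p q
  proof -
    have "iv p \<subseteq> {a..<a + L / 2}" "iv q \<subseteq> {a + L / 2..<a + L / 2 + L / 2}"
      using 1(1) 2(1) that unfolding good_def by blast+
    thus ?thesis by fastforce
  qed
  have "good a L (II1 \<union> II2)"
    unfolding good_def
  proof (intro conjI)
    show "pairwise (\<lambda>p q. iv p \<inter> iv q = {}) (II1 \<union> II2)"
    proof (rule pairwiseI)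
      fix p q assume pq: "p \<in> II1 \<union> II2" "q \<in> II1 \<union> II2" "p \<noteq> q"
      have pw: "pairwise (\<lambda>p q. iv p \<inter> iv q = {}) II1" "pairwise (\<lambda>p q. iv p \<inter> iv q = {}) II2"
        using 1(1) 2(1) unfolding good_def by blast+
      consider "p \<in> II1" "q \<in> II1" | "p \<in> II1" "q \<in> II2" | "p \<in> II2" "q \<in> II1" | "p \<in> II2" "q \<in> II2"
        using pq by blast
      thus "iv p \<inter> iv q = {}"
      proof cases
        case 1
        show ?thesis using pw(1)[unfolded pairwise_def, rule_format, OF 1 pq(3)] .
      next
        case 2
        thus ?thesis by (rule disj)
      next
        case 3
        thus ?thesis using disj[of q p] by (simp add: Int_commute)
      next
        case 4
        show ?thesis using pw(2)[unfolded pairwise_def, rule_format, OF 4 pq(3)] .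
      qed
    qed
    show "\<forall>p\<in>II1 \<union> II2. 0 < snd p \<and> iv p \<subseteq> {a..<a + L} \<and> lam * snd p < m p \<and> m p \<le> 2 * lam * snd p"
      using 1(1) 2(1) unfolding split good_def by blast
  qed (use 1 2 in \<open>auto simp: good_def\<close>)
  moreover have "rest a L (II1 \<union> II2) (L / 2 / 2 ^ K)"
    unfolding rest_def
  proof
    fix x assume x: "x \<in> {a..<a + L} - (\<Union>p\<in>II1 \<union> II2. iv p)"
    have sub: "{a..<a + L / 2} \<subseteq> {a..<a + L}" "{a + L / 2..<a + L / 2 + L / 2} \<subseteq> {a..<a + L}"
      using split by auto
    from x have "x \<in> {a..<a + L / 2} - (\<Union>p\<in>II1. iv p) \<or> x \<in> {a + L / 2..<a + L / 2 + L / 2} - (\<Union>p\<in>II2. iv p)"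
      unfolding split by simp
    thus "\<exists>c. x \<in> iv (c, L / 2 / 2 ^ K) \<and> iv (c, L / 2 / 2 ^ K) \<subseteq> {a..<a + L} \<and> m (c, L / 2 / 2 ^ K) \<le> lam * (L / 2 / 2 ^ K)"
    proof
      assume "x \<in> {a..<a + L / 2} - (\<Union>p\<in>II1. iv p)"
      from bspec[OF 1(2)[unfolded rest_def] this] obtain c
        where c: "x \<in> iv (c, L / 2 / 2 ^ K)" "iv (c, L / 2 / 2 ^ K) \<subseteq> {a..<a + L / 2}" "m (c, L / 2 / 2 ^ K) \<le> lam * (L / 2 / 2 ^ K)"
        by (elim exE conjE)
      show ?thesis by (rule exI[of _ c]) (intro conjI c(1) order.trans[OF c(2) sub(1)] c(3))
    next
      assume "x \<in> {a + L / 2..<a + L / 2 + L / 2} - (\<Union>p\<in>II2. iv p)"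
      from bspec[OF 2(2)[unfolded rest_def] this] obtain c
        where c: "x \<in> iv (c, L / 2 / 2 ^ K)" "iv (c, L / 2 / 2 ^ K) \<subseteq> {a + L / 2..<a + L / 2 + L / 2}" "m (c, L / 2 / 2 ^ K) \<le> lam * (L / 2 / 2 ^ K)"
        by (elim exE conjE)
      show ?thesis by (rule exI[of _ c]) (intro conjI c(1) order.trans[OF c(2) sub(2)] c(3))
    qed
  qed
  moreover have "L / 2 / 2 ^ K = L / 2 ^ Suc K" by simp
  ultimately have G: "good a L (II1 \<union> II2) \<and> rest a L (II1 \<union> II2) (L / 2 ^ Suc K)" by simp
  show ?case
    by (rule exI[of _ "II1 \<union> II2"]) (rule G[unfolded good_def rest_def conj_assoc])
qed

section \<open>Partial sums away from the support\<close>

definition cbump :: "real \<Rightarrow> real \<Rightarrow> real \<Rightarrow> complex" where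
  "cbump c l s = indicator {c..<c + l} s *\<^sub>R complex_of_real (bump c l s)"

definition cbump' :: "real \<Rightarrow> real \<Rightarrow> real \<Rightarrow> complex" where
  "cbump' c l s = indicator {c..<c + l} s *\<^sub>R complex_of_real (bump' c l s)"

lemma measurable_cbump [measurable]:
  "cbump c l \<in> borel_measurable torusM" "cbump' c l \<in> borel_measurable torusM"
  by (rule borel_measurable_torusM; unfold cbump_def [abs_def] cbump'_def [abs_def] bump_def [abs_def] bump'_def [abs_def]; measurable)+

lemma cbump_norm:
  assumes "0 < l"
  shows "cmod (cbump c l s) \<le> 2 / l" "cmod (cbump' c l s) \<le> 6 / l^2"
  using bump_bounds[OF assms, of c s] assms by (auto simp: cbump_def cbump'_def indicator_def)

lemma cbump_outside: "s \<notin> {c..<c + l} \<Longrightarrow> cbump c l s = 0" "s \<notin> {c..<c + l} \<Longrightarrow> cbump' c l s = 0"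
  by (auto simp: cbump_def cbump'_def)

lemma integrable_cbump: "0 < l \<Longrightarrow> integrable torusM (cbump c l)"
  by (rule integrable_torusM_bounded[OF _ cbump_norm(1)]) auto

text \<open>This expresses the regularity of the bump across the end points of its interval; it
  later trades a lower bound on k for a smaller coefficient.\<close>

lemma tcoeff_cbump':
  assumes "- pi \<le> c" "0 < l" "c + l \<le> pi"
  shows "tcoeff (cbump' c l) k = \<i> * of_int k * tcoeff (cbump c l) k"
proof -
  have "continuous_on {c..c + l} (\<lambda>x. complex_of_real (bump' c l x))"
    unfolding bump'_def using assms by (intro continuous_intros) auto
  moreover have "((\<lambda>x. complex_of_real (bump c l x)) has_vector_derivative complex_of_real (bump' c l x)) (at x within {c..c + l})" for x
    by (intro has_vector_derivative_of_real) (simp add: bump_deriv)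
  ultimately show ?thesis
    using integral_by_parts_cis[of c "c + l" "\<lambda>x. of_real (bump c l x)" "\<lambda>x. of_real (bump' c l x)" "of_int k"] assms
    by (simp add: tcoeff_def cbump_def cbump'_def bump_zero)
qed

lemma measurable_ckern [measurable]: "ckern \<in> borel_measurable borel"
  unfolding ckern_def [abs_def] by measurable

text \<open>Exact error of the geometric partial sum as an approximation of
  \<open>- ckern u\<close>: it has the same modulus as \<open>ckern u\<close> and becomes small only
  after averaging in u.\<close>

lemma ckern_add_sum:
  assumes "cis u \<noteq> 1"
  shows "ckern u + (\<Sum>k\<in>{0..<int M}. cis (of_int k * u)) = cis (of_nat M * u) * ckern u"
proof (induction M)
  case (Suc M)
  have eq: "{0..<int (Suc M)} = insert (int M) {0..<int M}" by auto
  have "ckern u + (\<Sum>k\<in>{0..<int (Suc M)}. cis (of_int k * u)) = cis (of_nat M * u) * (ckern u + 1)"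
    unfolding eq using Suc by (simp add: algebra_simps)
  also have "ckern u + 1 = cis u * ckern u" using assms by (simp add: ckern_def field_simps)
  finally show ?case by (simp add: cis_mult algebra_simps)
qed simp

lemma chord_far:
  assumes "2 * l < cmod (cis x - cis c)" "c \<le> s" "s \<le> c + l"
  shows "cmod (cis x - cis c) / 2 \<le> cmod (cis x - cis s)"
proof -
  have "cmod (cis x - cis c) \<le> cmod (cis x - cis s) + cmod (cis s - cis c)"
    using norm_triangle_ineq[of "cis x - cis s" "cis s - cis c"] by simp
  moreover have "cmod (cis s - cis c) \<le> l" using chord_le[of s c] assms by auto
  ultimately show ?thesis using assms by linarith
qed

text \<open>Stands in for \<open>ckern (x - t)\<close> at all t of the interval. Being independent
  of t, it leaves the integral against b and only a single Fourier coefficient of b remains.\<close>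

definition kappa :: "real \<Rightarrow> real \<Rightarrow> real \<Rightarrow> complex" where
  "kappa c l x = (LINT s|torusM. cbump c l s * ckern (x - s))"

section \<open>One atom seen from outside the doubled interval\<close>

context
  fixes c l x :: real
  assumes cl: "- pi \<le> c" "0 < l" "c + l \<le> pi" and far: "2 * l < cmod (cis x - cis c)"
begin

lemma cis_far: assumes "c \<le> s" "s \<le> c + l" shows "cis (x - s) \<noteq> 1" "cis x \<noteq> cis s" "cmod (ckern (x - s)) \<le> 1 / l"
proof -
  have l: "l \<le> cmod (cis x - cis s)" using chord_far[OF far assms] far by linarith
  thus ne: "cis x \<noteq> cis s" using cl by auto
  thus "cis (x - s) \<noteq> 1" using cis_neq_iff[of x s] by auto
  show "cmod (ckern (x - s)) \<le> 1 / l" unfolding ckern_chord using l cl by (intro divide_left_mono) (auto intro!: mult_pos_pos)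
qed

lemma integrable_cbump_ckern:
  assumes [measurable]: "h \<in> borel_measurable torusM" and h: "\<And>s. cmod (h s) \<le> B"
  shows "integrable torusM (\<lambda>s. cbump c l s * ckern (x - s) * h s)"
proof (rule integrable_torusM_bounded)
  fix s
  have B: "0 \<le> B" using order.trans[OF norm_ge_zero h] .
  show "norm (cbump c l s * ckern (x - s) * h s) \<le> 2 / l * (1 / l) * B"
  proof (cases "s \<in> {c..<c + l}")
    case True
    thus ?thesis unfolding norm_mult using cl cis_far(3)[of s] cbump_norm(1)[of l c s] h B
      by (intro mult_mono) auto
  next
    case False
    thus ?thesis using B cl by (simp add: cbump_outside)
  qed
qed measurable

text \<open>Adding \<open>\<Sum>k<M. cis (k u)\<close> to the kernel leaves \<open>cis (M u)\<close> times the kernel, and the mean of the latter against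
  the bump is \<open>O(1 / M)\<close>. So up to sign a partial sum with large \<open>M\<close> may stand in for the smeared kernel.\<close>

lemma kappa_approx:
  assumes "M > 0"
  shows "cmod (kappa c l x + (\<Sum>k\<in>{0..<int M}. tcoeff (cbump c l) k * cis (of_int k * x))) \<le> 16 * pi / l ^ 3 / M"
proof -
  define F where "F s = complex_of_real (bump c l s) * ckern (x - s)" for s
  define F' where "F' s = complex_of_real (bump' c l s) * ckern (x - s) + complex_of_real (bump c l s) * (\<i> * cis (x - s) * (ckern (x - s))^2)" for s
  have ne: "cis (x - s) - 1 \<noteq> 0" if "s \<in> {c..c + l}" for s using cis_far(1)[of s] that by auto
  have contk: "continuous_on {c..c + l} (\<lambda>s. ckern (x - s))"
    unfolding ckern_def using ne by (intro continuous_intros) auto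
  have contF': "continuous_on {c..c + l} F'"
    unfolding F'_def bump_def bump'_def using cl by (intro continuous_intros contk) auto
  have dk: "((\<lambda>s. ckern (x - s)) has_vector_derivative \<i> * cis (x - s) * (ckern (x - s))^2) (at s within {c..c + l})" if s: "c \<le> s" "s \<le> c + l" for s
    using cis_far(1)[OF s] unfolding ckern_def has_vector_derivative_def
    by (auto intro!: derivative_eq_intros ext simp: scaleR_conv_of_real power2_eq_square field_simps)
  have der: "(F has_vector_derivative F' s) (at s within {c..c + l})" if s: "c \<le> s" "s \<le> c + l" for s
  proof -
    have "((\<lambda>s. complex_of_real (bump c l s)) has_vector_derivative complex_of_real (bump' c l s)) (at s within {c..c + l})"
      by (intro has_vector_derivative_of_real) (simp add: bump_deriv)
    from has_vector_derivative_mult[OF this dk[OF s]] show ?thesis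
      unfolding F_def F'_def by (simp add: add_ac)
  qed
  \<comment> \<open>Two terms of the product rule: 6 / l^2 times 1 / l, and 2 / l times 1 / l^2; the
    kernel is at most 1 / l by \<open>cis_far\<close>.\<close>
  have "cmod (indicator {c..<c + l} s *\<^sub>R F' s * cis (- (real M * s))) \<le> 8 / l ^ 3" for s
  proof (cases "s \<in> {c..<c + l}")
    case True
    hence s: "c \<le> s" "s \<le> c + l" by auto
    have "cmod (F' s) \<le> \<bar>bump' c l s\<bar> * cmod (ckern (x - s)) + \<bar>bump c l s\<bar> * (cmod (ckern (x - s)))^2"
      unfolding F'_def by (rule norm_triangle_le) (simp add: norm_mult norm_power)
    also have "\<dots> \<le> 6 / l^2 * (1 / l) + 2 / l * (1 / l)^2"
      using bump_bounds[OF cl(2) s] cis_far(3)[OF s] cl by (intro add_mono mult_mono power_mono) auto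
    also have "\<dots> = 8 / l ^ 3" by (simp add: power2_eq_square power3_eq_cube)
    finally show ?thesis using True by (simp add: norm_mult)
  next
    case False
    thus ?thesis using cl by simp
  qed
  note bd = this
  have "(LINT s|torusM. (indicator {c..<c + l} s *\<^sub>R F' s) * cis (- (real M * s))) = \<i> * of_real (real M) * (LINT s|torusM. (indicator {c..<c + l} s *\<^sub>R F s) * cis (- (real M * s)))"
    by (rule integral_by_parts_cis[symmetric, OF _ _ _ der contF']) (use cl in \<open>auto simp: F_def bump_zero\<close>)
  moreover have "cmod (LINT s|torusM. (indicator {c..<c + l} s *\<^sub>R F' s) * cis (- (real M * s))) \<le> 2 * pi * (8 / l ^ 3)"
  proof (rule integral_torusM_bound)
    have "(\<lambda>s. indicator {c..<c + l} s *\<^sub>R F' s * cis (- (real M * s))) \<in> borel_measurable torusM"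
      by (rule borel_measurable_torusM; unfold F'_def [abs_def] bump_def [abs_def] bump'_def [abs_def]; measurable)
    thus "integrable torusM (\<lambda>s. indicator {c..<c + l} s *\<^sub>R F' s * cis (- (real M * s)))"
      using bd by (rule integrable_torusM_bounded)
  qed (rule bd)
  ultimately have bound: "real M * cmod (LINT s|torusM. (indicator {c..<c + l} s *\<^sub>R F s) * cis (- (real M * s))) \<le> 16 * pi / l ^ 3"
    by (simp add: norm_mult)
  have "kappa c l x + (\<Sum>k\<in>{0..<int M}. tcoeff (cbump c l) k * cis (of_int k * x))
    = (LINT s|torusM. cbump c l s * ckern (x - s) + (\<Sum>k\<in>{0..<int M}. cbump c l s * cis (- (of_int k * s)) * cis (of_int k * x)))"
  proof -
    have "integrable torusM (\<lambda>s. cbump c l s * ckern (x - s))"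
      using integrable_cbump_ckern[of "\<lambda>_. 1" 1] by simp
    moreover have "(\<Sum>k\<in>{0..<int M}. tcoeff (cbump c l) k * cis (of_int k * x))
        = (LINT s|torusM. (\<Sum>k\<in>{0..<int M}. cbump c l s * cis (- (of_int k * s)) * cis (of_int k * x)))"
      unfolding tcoeff_def
      by (subst Bochner_Integration.integral_sum) (auto intro!: integrable_tcoeff integrable_cbump cl)
    ultimately show ?thesis unfolding kappa_def
      by (subst Bochner_Integration.integral_add)
         (auto intro!: integrable_tcoeff integrable_cbump cl Bochner_Integration.integrable_sum)
  qed
  also have "\<dots> = (LINT s|torusM. cis (of_nat M * x) * (indicator {c..<c + l} s *\<^sub>R F s * cis (- (real M * s))))"
  proof (rule Bochner_Integration.integral_cong[OF refl])
    fix s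
    show "cbump c l s * ckern (x - s) + (\<Sum>k\<in>{0..<int M}. cbump c l s * cis (- (of_int k * s)) * cis (of_int k * x))
       = cis (of_nat M * x) * (indicator {c..<c + l} s *\<^sub>R F s * cis (- (real M * s)))"
    proof (cases "s \<in> {c..<c + l}")
      case True
      have "cbump c l s * ckern (x - s) + (\<Sum>k\<in>{0..<int M}. cbump c l s * cis (- (of_int k * s)) * cis (of_int k * x))
         = cbump c l s * (ckern (x - s) + (\<Sum>k\<in>{0..<int M}. cis (of_int k * (x - s))))"
        by (simp add: distrib_left sum_distrib_left mult.assoc cis_mult algebra_simps)
      also have "\<dots> = cbump c l s * (cis (of_nat M * (x - s)) * ckern (x - s))"
        using True cis_far(1)[of s] by (subst ckern_add_sum) auto
      also have "cis (of_nat M * (x - s)) = cis (of_nat M * x) * cis (- (real M * s))"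
        by (simp add: cis_mult algebra_simps)
      finally have e: "cbump c l s * ckern (x - s) + (\<Sum>k\<in>{0..<int M}. cbump c l s * cis (- (of_int k * s)) * cis (of_int k * x))
        = cbump c l s * (cis (of_nat M * x) * cis (- (real M * s)) * ckern (x - s))" .
      show ?thesis unfolding e using True by (simp add: cbump_def F_def mult_ac)
    next
      case False
      thus ?thesis by (simp add: cbump_outside)
    qed
  qed
  also have "\<dots> = cis (of_nat M * x) * (LINT s|torusM. indicator {c..<c + l} s *\<^sub>R F s * cis (- (real M * s)))"
    by (rule integral_mult_right_zero)
  finally have e: "kappa c l x + (\<Sum>k\<in>{0..<int M}. tcoeff (cbump c l) k * cis (of_int k * x))
    = cis (of_nat M * x) * (LINT s|torusM. indicator {c..<c + l} s *\<^sub>R F s * cis (- (real M * s)))" .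
  show ?thesis unfolding e norm_mult norm_cis mult_1_left
    using bound assms by (subst pos_le_divide_eq) (auto simp: mult.commute)
qed

text \<open>The bump has mass 1, so the difference is a mean of kernel differences over s in the
  interval. There |s - t| \<le> l and both chords are at least half of the chord to c, hence the
  4.\<close>

lemma ckern_minus_kappa:
  assumes "c \<le> t" "t \<le> c + l"
  shows "cmod (ckern (x - t) - kappa c l x) \<le> 4 * l / (cmod (cis x - cis c))^2"
proof -
  let ?d = "cmod (cis x - cis c)"
  have i0: "integrable torusM (\<lambda>s. cbump c l s * ckern (x - t))" "integrable torusM (\<lambda>s. cbump c l s * ckern (x - s))"
    using integrable_cbump_ckern[of "\<lambda>_. 1" 1] integrable_cbump[OF cl(2), of c] by auto
  have i1: "integrable torusM (\<lambda>s. cmod (cbump c l s * ckern (x - t) - cbump c l s * ckern (x - s)))"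
    by (rule integrable_norm[OF Bochner_Integration.integrable_diff[OF i0]])
  have b1: "has_bochner_integral torusM (cbump c l) 1"
    using has_bochner_integral_of_real[OF bump_integral[OF cl], where 'a = complex]
    by (simp add: cbump_def [abs_def] scaleR_conv_of_real)
  hence "(LINT s|torusM. cbump c l s * ckern (x - t)) = ckern (x - t)"
    by (simp add: has_bochner_integral_iff)
  hence "ckern (x - t) - kappa c l x = (LINT s|torusM. cbump c l s * ckern (x - t)) - (LINT s|torusM. cbump c l s * ckern (x - s))"
    by (simp add: kappa_def)
  also have "\<dots> = (LINT s|torusM. cbump c l s * ckern (x - t) - cbump c l s * ckern (x - s))"
    by (rule Bochner_Integration.integral_diff[OF i0, symmetric])
  finally have e: "ckern (x - t) - kappa c l x = (LINT s|torusM. cbump c l s * ckern (x - t) - cbump c l s * ckern (x - s))" .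
  have "cmod (ckern (x - t) - kappa c l x) \<le> (LINT s|torusM. cmod (cbump c l s * ckern (x - t) - cbump c l s * ckern (x - s)))"
    unfolding e by (rule integral_norm_bound)
  also have "\<dots> \<le> (LINT s|torusM. (indicator {c..<c + l} s *\<^sub>R bump c l s) * (4 * l / ?d^2))"
  proof (rule integral_mono[OF i1])
    show "integrable torusM (\<lambda>s. (indicator {c..<c + l} s *\<^sub>R bump c l s) * (4 * l / ?d^2))"
      by (rule integrable_mult_left[OF integrable.intros[OF bump_integral[OF cl]]])
    fix s
    show "cmod (cbump c l s * ckern (x - t) - cbump c l s * ckern (x - s)) \<le> (indicator {c..<c + l} s *\<^sub>R bump c l s) * (4 * l / ?d^2)"
    proof (cases "s \<in> {c..<c + l}")
      case True
      hence s: "c \<le> s" "s \<le> c + l" by auto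
      have d: "?d > 0" using far cl by linarith
      have "cmod (ckern (x - t) - ckern (x - s)) \<le> \<bar>s - t\<bar> / (cmod (cis x - cis t) * cmod (cis x - cis s))"
        using cis_far(2) s assms by (intro ckern_diff) auto
      also have "\<dots> \<le> l / ((?d / 2) * (?d / 2))"
        using s assms d chord_far[OF far s] chord_far[OF far assms] by (intro frac_le mult_mono mult_pos_pos) auto
      also have "\<dots> = 4 * l / ?d^2" by (simp add: power2_eq_square)
      finally have "bump c l s * cmod (ckern (x - t) - ckern (x - s)) \<le> bump c l s * (4 * l / ?d^2)"
        using bump_bounds[OF cl(2) s] by (intro mult_left_mono) auto
      moreover have "cmod (cbump c l s * ckern (x - t) - cbump c l s * ckern (x - s)) = bump c l s * cmod (ckern (x - t) - ckern (x - s))"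
        using True bump_bounds[OF cl(2) s] by (simp add: cbump_def right_diff_distrib[symmetric] norm_mult)
      ultimately show ?thesis using True by simp
    next
      case False
      thus ?thesis by (simp add: cbump_outside)
    qed
  qed
  also have "\<dots> = 4 * l / ?d^2"
    using bump_integral[OF cl] by (subst integral_mult_left_zero) (simp add: has_bochner_integral_iff)
  finally show ?thesis .
qed

text \<open>Two exchanges in the Dirichlet kernel: \<open>ckern\<close> by \<open>kappa\<close>,
  with an error of Poisson size, and \<open>kappa\<close> by minus the partial sum of the bump, with
  an error O(1 / M). The plus sign in the statement is the sign of the geometric series; b is real,
  so the real part can be taken after integration.\<close>

lemma partial_sum_off_interval:
  fixes b :: "real \<Rightarrow> real"
  assumes b: "integrable torusM b" and b0: "\<And>t. t \<notin> {c..<c + l} \<Longrightarrow> b t = 0" and "M > 0"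
  shows "cmod (fourier_partial_sum n (\<lambda>t. of_real (b t)) x
     + of_real (Re (cis (real (n + 1) * x) * (tcoeff (\<lambda>t. of_real (b t)) (int (n + 1)) *
         (\<Sum>k\<in>{0..<int M}. tcoeff (cbump c l) k * cis (of_int k * x)))) / pi))
    \<le> (2 * l / (l^2 + (cmod (cis x - cis c))^2) + 16 / l ^ 3 / M) * (l1_int b)"
proof -
  let ?d = "cmod (cis x - cis c)"
  let ?cb = "\<lambda>t. complex_of_real (b t)"
  define I where "I = (l1_int b)"
  have I0: "I \<ge> 0" by (simp add: I_def)
  define G where "G = (\<Sum>k\<in>{0..<int M}. tcoeff (cbump c l) k * cis (of_int k * x))"
  define \<beta> where "\<beta> = tcoeff ?cb (int (n + 1))"
  have cbi: "integrable torusM ?cb" using b by simp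
  \<comment> \<open>Cutting off outside the interval makes the factor bounded on the whole torus; b
    vanishes there anyway.\<close>
  define K where "K t = indicator {c..<c + l} t *\<^sub>R (cis (real (n + 1) * (x - t)) * ckern (x - t))" for t
  have K_meas [measurable]: "K \<in> borel_measurable torusM"
    by (rule borel_measurable_torusM; unfold K_def [abs_def]; measurable)
  have K_bound: "cmod (K t) \<le> 1 / l" for t
    using cis_far(3)[of t] cl by (cases "t \<in> {c..<c + l}") (auto simp: K_def norm_mult)
  have Ki: "integrable torusM (\<lambda>t. ?cb t * K t)"
    using cbi K_meas K_bound by (rule integrable_mult_bounded)
  define W where "W = (LINT t|torusM. ?cb t * K t)"
  have "fourier_partial_sum n ?cb x = (LINT t|torusM. ?cb t * dirichlet n (x - t)) / (2 * of_real pi)"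
    using cbi by (rule fourier_partial_sum_integral)
  also have "(\<lambda>t. ?cb t * dirichlet n (x - t)) = (\<lambda>t. complex_of_real (2 * Re (?cb t * K t)))"
  proof
    fix t
    show "?cb t * dirichlet n (x - t) = complex_of_real (2 * Re (?cb t * K t))"
    proof (cases "t \<in> {c..<c + l}")
      case True
      thus ?thesis using cis_far(1)[of t] by (subst dirichlet_kernel_eq_ckern) (auto simp: K_def)
    qed (simp add: b0)
  qed
  also have "(LINT t|torusM. complex_of_real (2 * Re (?cb t * K t))) = complex_of_real (2 * Re W)"
    unfolding W_def using integral_Re[OF Ki] by (simp only: integral_complex_of_real integral_mult_right_zero)
  finally have S: "fourier_partial_sum n ?cb x = of_real (Re W / pi)" by simp
  have i2: "integrable torusM (\<lambda>t. cis (real (n + 1) * x) * kappa c l x * (?cb t * cis (- (of_int (int (n + 1)) * t))))"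
    by (rule integrable_mult_right[OF integrable_tcoeff[OF cbi]])
  have "W - cis (real (n + 1) * x) * \<beta> * kappa c l x
     = (LINT t|torusM. ?cb t * K t) - (LINT t|torusM. cis (real (n + 1) * x) * kappa c l x * (?cb t * cis (- (of_int (int (n + 1)) * t))))"
    unfolding W_def \<beta>_def tcoeff_def integral_mult_right_zero by (simp add: mult_ac)
  also have "\<dots> = (LINT t|torusM. ?cb t * K t - cis (real (n + 1) * x) * kappa c l x * (?cb t * cis (- (of_int (int (n + 1)) * t))))"
    by (rule Bochner_Integration.integral_diff[OF Ki i2, symmetric])
  finally have e: "W - cis (real (n + 1) * x) * \<beta> * kappa c l x
     = (LINT t|torusM. ?cb t * K t - cis (real (n + 1) * x) * kappa c l x * (?cb t * cis (- (of_int (int (n + 1)) * t))))" .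
  have "cmod (W - cis (real (n + 1) * x) * \<beta> * kappa c l x)
     \<le> (LINT t|torusM. cmod (?cb t * K t - cis (real (n + 1) * x) * kappa c l x * (?cb t * cis (- (of_int (int (n + 1)) * t)))))"
    unfolding e by (rule integral_norm_bound)
  also have "\<dots> \<le> (LINT t|torusM. (4 * l / ?d^2) * \<bar>b t\<bar>)"
  proof (rule integral_mono[OF integrable_norm[OF Bochner_Integration.integrable_diff[OF Ki i2]]])
    show "integrable torusM (\<lambda>t. (4 * l / ?d^2) * \<bar>b t\<bar>)" using b by simp
    fix t
    show "cmod (?cb t * K t - cis (real (n + 1) * x) * kappa c l x * (?cb t * cis (- (of_int (int (n + 1)) * t)))) \<le> (4 * l / ?d^2) * \<bar>b t\<bar>"
    proof (cases "t \<in> {c..<c + l}")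
      case True
      have e: "cis (real (n + 1) * (x - t)) = cis (real (n + 1) * x) * cis (- (of_int (int (n + 1)) * t))"
        by (simp add: cis_mult algebra_simps)
      have "?cb t * K t - cis (real (n + 1) * x) * kappa c l x * (?cb t * cis (- (of_int (int (n + 1)) * t)))
         = ?cb t * cis (real (n + 1) * x) * cis (- (of_int (int (n + 1)) * t)) * (ckern (x - t) - kappa c l x)"
        unfolding K_def e using True by (simp add: algebra_simps)
      hence "cmod (?cb t * K t - cis (real (n + 1) * x) * kappa c l x * (?cb t * cis (- (of_int (int (n + 1)) * t)))) = \<bar>b t\<bar> * cmod (ckern (x - t) - kappa c l x)"
        by (simp add: norm_mult)
      also have "\<dots> \<le> \<bar>b t\<bar> * (4 * l / ?d^2)"
        using True by (intro mult_left_mono ckern_minus_kappa) auto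
      finally show ?thesis by (simp add: mult.commute)
    qed (simp add: b0)
  qed
  also have "\<dots> = 4 * l / ?d^2 * I" unfolding I_def by (rule integral_mult_right_zero)
  finally have 1: "cmod (W - cis (real (n + 1) * x) * \<beta> * kappa c l x) \<le> 4 * l / ?d^2 * I" .
  have \<beta>_le: "cmod \<beta> \<le> I" using tcoeff_norm_le[of ?cb] by (simp add: \<beta>_def I_def)
  have "cmod (cis (real (n + 1) * x) * \<beta> * (kappa c l x + G)) \<le> I * (16 * pi / l ^ 3 / M)"
    unfolding norm_mult norm_cis mult_1_left G_def by (rule mult_mono[OF \<beta>_le kappa_approx[OF assms(3)] I0]) simp
  with 1 have "cmod (W + cis (real (n + 1) * x) * (\<beta> * G)) \<le> 4 * l / ?d^2 * I + I * (16 * pi / l ^ 3 / M)"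
    using norm_triangle_ineq[of "W - cis (real (n + 1) * x) * \<beta> * kappa c l x" "cis (real (n + 1) * x) * \<beta> * (kappa c l x + G)"]
    by (simp add: algebra_simps)
  hence "\<bar>Re (W + cis (real (n + 1) * x) * (\<beta> * G))\<bar> \<le> 4 * l / ?d^2 * I + I * (16 * pi / l ^ 3 / M)"
    using abs_Re_le_cmod order.trans by blast
  moreover have "fourier_partial_sum n ?cb x + of_real (Re (cis (real (n + 1) * x) * (\<beta> * G)) / pi) = of_real (Re (W + cis (real (n + 1) * x) * (\<beta> * G)) / pi)"
    unfolding S by (simp add: add_divide_distrib)
  ultimately have "cmod (fourier_partial_sum n ?cb x + of_real (Re (cis (real (n + 1) * x) * (\<beta> * G)) / pi)) \<le> (4 * l / ?d^2 * I + I * (16 * pi / l ^ 3 / M)) / pi"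
    by (simp add: divide_right_mono norm_divide abs_divide del: Re_complex_of_real plus_complex.simps times_complex.simps)
  also have "\<dots> = 4 * l / ?d^2 / pi * I + 16 / l ^ 3 / M * I" by (simp add: field_simps)
  \<comment> \<open>\<open>far\<close> gives 4 l^2 \<le> d^2, so 4 (l^2 + d^2) \<le> 5 d^2, and 5 <
    2 pi. With l^2 in the denominator the majorant is integrable over the whole torus.\<close>
  also have "4 * l / ?d^2 / pi \<le> 2 * l / (l^2 + ?d^2)"
  proof -
    have "(2 * l)^2 \<le> ?d^2" using far cl by (intro power_mono) auto
    hence "4 * (l^2 + ?d^2) \<le> 5 * ?d^2" by (simp add: power_mult_distrib)
    also have "\<dots> \<le> 2 * pi * ?d^2" using pi_gt3 by (intro mult_right_mono) auto
    finally have *: "4 * (l^2 + ?d^2) \<le> 2 * (pi * ?d^2)" by simp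
    have p: "l^2 + ?d^2 > 0" "pi * ?d^2 > 0"
      using cl far by (auto intro!: add_pos_nonneg mult_pos_pos zero_less_power simp del: zero_less_norm_iff)
    have "4 / (pi * ?d^2) \<le> 2 / (l^2 + ?d^2)"
      using * p by (simp add: divide_simps mult_ac)
    from mult_left_mono[OF this, of l] show ?thesis using cl by (simp add: mult_ac)
  qed
  finally show ?thesis using I0 unfolding \<beta>_def G_def I_def by (simp add: distrib_right mult_right_mono)
qed

end

section \<open>Almost orthogonality\<close>

lemma indicator_iv_integral:
  assumes "iv p \<subseteq> torus" "0 \<le> snd p"
  shows "has_bochner_integral torusM (indicator (iv p) :: real \<Rightarrow> real) (snd p)"
proof (cases "snd p = 0")
  case True
  hence "indicator (iv p) = (\<lambda>_. 0 :: real)" by (auto simp: iv_def indicator_def)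
  thus ?thesis using True by (simp add: has_bochner_integral_zero)
next
  case False
  hence "fst p \<in> iv p" using assms(2) by (auto simp: iv_def)
  hence 1: "- pi \<le> fst p" using assms(1) by auto
  have 2: "fst p + snd p \<le> pi"
  proof (rule ccontr)
    assume "\<not> ?thesis"
    hence "max (fst p) pi \<in> iv p" using assms(2) False by (auto simp: iv_def)
    hence "max (fst p) pi \<in> torus" using assms(1) by blast
    thus False by auto
  qed
  have "has_bochner_integral torusM (\<lambda>x. indicator {fst p..<fst p + snd p} x *\<^sub>R (1::real)) ((fst p + snd p) - fst p)"
    by (rule has_bochner_integral_torusM_FTC) (use 1 2 assms(2) in \<open>auto intro!: derivative_eq_intros simp: has_vector_derivative_def\<close>)
  thus ?thesis by (simp add: iv_def)
qed

text \<open>With disjoint supports at most one term is nonzero at each point, so the square of the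
  sum has no cross terms and its integral is bounded interval by interval.\<close>

lemma bessel_disjoint_sum:
  fixes \<psi> :: "real \<times> real \<Rightarrow> real \<Rightarrow> complex"
  assumes II: "finite II" "pairwise (\<lambda>p q. iv p \<inter> iv q = {}) II" "\<And>p. p \<in> II \<Longrightarrow> iv p \<subseteq> torus" "\<And>p. p \<in> II \<Longrightarrow> 0 \<le> snd p"
    and [measurable]: "\<And>p. p \<in> II \<Longrightarrow> \<psi> p \<in> borel_measurable torusM"
    and B: "\<And>p t. p \<in> II \<Longrightarrow> cmod (\<psi> p t) \<le> B p"
    and supp: "\<And>p t. p \<in> II \<Longrightarrow> t \<notin> iv p \<Longrightarrow> \<psi> p t = 0" and "finite K"
  shows "(\<Sum>k\<in>K. (cmod (\<Sum>p\<in>II. z p * tcoeff (\<psi> p) k))^2) \<le> 2 * pi * (\<Sum>p\<in>II. (cmod (z p))^2 * (B p)^2 * snd p)"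
proof -
  define h where "h t = (\<Sum>p\<in>II. z p * \<psi> p t)" for t
  have h_meas [measurable]: "h \<in> borel_measurable torusM" unfolding h_def by measurable
  have "cmod (h t) \<le> (\<Sum>p\<in>II. cmod (z p) * B p)" for t
    unfolding h_def by (rule sum_norm_le) (use B in \<open>auto simp: norm_mult intro!: mult_left_mono\<close>)
  note hB = this
  have \<psi>i: "integrable torusM (\<psi> p)" if "p \<in> II" for p
    using that B by (intro integrable_torusM_bounded[of _ "B p"]) auto
  have "tcoeff h k = (\<Sum>p\<in>II. z p * tcoeff (\<psi> p) k)" for k
    unfolding h_def using \<psi>i by (subst tcoeff_sum) (auto simp: tcoeff_cmult)
  hence "(\<Sum>k\<in>K. (cmod (\<Sum>p\<in>II. z p * tcoeff (\<psi> p) k))^2) = (\<Sum>k\<in>K. (cmod (tcoeff h k))^2)" by simp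
  also have "\<dots> \<le> 2 * pi * (l2_int h)"
    by (rule bessel_torus[OF \<open>finite K\<close> h_meas hB])
  also have "(l2_int h) \<le> (LINT t|torusM. (\<Sum>p\<in>II. (cmod (z p))^2 * (B p)^2 * indicator (iv p) t))"
  proof (rule integral_mono)
    show "integrable torusM (\<lambda>t. (cmod (h t))^2)"
      by (rule integrable_torusM_bounded[where B = "(\<Sum>p\<in>II. cmod (z p) * B p)^2"]) (use hB in \<open>auto intro!: power_mono\<close>)
    show "integrable torusM (\<lambda>t. \<Sum>p\<in>II. (cmod (z p))^2 * (B p)^2 * indicator (iv p) t)"
      using II by (intro Bochner_Integration.integrable_sum integrable_mult_right integrable.intros[OF indicator_iv_integral]) auto
    fix t
    show "(cmod (h t))^2 \<le> (\<Sum>p\<in>II. (cmod (z p))^2 * (B p)^2 * indicator (iv p) t)"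
    proof (cases "\<exists>p\<in>II. t \<in> iv p")
      case True
      then obtain p where p: "p \<in> II" "t \<in> iv p" by blast
      have other: "t \<notin> iv q" if "q \<in> II" "q \<noteq> p" for q
        using II(2) p that by (auto simp: pairwise_def)
      have "h t = z p * \<psi> p t"
        unfolding h_def using p II(1) other supp by (subst sum.remove[of _ p]) (auto intro!: sum.neutral)
      hence "(cmod (h t))^2 = (cmod (z p))^2 * (cmod (\<psi> p t))^2" by (simp add: norm_mult power_mult_distrib)
      also have "\<dots> \<le> (cmod (z p))^2 * (B p)^2"
        using B[OF p(1)] by (intro mult_left_mono power_mono) auto
      also have "\<dots> = (cmod (z p))^2 * (B p)^2 * indicator (iv p) t" using p by simp
      also have "\<dots> \<le> (\<Sum>p\<in>II. (cmod (z p))^2 * (B p)^2 * indicator (iv p) t)"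
        using II(1) p by (intro member_le_sum) auto
      finally show ?thesis .
    next
      case False
      hence "h t = 0" unfolding h_def using supp by (intro sum.neutral) auto
      thus ?thesis by (auto intro!: sum_nonneg)
    qed
  qed
  also have "\<dots> = (\<Sum>p\<in>II. (cmod (z p))^2 * (B p)^2 * snd p)"
  proof -
    have "(LINT t|torusM. (cmod (z p))^2 * (B p)^2 * indicator (iv p) t) = (cmod (z p))^2 * (B p)^2 * snd p" if "p \<in> II" for p
      unfolding integral_mult_right_zero has_bochner_integral_integral_eq[OF indicator_iv_integral[OF II(3,4)[OF that]]] ..
    hence "(\<Sum>p\<in>II. LINT t|torusM. (cmod (z p))^2 * (B p)^2 * indicator (iv p) t) = (\<Sum>p\<in>II. (cmod (z p))^2 * (B p)^2 * snd p)"
      by (rule sum.cong[OF refl])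
    moreover have "integrable torusM (\<lambda>t. (cmod (z p))^2 * (B p)^2 * indicator (iv p) t)" if "p \<in> II" for p
      by (rule integrable_mult_right[OF integrable.intros[OF indicator_iv_integral[OF II(3,4)[OF that]]]])
    ultimately show ?thesis by (simp only: Bochner_Integration.integral_sum)
  qed
  finally show ?thesis by simp
qed

text \<open>Allows pairs (j, k) as indices, once they are known to give distinct
  frequencies.\<close>

lemma parseval_trig_inj:
  assumes "finite K" "inj_on \<phi> K"
  shows "has_bochner_integral torusM (\<lambda>x. (cmod (\<Sum>k\<in>K. c k * cis (of_int (\<phi> k) * x)))^2) (2 * pi * (\<Sum>k\<in>K. (cmod (c k))^2))"
proof -
  have inv: "inv_into K \<phi> (\<phi> k) = k" if "k \<in> K" for k using assms(2) that by (rule inv_into_f_f)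
  have "(\<Sum>i\<in>\<phi> ` K. c (inv_into K \<phi> i) * cis (of_int i * x)) = (\<Sum>k\<in>K. c k * cis (of_int (\<phi> k) * x))" for x
    using assms inv by (subst sum.reindex) auto
  moreover have "(\<Sum>i\<in>\<phi> ` K. (cmod (c (inv_into K \<phi> i)))^2) = (\<Sum>k\<in>K. (cmod (c k))^2)"
    using assms inv by (subst sum.reindex) auto
  ultimately show ?thesis using parseval_trig[of "\<phi> ` K" "\<lambda>i. c (inv_into K \<phi> i)"] assms(1) by simp
qed

text \<open>Cauchy--Schwarz gives the weight 1 / N, which is at most 1 / j for j \<le> N. The
  resulting bound no longer depends on N, so one square function controls all averages at
  once.\<close>

lemma average_square_le:
  fixes X :: "nat \<Rightarrow> complex"
  assumes "1 \<le> N" "N \<le> N0"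
  shows "(cmod ((\<Sum>j=1..N. X j) / of_nat N))^2 \<le> (\<Sum>j=1..N0. (1 / real j) * (cmod (X j))^2)"
proof -
  have "(cmod (\<Sum>j=1..N. X j))^2 \<le> (\<Sum>j=1..N. 1 * cmod (X j))^2"
    by (intro power_mono) (auto intro: norm_sum)
  also have "\<dots> \<le> (\<Sum>j=1..N. 1^2) * (\<Sum>j=1..N. (cmod (X j))^2)"
    by (rule Cauchy_Schwarz_ineq_sum)
  finally have "(cmod ((\<Sum>j=1..N. X j) / of_nat N))^2 \<le> real N * (\<Sum>j=1..N. (cmod (X j))^2) / (real N)^2"
    by (simp add: norm_divide power_divide divide_right_mono)
  also have "\<dots> = (\<Sum>j=1..N. (1 / real N) * (cmod (X j))^2)"
    using assms by (simp add: sum_distrib_left power2_eq_square field_simps)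
  also have "\<dots> \<le> (\<Sum>j=1..N. (1 / real j) * (cmod (X j))^2)"
    using assms by (intro sum_mono mult_right_mono divide_left_mono) auto
  also have "\<dots> \<le> (\<Sum>j=1..N0. (1 / real j) * (cmod (X j))^2)"
    using assms by (intro sum_mono2) auto
  finally show ?thesis .
qed

lemma sum_inverse_squares_le: "(\<Sum>m=1..N. 1 / (real m)^2) \<le> 2"
proof -
  have "(\<Sum>m=1..Suc N. 1 / (real m)^2) \<le> 2 - 1 / real (Suc N)" for N
  proof (induction N)
    case (Suc N)
    have "1 / (real (Suc (Suc N)))^2 \<le> 1 / real (Suc N) - 1 / real (Suc (Suc N))"
    proof -
      have "1 / (real (Suc (Suc N)))^2 \<le> 1 / (real (Suc N) * real (Suc (Suc N)))"
        unfolding power2_eq_square by (intro divide_left_mono mult_right_mono) auto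
      also have "\<dots> = 1 / real (Suc N) - 1 / real (Suc (Suc N))" by (simp add: field_simps)
      finally show ?thesis .
    qed
    thus ?case using Suc by simp
  qed simp
  from this[of "N - 1"] show ?thesis by (cases N) (auto intro: order.trans)
qed

text \<open>As in the strong law of large numbers: the averages are estimated along the squares \<open>m^2\<close>, and the gap to the next
  square is short enough for the Cauchy--Schwarz inequality.\<close>

lemma orthogonal_averages_maximal:
  fixes G :: "nat \<Rightarrow> 'a \<Rightarrow> complex"
  assumes A: "\<And>J. finite J \<Longrightarrow> J \<subseteq> {1..} \<Longrightarrow> integrable M (\<lambda>x. (cmod (\<Sum>j\<in>J. G j x))^2)"
    "\<And>J. finite J \<Longrightarrow> J \<subseteq> {1..} \<Longrightarrow> (LINT x|M. (cmod (\<Sum>j\<in>J. G j x))^2) \<le> real (card J) * A"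
  obtains Z where "integrable M Z" "(LINT x|M. Z x) \<le> 20 * A" "\<And>x. Z x \<ge> 0"
    "\<And>x N. 1 \<le> N \<Longrightarrow> N \<le> N0 \<Longrightarrow> (cmod ((\<Sum>j=1..N. G j x) / of_nat N))^2 \<le> Z x"
proof -
  have A0: "0 \<le> A"
    using order.trans[OF Bochner_Integration.integral_nonneg A(2)[of "{1}"]] by auto
  have int1: "integrable M (\<lambda>x. (cmod (G j x))^2)" "(LINT x|M. (cmod (G j x))^2) \<le> A" if "j \<ge> 1" for j
    using A[of "{j}"] that by auto
  \<comment> \<open>The indices strictly between m^2 and (m + 1)^2.\<close>
  define J where "J m = {m^2<..m^2 + 2 * m}" for m :: nat
  \<comment> \<open>Dominates the squared average for every N of the block: the 2 comes from (a +
    b)^2 \<le> 2 a^2 + 2 b^2, and 4 / m^3 = 2 * 2m / m^4 contains the number 2m of indices in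
    \<open>J m\<close>. Its integral is at most (2 + 8) A / m^2.\<close>
  define Y where "Y m x = 2 / real m ^ 4 * (cmod (\<Sum>j\<in>{1..m^2}. G j x))^2 + 4 / real m ^ 3 * (\<Sum>j\<in>J m. (cmod (G j x))^2)" for m x
  define Z where "Z x = (\<Sum>m=1..N0. Y m x)" for x
  have J1: "j \<ge> 1" if "j \<in> J m" for j m using that by (auto simp: J_def)
  have J_int: "integrable M (\<lambda>x. \<Sum>j\<in>J m. (cmod (G j x))^2)" for m
    using int1 J1 by (intro Bochner_Integration.integrable_sum) blast
  have Y_int: "integrable M (Y m)" for m
    unfolding Y_def [abs_def] by (intro Bochner_Integration.integrable_add integrable_mult_right A J_int) auto
  have Y_le: "(LINT x|M. Y m x) \<le> 10 * A * (1 / (real m)^2)" if "m \<ge> 1" for m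
  proof -
    have "(LINT x|M. Y m x) = 2 / real m ^ 4 * (LINT x|M. (cmod (\<Sum>j\<in>{1..m^2}. G j x))^2) + 4 / real m ^ 3 * (LINT x|M. (\<Sum>j\<in>J m. (cmod (G j x))^2))"
    proof -
      have "integrable M (\<lambda>x. (cmod (\<Sum>j\<in>{1..m^2}. G j x))^2)" by (rule A) auto
      thus ?thesis unfolding Y_def using J_int
        by (subst Bochner_Integration.integral_add) auto
    qed
    also have "(LINT x|M. (\<Sum>j\<in>J m. (cmod (G j x))^2)) = (\<Sum>j\<in>J m. (LINT x|M. (cmod (G j x))^2))"
      using int1 J1 by (intro Bochner_Integration.integral_sum) blast
    also have "2 / real m ^ 4 * (LINT x|M. (cmod (\<Sum>j\<in>{1..m^2}. G j x))^2) + 4 / real m ^ 3 * (\<Sum>j\<in>J m. (LINT x|M. (cmod (G j x))^2))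
       \<le> 2 / real m ^ 4 * (real (m^2) * A) + 4 / real m ^ 3 * (\<Sum>j\<in>J m. A)"
    proof -
      have "(LINT x|M. (cmod (\<Sum>j\<in>{1..m^2}. G j x))^2) \<le> real (m^2) * A"
        using A(2)[of "{1..m^2}"] by simp
      moreover have "(\<Sum>j\<in>J m. (LINT x|M. (cmod (G j x))^2)) \<le> (\<Sum>j\<in>J m. A)"
        using int1(2) J1 by (intro sum_mono) blast
      ultimately show ?thesis by (intro add_mono mult_left_mono) auto
    qed
    also have "\<dots> = 10 * A * (1 / (real m)^2)"
    proof -
      have "card (J m) = 2 * m" by (simp add: J_def)
      thus ?thesis using that by (simp add: power2_eq_square power3_eq_cube power4_eq_xxxx field_simps)
    qed
    finally show ?thesis .
  qed
  show ?thesis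
  proof (rule that)
    show "integrable M Z" unfolding Z_def by (intro Bochner_Integration.integrable_sum Y_int)
    have "(LINT x|M. Z x) = (\<Sum>m=1..N0. (LINT x|M. Y m x))"
      unfolding Z_def by (intro Bochner_Integration.integral_sum Y_int)
    also have "\<dots> \<le> (\<Sum>m=1..N0. 10 * A * (1 / (real m)^2))" by (intro sum_mono Y_le) auto
    also have "\<dots> = 10 * A * (\<Sum>m=1..N0. 1 / (real m)^2)" by (rule sum_distrib_left[symmetric])
    also have "\<dots> \<le> 10 * A * 2" using A0 by (intro mult_left_mono sum_inverse_squares_le) auto
    finally show "(LINT x|M. Z x) \<le> 20 * A" by simp
    have Y0: "Y m x \<ge> 0" for m x unfolding Y_def by (intro add_nonneg_nonneg mult_nonneg_nonneg sum_nonneg) auto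
    thus "Z x \<ge> 0" for x unfolding Z_def by (intro sum_nonneg) auto
    fix x N assume N: "1 \<le> N" "N \<le> N0"
    define m where "m = floor_sqrt N"
    have m: "m^2 \<le> N" "N < (m + 1)^2" "1 \<le> m"
      using N floor_sqrt_power2_le[of N] Suc_floor_sqrt_power2_gt[of N] by (auto simp: m_def Suc_le_eq)
    have mN: "m \<le> N" using m(1,3) by (meson order.trans self_le_power zero_less_numeral)
    have split: "{1..N} = {1..m^2} \<union> {m^2<..N}" using m by auto
    have sub: "{m^2<..N} \<subseteq> J m" using m(2) by (auto simp: J_def power2_eq_square)
    have "cmod (\<Sum>j=1..N. G j x) \<le> cmod (\<Sum>j\<in>{1..m^2}. G j x) + (\<Sum>j\<in>{m^2<..N}. cmod (G j x))"
      unfolding split by (subst sum.union_disjoint) (auto intro!: norm_triangle_mono norm_sum)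
    also have "(\<Sum>j\<in>{m^2<..N}. cmod (G j x)) \<le> (\<Sum>j\<in>J m. 1 * cmod (G j x))"
      using sub by (simp, intro sum_mono2) (auto simp: J_def)
    finally have "(cmod (\<Sum>j=1..N. G j x))^2 \<le> (cmod (\<Sum>j\<in>{1..m^2}. G j x) + (\<Sum>j\<in>J m. 1 * cmod (G j x)))^2"
      by (intro power_mono) auto
    also have "\<dots> \<le> 2 * (cmod (\<Sum>j\<in>{1..m^2}. G j x))^2 + 2 * (\<Sum>j\<in>J m. 1 * cmod (G j x))^2"
      by (smt (verit) power2_sum sum_squares_bound)
    also have "(\<Sum>j\<in>J m. 1 * cmod (G j x))^2 \<le> (\<Sum>j\<in>J m. 1^2) * (\<Sum>j\<in>J m. (cmod (G j x))^2)"
      by (rule Cauchy_Schwarz_ineq_sum)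
    also have "(\<Sum>j\<in>J m. 1^2) = 2 * real m" by (simp add: J_def)
    finally have "(cmod (\<Sum>j=1..N. G j x))^2 / real m ^ 4 \<le> (2 * (cmod (\<Sum>j\<in>{1..m^2}. G j x))^2 + 2 * (2 * real m * (\<Sum>j\<in>J m. (cmod (G j x))^2))) / real m ^ 4"
      by (intro divide_right_mono) auto
    also have "\<dots> = Y m x"
      using m(3) by (simp add: Y_def add_divide_distrib power3_eq_cube power4_eq_xxxx)
    also have "\<dots> \<le> Z x" unfolding Z_def using m(3) mN N Y0 by (intro member_le_sum) auto
    finally have "(cmod (\<Sum>j=1..N. G j x))^2 / real m ^ 4 \<le> Z x" .
    moreover have "(cmod (\<Sum>j=1..N. G j x))^2 / (real N)^2 \<le> (cmod (\<Sum>j=1..N. G j x))^2 / real m ^ 4"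
    proof -
      have "real m ^ 4 = (real (m^2))^2" by simp
      also have "\<dots> \<le> (real N)^2" using m(1) by (intro power_mono) auto
      finally show ?thesis using m(3) N by (intro divide_left_mono mult_pos_pos) auto
    qed
    ultimately show "(cmod ((\<Sum>j=1..N. G j x) / of_nat N))^2 \<le> Z x"
      by (simp add: norm_divide power_divide)
  qed
qed

section \<open>The bad part\<close>

text \<open>The 4 in \<open>b_norm\<close>: the mean of |f| over a selected interval is at most 2
  \<open>lam\<close>, and subtracting the mean of f at most doubles the norm.\<close>

locale bad_part = sparse_sequence +
  fixes II :: "(real \<times> real) set" and b :: "real \<times> real \<Rightarrow> real \<Rightarrow> real" and lam :: real
  assumes fin: "finite II" and disj: "pairwise (\<lambda>p q. iv p \<inter> iv q = {}) II"
    and II: "\<And>p. p \<in> II \<Longrightarrow> 0 < snd p" "\<And>p. p \<in> II \<Longrightarrow> - pi \<le> fst p" "\<And>p. p \<in> II \<Longrightarrow> fst p + snd p \<le> pi"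
    and lam: "0 < lam"
    and b_int: "\<And>p. p \<in> II \<Longrightarrow> integrable torusM (b p)"
    and b_supp: "\<And>p t. p \<in> II \<Longrightarrow> t \<notin> iv p \<Longrightarrow> b p t = 0"
    and b_mean: "\<And>p. p \<in> II \<Longrightarrow> (LINT t|torusM. b p t) = 0"
    and b_norm: "\<And>p. p \<in> II \<Longrightarrow> (l1_int (b p)) \<le> 4 * lam * snd p"
begin

section \<open>Modulated coefficients of the atoms\<close>

definition \<beta> :: "nat \<Rightarrow> real \<times> real \<Rightarrow> complex" where
  "\<beta> j p = tcoeff (\<lambda>t. of_real (b p t)) (int (n j + 1))"

definition \<Lambda> :: real where "\<Lambda> = (\<Sum>p\<in>II. snd p)"

lemma Lambda_nonneg: "0 \<le> \<Lambda>"
  unfolding \<Lambda>_def using II by (intro sum_nonneg) (auto intro: less_imp_le)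

lemma beta_le: assumes "p \<in> II" shows "cmod (\<beta> j p) \<le> 4 * lam * snd p"
  unfolding \<beta>_def using order.trans[OF tcoeff_norm_le] b_norm[OF assms] by simp

lemma beta_square_le: assumes "p \<in> II" shows "(cmod (\<beta> j p))^2 \<le> 16 * lam^2 * snd p * snd p"
  using power_mono[OF beta_le[OF assms, of j] norm_ge_zero, of 2] by (simp add: power2_eq_square mult_ac)

text \<open>Since b has mean zero, the exponential may be replaced by its difference to the value at
  the left end, which is at most (n_j + 1) l \<le> 2 n_j l.\<close>

lemma beta_le_low: fixes p :: "real \<times> real" assumes p: "p \<in> II" and j: "j \<ge> 1" shows "cmod (\<beta> j p) \<le> 4 * lam * snd p * (2 * (n j * snd p))"
proof -
  define m where "m = of_int (int (n j + 1)) * (1::real)"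
  have cb: "integrable torusM (\<lambda>t. complex_of_real (b p t))" using b_int[OF p] by simp
  have cbm: "integrable torusM (\<lambda>t. complex_of_real (b p t) * cis (- (m * t)))"
    by (rule integrable_mult_cis[OF cb]) measurable
  have "(LINT t|torusM. complex_of_real (b p t)) = of_real (LINT t|torusM. b p t)"
    by (rule integral_complex_of_real)
  hence "(LINT t|torusM. cis (- (m * fst p)) * complex_of_real (b p t)) = 0" using b_mean[OF p] by simp
  hence "\<beta> j p = (LINT t|torusM. complex_of_real (b p t) * cis (- (m * t))) - (LINT t|torusM. cis (- (m * fst p)) * complex_of_real (b p t))"
    by (simp add: \<beta>_def tcoeff_def m_def)
  also have "\<dots> = (LINT t|torusM. complex_of_real (b p t) * cis (- (m * t)) - cis (- (m * fst p)) * complex_of_real (b p t))"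
    by (rule Bochner_Integration.integral_diff[OF cbm integrable_mult_right[OF cb], symmetric])
  finally have e: "\<beta> j p = (LINT t|torusM. complex_of_real (b p t) * cis (- (m * t)) - cis (- (m * fst p)) * complex_of_real (b p t))" .
  have "cmod (\<beta> j p) \<le> (LINT t|torusM. cmod (complex_of_real (b p t) * cis (- (m * t)) - cis (- (m * fst p)) * complex_of_real (b p t)))"
    unfolding e by (rule integral_norm_bound)
  also have "\<dots> \<le> (LINT t|torusM. 2 * (n j * snd p) * \<bar>b p t\<bar>)"
  proof (rule integral_mono[OF integrable_norm[OF Bochner_Integration.integrable_diff[OF cbm integrable_mult_right[OF cb]]]])
    show "integrable torusM (\<lambda>t. 2 * (n j * snd p) * \<bar>b p t\<bar>)" using b_int[OF p] by simp
    fix t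
    show "cmod (complex_of_real (b p t) * cis (- (m * t)) - cis (- (m * fst p)) * complex_of_real (b p t)) \<le> 2 * (n j * snd p) * \<bar>b p t\<bar>"
    proof (cases "t \<in> iv p")
      case True
      have "cmod (complex_of_real (b p t) * cis (- (m * t)) - cis (- (m * fst p)) * complex_of_real (b p t))
         = \<bar>b p t\<bar> * cmod (cis (- (m * t)) - cis (- (m * fst p)))"
        by (metis (no_types, opaque_lifting) mult.commute norm_mult norm_of_real right_diff_distrib)
      also have "\<dots> \<le> \<bar>b p t\<bar> * \<bar>- (m * t) - - (m * fst p)\<bar>" by (intro mult_left_mono chord_le) auto
      also have "\<bar>- (m * t) - - (m * fst p)\<bar> = m * \<bar>t - fst p\<bar>"
      proof -
        have "- (m * t) - - (m * fst p) = - (m * (t - fst p))" by (simp add: algebra_simps)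
        moreover have "m \<ge> 0" by (simp add: m_def)
        ultimately show ?thesis by (simp add: abs_mult)
      qed
      also have "\<bar>b p t\<bar> * (m * \<bar>t - fst p\<bar>) \<le> \<bar>b p t\<bar> * ((2 * n j) * snd p)"
        using True npos[OF j] by (intro mult_left_mono mult_mono) (auto simp: m_def iv_def)
      finally show ?thesis by (simp add: mult_ac)
    next
      case False
      thus ?thesis using b_supp[OF p] by simp
    qed
  qed
  also have "\<dots> = 2 * (n j * snd p) * (l1_int (b p))" by (rule integral_mult_right_zero)
  also have "\<dots> \<le> 2 * (n j * snd p) * (4 * lam * snd p)"
    using b_norm[OF p] II(1)[OF p] by (intro mult_left_mono) auto
  finally show ?thesis by (simp add: mult_ac)
qed

text \<open>The threshold is j^\<delta> and not 1: beyond it the gap n_{j+1} - n_j \<ge> n_j /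
  j^\<delta> exceeds 1 / |I|, the frequency scale of the bump.\<close>

definition low :: "nat \<Rightarrow> (real \<times> real) set" where "low j = {p \<in> II. n j * snd p \<le> real j powr \<delta>}"

definition bcoeff :: "nat \<Rightarrow> (real \<times> real) set \<Rightarrow> int \<Rightarrow> complex" where
  "bcoeff j S k = (\<Sum>p\<in>S. \<beta> j p * tcoeff (cbump (fst p) (snd p)) k)"

lemma iv_torus: "p \<in> II \<Longrightarrow> iv p \<subseteq> torus"
  using II by (fastforce simp: iv_def)

lemma bcoeff_square_sum:
  assumes "S \<subseteq> II" "finite K"
  shows "(\<Sum>k\<in>K. (cmod (bcoeff j S k))^2) \<le> 8 * pi * (\<Sum>p\<in>S. (cmod (\<beta> j p))^2 / snd p)"
proof -
  have "(\<Sum>k\<in>K. (cmod (bcoeff j S k))^2) \<le> 2 * pi * (\<Sum>p\<in>S. (cmod (\<beta> j p))^2 * (2 / snd p)^2 * snd p)"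
    unfolding bcoeff_def
  proof (rule bessel_disjoint_sum)
    fix p assume p: "p \<in> S"
    show "cmod (cbump (fst p) (snd p) t) \<le> 2 / snd p" for t
      using II(1)[of p] p assms(1) by (intro cbump_norm) blast
    show "0 \<le> snd p" using II(1)[of p] p assms(1) by (blast intro: less_imp_le)
  qed (use assms II disj fin finite_subset iv_torus in \<open>auto intro: pairwise_subset less_imp_le simp: cbump_outside iv_def\<close>)
  also have "(\<Sum>p\<in>S. (cmod (\<beta> j p))^2 * (2 / snd p)^2 * snd p) = (\<Sum>p\<in>S. 4 * ((cmod (\<beta> j p))^2 / snd p))"
    using II assms(1) by (intro sum.cong) (auto simp: power2_eq_square field_simps)
  finally show ?thesis unfolding sum_distrib_left[symmetric] by simp
qed

text \<open>Chebyshev in frequency: multiplying by k \<ge> m yields the coefficients of the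
  derivatives, whose supports are still disjoint. The bound 6 / l^2 on the derivative gives 72 = 2 *
  36.\<close>

lemma bcoeff_tail_square_sum:
  assumes "S \<subseteq> II" "finite K" "0 < m" "\<And>k. k \<in> K \<Longrightarrow> m \<le> real_of_int k"
  shows "(\<Sum>k\<in>K. (cmod (bcoeff j S k))^2) \<le> 72 * pi * (\<Sum>p\<in>S. (cmod (\<beta> j p))^2 / snd p * (1 / (m * snd p))^2)"
proof -
  have "(\<Sum>k\<in>K. (m * cmod (bcoeff j S k))^2) \<le> (\<Sum>k\<in>K. (cmod (\<Sum>p\<in>S. \<beta> j p * tcoeff (cbump' (fst p) (snd p)) k))^2)"
  proof (rule sum_mono)
    fix k assume k: "k \<in> K"
    have "(\<Sum>p\<in>S. \<beta> j p * tcoeff (cbump' (fst p) (snd p)) k) = \<i> * of_int k * bcoeff j S k"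
      unfolding bcoeff_def sum_distrib_left using II assms(1) by (intro sum.cong) (auto simp: tcoeff_cbump' subset_eq)
    hence "cmod (\<Sum>p\<in>S. \<beta> j p * tcoeff (cbump' (fst p) (snd p)) k) = \<bar>of_int k\<bar> * cmod (bcoeff j S k)"
      by (simp add: norm_mult)
    moreover have "m * cmod (bcoeff j S k) \<le> \<bar>of_int k\<bar> * cmod (bcoeff j S k)"
      using assms(4)[OF k] by (intro mult_right_mono) auto
    ultimately show "(m * cmod (bcoeff j S k))^2 \<le> (cmod (\<Sum>p\<in>S. \<beta> j p * tcoeff (cbump' (fst p) (snd p)) k))^2"
      using assms(3) by (intro power_mono) auto
  qed
  also have "\<dots> \<le> 2 * pi * (\<Sum>p\<in>S. (cmod (\<beta> j p))^2 * (6 / (snd p)^2)^2 * snd p)"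
  proof (rule bessel_disjoint_sum)
    fix p assume p: "p \<in> S"
    show "cmod (cbump' (fst p) (snd p) t) \<le> 6 / (snd p)^2" for t
      using II(1)[of p] p assms(1) by (intro cbump_norm) blast
    show "0 \<le> snd p" using II(1)[of p] p assms(1) by (blast intro: less_imp_le)
  qed (use assms II disj fin finite_subset iv_torus in \<open>auto intro: pairwise_subset less_imp_le simp: cbump_outside iv_def\<close>)
  finally have "m^2 * (\<Sum>k\<in>K. (cmod (bcoeff j S k))^2) \<le> 2 * pi * (\<Sum>p\<in>S. (cmod (\<beta> j p))^2 * (6 / (snd p)^2)^2 * snd p)"
    by (simp add: sum_distrib_left power_mult_distrib)
  hence "(\<Sum>k\<in>K. (cmod (bcoeff j S k))^2) \<le> 2 * pi * (\<Sum>p\<in>S. (cmod (\<beta> j p))^2 * (6 / (snd p)^2)^2 * snd p) / m^2"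
    using assms(3) by (simp add: field_simps)
  also have "\<dots> = 2 * pi * (\<Sum>p\<in>S. (cmod (\<beta> j p))^2 * (6 / (snd p)^2)^2 * snd p / m^2)"
    unfolding sum_divide_distrib[symmetric] times_divide_eq_right ..
  also have "(\<Sum>p\<in>S. (cmod (\<beta> j p))^2 * (6 / (snd p)^2)^2 * snd p / m^2) = (\<Sum>p\<in>S. 36 * ((cmod (\<beta> j p))^2 / snd p * (1 / (m * snd p))^2))"
  proof (intro sum.cong refl)
    fix p assume "p \<in> S"
    hence "p \<in> II" using assms(1) by blast
    hence "0 < snd p" by (rule II(1))
    hence "snd p \<noteq> 0" by simp
    moreover have "B * (6 / l^2)^2 * l / m^2 = 36 * (B / l * (1 / (m * l))^2)" if "l \<noteq> 0" for B l :: real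
      using that assms(3) by (simp add: divide_simps power2_eq_square)
    ultimately show "(cmod (\<beta> j p))^2 * (6 / (snd p)^2)^2 * snd p / m^2 = 36 * ((cmod (\<beta> j p))^2 / snd p * (1 / (m * snd p))^2)"
      by blast
  qed
  finally show ?thesis unfolding sum_distrib_left[symmetric] by simp
qed

text \<open>Shifted by \<open>n j + 1\<close>, these frequencies lie in \<open>{n j + 1..n (Suc j)}\<close>, and hence are disjoint for different \<open>j\<close>.\<close>

definition freqs :: "nat \<Rightarrow> nat \<Rightarrow> int set" where "freqs M j = {k \<in> {0..<int M}. k < int (n (Suc j)) - int (n j)}"

definition trig :: "(int \<Rightarrow> complex) \<Rightarrow> int set \<Rightarrow> real \<Rightarrow> complex" where
  "trig c K x = (\<Sum>k\<in>K. c k * cis (of_int k * x))"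

lemma trig_square:
  "finite K \<Longrightarrow> has_bochner_integral torusM (\<lambda>x. (cmod (trig c K x))^2) (2 * pi * (\<Sum>k\<in>K. (cmod (c k))^2))"
  unfolding trig_def by (rule parseval_trig)

text \<open>Common bound for the three regimes \<open>n l \<le> 1\<close> (cancellation), \<open>1 < n l \<le> j powr \<delta>\<close> (trivial bound) and
  \<open>j powr \<delta> < n l\<close> (smoothness).\<close>

definition \<omega> :: "nat \<Rightarrow> real \<Rightarrow> real" where
  "\<omega> j l = (if real (n j) * l \<le> 1 then real (n j) * l else 0) + (if real (n j) * l \<ge> 1 then real j powr \<delta> / (real (n j) * l) else 0)"

lemma omega_sum: fixes l :: real assumes "0 < l" shows "(\<Sum>j=1..N. (1 / real j) * \<omega> j l) \<le> 4"
proof -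
  have "(1 / real j) * \<omega> j l \<le> low_wt j l + high_wt j l"
    if j: "j \<in> {1..N}" for j
  proof -
    have 1: "1 / real j \<le> 1 / real j powr \<delta>" using j \<delta> by (intro powr_ge_one_div) auto
    \<comment> \<open>Here 2 \<delta> < 1 enters as \<delta> - 1 \<le> - \<delta>: the weight 1 / j
      must absorb j^\<delta> and still leave the j^{-\<delta>} needed for telescoping.\<close>
    have "real j powr \<delta> / real j = real j powr (\<delta> - 1)" using j by (simp add: powr_diff)
    also have "\<dots> \<le> real j powr (- \<delta>)" using j \<delta> by (intro powr_mono) auto
    also have "\<dots> = 1 / real j powr \<delta>" by (simp add: powr_minus_divide)
    finally have 2: "real j powr \<delta> / real j \<le> 1 / real j powr \<delta>" .
    have nl: "n j * l > 0" using npos[of j] j assms by auto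
    have "(1 / real j) * (n j * l) \<le> 1 / real j powr \<delta> * (n j * l)" using 1 nl by (intro mult_right_mono) auto
    moreover have "(1 / real j) * (real j powr \<delta> / (n j * l)) \<le> 1 / real j powr \<delta> / (n j * l)"
      using divide_right_mono[OF 2, of "n j * l"] nl by (simp add: mult_ac)
    ultimately have "(1 / real j) * (if n j * l \<le> 1 then n j * l else 0) \<le> low_wt j l"
      "(1 / real j) * (if n j * l \<ge> 1 then real j powr \<delta> / (n j * l) else 0) \<le> high_wt j l"
      by (simp_all only: low_wt_def high_wt_def if_True if_False mult_zero_right order.refl split: if_split) blast+
    thus ?thesis unfolding \<omega>_def distrib_left by (rule add_mono)
  qed
  hence "(\<Sum>j=1..N. (1 / real j) * \<omega> j l) \<le> (\<Sum>j=1..N. low_wt j l + high_wt j l)"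
    by (rule sum_mono)
  also have "\<dots> \<le> 2 + 2"
    unfolding sum.distrib using assms by (intro add_mono sum_low_frequencies sum_high_frequencies)
  finally show ?thesis by simp
qed

text \<open>With y = n_j l: for y \<le> 1 the mean zero gives y^2 \<le> y, and for 1 < y \<le>
  j^\<delta> the trivial bound suffices since \<omega> \<ge> 1. The constant is (4 * 2)^2.\<close>

lemma low_term:
  assumes p: "p \<in> low j" and j: "j \<ge> 1"
  shows "(cmod (\<beta> j p))^2 / snd p \<le> 64 * lam^2 * (snd p * \<omega> j (snd p))"
proof -
  define y where "y = n j * snd p"
  have pI: "p \<in> II" and y: "y \<le> real j powr \<delta>" using p by (auto simp: low_def y_def)
  have l: "0 < snd p" by (rule II(1)[OF pI])
  have y0: "0 < y" using npos[OF j] l by (simp add: y_def)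
  show ?thesis
  proof (cases "y \<le> 1")
    case True
    have "(cmod (\<beta> j p))^2 \<le> (4 * lam * snd p * (2 * y))^2"
      using beta_le_low[OF pI j] by (intro power_mono) (auto simp: y_def)
    also have "\<dots> = 64 * lam^2 * (snd p)^2 * (y * y)" by (simp add: power2_eq_square)
    also have "\<dots> \<le> 64 * lam^2 * (snd p)^2 * (y * 1)" using True y0 by (intro mult_left_mono) auto
    also have "y \<le> \<omega> j (snd p)" using True y0 unfolding \<omega>_def y_def[symmetric] by auto
    hence "64 * lam^2 * (snd p)^2 * (y * 1) \<le> 64 * lam^2 * (snd p)^2 * \<omega> j (snd p)" by (intro mult_left_mono) auto
    finally have "(cmod (\<beta> j p))^2 \<le> (64 * lam^2 * (snd p * \<omega> j (snd p))) * snd p" by (simp add: power2_eq_square mult_ac)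
    thus ?thesis using l by (simp add: pos_divide_le_eq)
  next
    case False
    have "(cmod (\<beta> j p))^2 \<le> 16 * lam^2 * (snd p)^2 * 1" using beta_square_le[OF pI] by (simp add: power2_eq_square mult.assoc)
    also have "\<dots> \<le> 64 * lam^2 * (snd p)^2 * \<omega> j (snd p)"
    proof (intro mult_mono)
      show "1 \<le> \<omega> j (snd p)" using False y y0 unfolding \<omega>_def y_def[symmetric] by (auto simp: field_simps)
    qed auto
    finally have "(cmod (\<beta> j p))^2 \<le> (64 * lam^2 * (snd p * \<omega> j (snd p))) * snd p" by (simp add: power2_eq_square mult_ac)
    thus ?thesis using l by (simp add: pos_divide_le_eq)
  qed
qed

text \<open>The gap is at least n_j / q with q = j^\<delta>, so the reciprocal to be squared is at
  most q / y < 1, and its square at most q / y.\<close>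

lemma high_term:
  assumes p: "p \<in> II - low j" and j: "j \<ge> 1"
  shows "(cmod (\<beta> j p))^2 / snd p * (1 / ((real (n (Suc j)) - real (n j)) * snd p))^2 \<le> 16 * lam^2 * (snd p * \<omega> j (snd p))"
proof -
  define y where "y = n j * snd p"
  define m where "m = real (n (Suc j)) - real (n j)"
  define q where "q = real j powr \<delta>"
  have q1: "q \<ge> 1" using j \<delta> by (simp add: q_def ge_one_powr_ge_zero)
  have pI: "p \<in> II" and y: "y > q" using p by (auto simp: low_def y_def q_def)
  have l: "0 < snd p" by (rule II(1)[OF pI])
  have nj: "real (n j) > 0" using npos[OF j] by simp
  have 1: "(cmod (\<beta> j p))^2 / snd p \<le> 16 * lam^2 * snd p" using l beta_square_le[OF pI] by (simp add: pos_divide_le_eq)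
  have m: "m \<ge> n j / q" using growth[OF j] by (simp add: m_def q_def algebra_simps)
  have "n j / q > 0" using nj q1 by auto
  hence "1 / (m * snd p) \<le> 1 / (n j / q * snd p)"
    using m l by (intro divide_left_mono mult_right_mono mult_pos_pos) auto
  also have "\<dots> = q / y" using nj q1 by (simp add: y_def)
  finally have "(1 / (m * snd p))^2 \<le> (q / y)^2" using m \<open>n j / q > 0\<close> l by (intro power_mono) auto
  also have "\<dots> \<le> q / y" unfolding power2_eq_square using y q1 by (intro mult_left_le) auto
  also have "\<dots> \<le> \<omega> j (snd p)" using y q1 unfolding \<omega>_def y_def[symmetric] q_def[symmetric] by auto
  finally have 2: "(1 / (m * snd p))^2 \<le> \<omega> j (snd p)" .
  have "(cmod (\<beta> j p))^2 / snd p * (1 / (m * snd p))^2 \<le> 16 * lam^2 * snd p * \<omega> j (snd p)"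
    using 1 2 l by (intro mult_mono) auto
  thus ?thesis by (simp add: m_def mult_ac)
qed

text \<open>\<open>P\<close> collects the short intervals, \<open>Q\<close> the long ones at gap
  frequencies, \<open>R\<close> the long ones at the other frequencies. \<open>P\<close> and
  \<open>R\<close> are square summable with weights 1 / j; \<open>Q\<close> is merely bounded in L^2
  and needs orthogonality in j.\<close>

definition P where "P M j = trig (bcoeff j (low j)) {0..<int M}"
definition R where "R M j = trig (bcoeff j (II - low j)) ({0..<int M} - freqs M j)"
definition Q where "Q M j = trig (bcoeff j (II - low j)) (freqs M j)"

lemma integrable_trig_square: "finite K \<Longrightarrow> integrable torusM (\<lambda>x. (cmod (trig c K x))^2)"
  using trig_square by (rule integrable.intros)

lemma finite_freqs: "finite (freqs M j)"
  unfolding freqs_def by (rule finite_subset[of _ "{0..<int M}"]) auto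

lemma PR_square:
  assumes j: "j \<ge> 1"
  shows "(l2_int (P M j)) + (l2_int (R M j)) \<le> 2304 * pi^2 * lam^2 * (\<Sum>p\<in>II. snd p * \<omega> j (snd p))"
proof -
  define m where "m = real (n (Suc j)) - real (n j)"
  have m: "0 < m" using growth_strict[OF j] by (simp add: m_def)
  have w: "0 \<le> snd p * \<omega> j (snd p)" if "p \<in> II" for p
    using II(1)[OF that] unfolding \<omega>_def by (intro mult_nonneg_nonneg add_nonneg_nonneg) auto
  have lowII: "low j \<subseteq> II" by (auto simp: low_def)
  have "(l2_int (P M j)) = 2 * pi * (\<Sum>k\<in>{0..<int M}. (cmod (bcoeff j (low j) k))^2)"
    unfolding P_def by (rule has_bochner_integral_integral_eq[OF trig_square]) simp
  also have "\<dots> \<le> 2 * pi * (8 * pi * (\<Sum>p\<in>low j. (cmod (\<beta> j p))^2 / snd p))"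
    by (intro mult_left_mono bcoeff_square_sum lowII) auto
  also have "\<dots> \<le> 2 * pi * (8 * pi * (\<Sum>p\<in>low j. 64 * lam^2 * (snd p * \<omega> j (snd p))))"
    by (intro mult_left_mono sum_mono low_term j) auto
  also have "\<dots> = 1024 * pi^2 * lam^2 * (\<Sum>p\<in>low j. snd p * \<omega> j (snd p))"
    unfolding sum_distrib_left[symmetric] by (simp add: power2_eq_square)
  \<comment> \<open>Raised from 1024 to the constant of \<open>R\<close>, so that the sums over the
    short and the long intervals combine.\<close>
  also have "\<dots> \<le> 2304 * pi^2 * lam^2 * (\<Sum>p\<in>low j. snd p * \<omega> j (snd p))"
    using w lowII by (intro mult_right_mono sum_nonneg) auto
  finally have 1: "(l2_int (P M j)) \<le> 2304 * pi^2 * lam^2 * (\<Sum>p\<in>low j. snd p * \<omega> j (snd p))" .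
  have "(l2_int (R M j)) = 2 * pi * (\<Sum>k\<in>{0..<int M} - freqs M j. (cmod (bcoeff j (II - low j) k))^2)"
    unfolding R_def by (rule has_bochner_integral_integral_eq[OF trig_square]) simp
  also have "\<dots> \<le> 2 * pi * (72 * pi * (\<Sum>p\<in>II - low j. (cmod (\<beta> j p))^2 / snd p * (1 / (m * snd p))^2))"
  proof (intro mult_left_mono bcoeff_tail_square_sum m)
    fix k assume "k \<in> {0..<int M} - freqs M j"
    hence "int (n (Suc j)) - int (n j) \<le> k" by (auto simp: freqs_def)
    thus "m \<le> real_of_int k" by (simp add: m_def)
  qed auto
  also have "\<dots> \<le> 2 * pi * (72 * pi * (\<Sum>p\<in>II - low j. 16 * lam^2 * (snd p * \<omega> j (snd p))))"
    unfolding m_def by (intro mult_left_mono sum_mono high_term j) auto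
  also have "\<dots> = 2304 * pi^2 * lam^2 * (\<Sum>p\<in>II - low j. snd p * \<omega> j (snd p))"
    unfolding sum_distrib_left[symmetric] by (simp add: power2_eq_square)
  finally have 2: "(l2_int (R M j)) \<le> 2304 * pi^2 * lam^2 * (\<Sum>p\<in>II - low j. snd p * \<omega> j (snd p))" .
  have "(\<Sum>p\<in>II. snd p * \<omega> j (snd p)) = (\<Sum>p\<in>low j. snd p * \<omega> j (snd p)) + (\<Sum>p\<in>II - low j. snd p * \<omega> j (snd p))"
    using sum.subset_diff[OF lowII fin] by (simp add: add.commute)
  thus ?thesis using 1 2 by (simp add: distrib_left)
qed

text \<open>After exchanging the sums each interval contributes its length times at most 4, by
  \<open>omega_sum\<close>.\<close>

lemma PR_square_sum:
  "(\<Sum>j=1..N. (1 / real j) * ((l2_int (P M j)) + (l2_int (R M j)))) \<le> 9216 * pi^2 * lam^2 * \<Lambda>"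
proof -
  have "(\<Sum>j=1..N. (1 / real j) * ((l2_int (P M j)) + (l2_int (R M j))))
     \<le> (\<Sum>j=1..N. (1 / real j) * (2304 * pi^2 * lam^2 * (\<Sum>p\<in>II. snd p * \<omega> j (snd p))))"
    by (intro sum_mono mult_left_mono PR_square) auto
  also have "\<dots> = 2304 * pi^2 * lam^2 * (\<Sum>j=1..N. \<Sum>p\<in>II. snd p * ((1 / real j) * \<omega> j (snd p)))"
    unfolding sum_distrib_left by (intro sum.cong refl) (simp add: mult_ac)
  also have "(\<Sum>j=1..N. \<Sum>p\<in>II. snd p * ((1 / real j) * \<omega> j (snd p))) = (\<Sum>p\<in>II. snd p * (\<Sum>j=1..N. (1 / real j) * \<omega> j (snd p)))"
    by (subst sum.swap) (simp only: sum_distrib_left)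
  also have "2304 * pi^2 * lam^2 * \<dots> \<le> 2304 * pi^2 * lam^2 * (\<Sum>p\<in>II. snd p * 4)"
    using II by (intro mult_left_mono sum_mono omega_sum) (auto intro: less_imp_le)
  also have "\<dots> = 9216 * pi^2 * lam^2 * \<Lambda>" by (simp add: \<Lambda>_def sum_distrib_right[symmetric])
  finally show ?thesis .
qed

text \<open>Only the trivial bound on \<beta> is used. The estimate is uniform in j without decay,
  so no weighted square sum could be controlled by it.\<close>

lemma Q_bcoeff_square: "(\<Sum>k\<in>freqs M j. (cmod (bcoeff j (II - low j) k))^2) \<le> 128 * pi * lam^2 * \<Lambda>"
proof -
  have "(\<Sum>k\<in>freqs M j. (cmod (bcoeff j (II - low j) k))^2) \<le> 8 * pi * (\<Sum>p\<in>II - low j. (cmod (\<beta> j p))^2 / snd p)"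
    by (intro bcoeff_square_sum finite_freqs) auto
  also have "\<dots> \<le> 8 * pi * (\<Sum>p\<in>II. (cmod (\<beta> j p))^2 / snd p)"
  proof (intro mult_left_mono sum_mono2 fin)
    fix p assume "p \<in> II - (II - low j)"
    thus "0 \<le> (cmod (\<beta> j p))^2 / snd p" using II(1)[of p] by simp
  qed auto
  also have "\<dots> \<le> 8 * pi * (\<Sum>p\<in>II. 16 * lam^2 * snd p)"
  proof (intro mult_left_mono sum_mono)
    fix p assume p: "p \<in> II"
    show "(cmod (\<beta> j p))^2 / snd p \<le> 16 * lam^2 * snd p" using II(1)[OF p] beta_square_le[OF p] by (simp add: pos_divide_le_eq)
  qed auto
  also have "\<dots> = 128 * pi * lam^2 * \<Lambda>" unfolding \<Lambda>_def sum_distrib_left[symmetric] by simp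
  finally show ?thesis .
qed

definition G where "G M j x = cis (real (n j + 1) * x) * Q M j x"

lemma G_orthogonal:
  assumes "finite J" "J \<subseteq> {1..}"
  shows "integrable torusM (\<lambda>x. (cmod (\<Sum>j\<in>J. G M j x))^2)"
    "(LINT x|torusM. (cmod (\<Sum>j\<in>J. G M j x))^2) \<le> real (card J) * (256 * pi^2 * lam^2 * \<Lambda>)"
proof -
  define K where "K = Sigma J (freqs M)"
  define \<phi> where "\<phi> = (\<lambda>(j, k). int (n j + 1) + k)"
  define c where "c = (\<lambda>(j, k). bcoeff j (II - low j) k)"
  have finK: "finite K" unfolding K_def using assms finite_freqs by auto
  have "inj_on \<phi> K"
  proof -
    \<comment> \<open>The restriction on k gives \<phi> (j, k) \<le> n_{j+1} \<le> n_{j'} < \<phi>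
      (j', k').\<close>
    have lt: "\<phi> (j, k) < \<phi> (j', k')" if "(j, k) \<in> K" "(j', k') \<in> K" "j < j'" for j k j' k'
    proof -
      have "n (Suc j) \<le> n j'" using that assms by (intro growth_mono) (auto simp: K_def)
      thus ?thesis using that by (auto simp: \<phi>_def K_def freqs_def)
    qed
    show ?thesis
    proof (rule inj_onI)
      fix x y assume xy: "x \<in> K" "y \<in> K" "\<phi> x = \<phi> y"
      obtain j k j' k' where e: "x = (j, k)" "y = (j', k')" by (cases x, cases y) auto
      have "j = j'" using lt[of j k j' k'] lt[of j' k' j k] xy e by (cases j j' rule: linorder_cases) auto
      thus "x = y" using xy e by (auto simp: \<phi>_def)
    qed
  qed
  from parseval_trig_inj[OF finK this, of c]
  have "has_bochner_integral torusM (\<lambda>x. (cmod (\<Sum>k\<in>K. c k * cis (of_int (\<phi> k) * x)))^2) (2 * pi * (\<Sum>k\<in>K. (cmod (c k))^2))" .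
  moreover have "(\<Sum>k\<in>K. c k * cis (of_int (\<phi> k) * x)) = (\<Sum>j\<in>J. G M j x)" for x
  proof -
    have "(\<Sum>k\<in>K. c k * cis (of_int (\<phi> k) * x)) = (\<Sum>j\<in>J. \<Sum>k\<in>freqs M j. bcoeff j (II - low j) k * cis (of_int (int (n j + 1) + k) * x))"
      unfolding K_def using assms finite_freqs by (subst sum.Sigma) (auto simp: c_def \<phi>_def intro!: sum.cong)
    also have "\<dots> = (\<Sum>j\<in>J. G M j x)"
      unfolding G_def Q_def trig_def sum_distrib_left
      by (intro sum.cong refl) (simp add: cis_mult[symmetric] algebra_simps)
    finally show ?thesis .
  qed
  moreover have "(\<Sum>k\<in>K. (cmod (c k))^2) = (\<Sum>j\<in>J. \<Sum>k\<in>freqs M j. (cmod (bcoeff j (II - low j) k))^2)"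
    unfolding K_def using assms finite_freqs by (subst sum.Sigma) (auto simp: c_def intro!: sum.cong)
  ultimately have *: "has_bochner_integral torusM (\<lambda>x. (cmod (\<Sum>j\<in>J. G M j x))^2) (2 * pi * (\<Sum>j\<in>J. \<Sum>k\<in>freqs M j. (cmod (bcoeff j (II - low j) k))^2))"
    by simp
  thus "integrable torusM (\<lambda>x. (cmod (\<Sum>j\<in>J. G M j x))^2)" by (rule integrable.intros)
  have "(\<Sum>j\<in>J. \<Sum>k\<in>freqs M j. (cmod (bcoeff j (II - low j) k))^2) \<le> (\<Sum>j\<in>J. 128 * pi * lam^2 * \<Lambda>)"
    by (intro sum_mono Q_bcoeff_square)
  hence "2 * pi * (\<Sum>j\<in>J. \<Sum>k\<in>freqs M j. (cmod (bcoeff j (II - low j) k))^2) \<le> 2 * pi * (\<Sum>j\<in>J. 128 * pi * lam^2 * \<Lambda>)"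
    by (intro mult_left_mono) auto
  thus "(LINT x|torusM. (cmod (\<Sum>j\<in>J. G M j x))^2) \<le> real (card J) * (256 * pi^2 * lam^2 * \<Lambda>)"
    unfolding has_bochner_integral_integral_eq[OF *] by (simp add: power2_eq_square mult_ac)
qed

end

section \<open>Maximal estimate for the whole bad part\<close>

context bad_part
begin

definition total :: "real \<Rightarrow> complex" where "total t = (\<Sum>p\<in>II. complex_of_real (b p t))"

text \<open>The condition \<open>near x < 1\<close> already excludes the doubled intervals (\<open>near_far\<close>), so no separate exceptional set
  has to be removed.\<close>

definition near :: "real \<Rightarrow> real" where
  "near x = (\<Sum>p\<in>II. 8 * snd p * (snd p / ((snd p)^2 + (cmod (cis x - cis (fst p)))^2)))"

lemma near_integrable: "integrable torusM near"
  unfolding near_def [abs_def] using II by (intro Bochner_Integration.integrable_sum integrable_mult_right integrable_poisson) auto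

lemma near_integral: "(LINT x|torusM. near x) \<le> 48 * pi * \<Lambda>"
proof -
  have "(LINT x|torusM. near x) = (\<Sum>p\<in>II. 8 * snd p * (LINT x|torusM. snd p / ((snd p)^2 + (cmod (cis x - cis (fst p)))^2)))"
  proof -
    have "integrable torusM (\<lambda>x. 8 * snd p * (snd p / ((snd p)^2 + (cmod (cis x - cis (fst p)))^2)))" if "p \<in> II" for p
      by (rule integrable_mult_right[OF integrable_poisson(2)[OF II(1)[OF that]]])
    thus ?thesis unfolding near_def by (simp only: Bochner_Integration.integral_sum integral_mult_right_zero)
  qed
  also have "\<dots> \<le> (\<Sum>p\<in>II. 8 * snd p * (6 * pi))"
  proof (intro sum_mono mult_left_mono)
    fix p assume p: "p \<in> II"
    have "\<bar>fst p\<bar> \<le> pi" using II[OF p] by linarith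
    thus "(LINT x|torusM. snd p / ((snd p)^2 + (cmod (cis x - cis (fst p)))^2)) \<le> 6 * pi"
      using II(1)[OF p] by (intro chord_poisson_integral_bound) auto
    show "0 \<le> 8 * snd p" using II(1)[OF p] by simp
  qed
  also have "\<dots> = 48 * pi * \<Lambda>" unfolding \<Lambda>_def sum_distrib_left by (intro sum.cong) simp_all
  finally show ?thesis .
qed

text \<open>A single summand below 1 forces 8 l^2 < l^2 + d^2, hence d^2 > 7 l^2.\<close>

lemma near_far:
  assumes "near x < 1" "p \<in> II"
  shows "2 * snd p < cmod (cis x - cis (fst p))"
proof -
  let ?l = "snd p" and ?d = "cmod (cis x - cis (fst p))"
  have l: "0 < ?l" by (rule II(1)[OF assms(2)])
  have "8 * ?l * (?l / (?l^2 + ?d^2)) \<le> near x"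
    unfolding near_def using fin assms(2) II(1) by (intro member_le_sum) (auto intro!: mult_nonneg_nonneg divide_nonneg_nonneg intro: less_imp_le)
  hence "8 * ?l^2 / (?l^2 + ?d^2) < 1" using assms(1) by (simp add: power2_eq_square)
  moreover have "?l^2 + ?d^2 > 0" using l by (intro add_pos_nonneg) auto
  ultimately have "8 * ?l^2 < ?l^2 + ?d^2" by (simp add: pos_divide_less_eq)
  hence "(2 * ?l)^2 < ?d^2" by (simp add: power_mult_distrib) (smt (verit) zero_le_power2)
  thus ?thesis by (rule power2_less_imp_less) simp
qed

lemma trig_split:
  "(\<Sum>p\<in>II. \<beta> j p * (\<Sum>k\<in>{0..<int M}. tcoeff (cbump (fst p) (snd p)) k * cis (of_int k * x))) = P M j x + Q M j x + R M j x"
proof -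
  have lowII: "low j \<subseteq> II" by (auto simp: low_def)
  have c: "bcoeff j II k = bcoeff j (low j) k + bcoeff j (II - low j) k" for k
    unfolding bcoeff_def using sum.subset_diff[OF lowII fin] by (simp add: add.commute)
  have sub: "freqs M j \<subseteq> {0..<int M}" by (auto simp: freqs_def)
  have "(\<Sum>p\<in>II. \<beta> j p * (\<Sum>k\<in>{0..<int M}. tcoeff (cbump (fst p) (snd p)) k * cis (of_int k * x))) = trig (bcoeff j II) {0..<int M} x"
    unfolding trig_def bcoeff_def sum_distrib_left sum_distrib_right by (subst sum.swap) (simp add: mult.assoc)
  also have "\<dots> = P M j x + trig (bcoeff j (II - low j)) {0..<int M} x"
    unfolding P_def trig_def c by (simp add: distrib_right sum.distrib)
  also have "trig (bcoeff j (II - low j)) {0..<int M} x = Q M j x + R M j x"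
    unfolding Q_def R_def trig_def by (subst sum.subset_diff[OF sub]) (simp_all add: add.commute)
  finally show ?thesis by simp
qed

text \<open>One \<open>lam\<close> pays for smearing the kernels, as \<open>near x < 1\<close>; the
  other pays for the cut at frequency \<open>M\<close>, which has to be large compared with the
  inverse squares of all lengths.\<close>

lemma partial_sum_total_approx:
  assumes near: "near x < 1" and M: "M > 0" "(\<Sum>p\<in>II. 64 / (snd p)^2) \<le> real M"
  shows "cmod (fourier_partial_sum (n j) total x + of_real (Re (cis (real (n j + 1) * x) * (P M j x + Q M j x + R M j x)) / pi)) \<le> 2 * lam"
proof -
  let ?d = "\<lambda>p. cmod (cis x - cis (fst p))"
  let ?H = "\<lambda>p. \<beta> j p * (\<Sum>k\<in>{0..<int M}. tcoeff (cbump (fst p) (snd p)) k * cis (of_int k * x))"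
  let ?S = "\<lambda>p. fourier_partial_sum (n j) (\<lambda>t. complex_of_real (b p t)) x"
  have "fourier_partial_sum (n j) total x = (\<Sum>p\<in>II. ?S p)"
    unfolding total_def [abs_def] using b_int by (intro fourier_partial_sum_sum) auto
  moreover have "complex_of_real (Re (cis (real (n j + 1) * x) * (P M j x + Q M j x + R M j x)) / pi) = (\<Sum>p\<in>II. of_real (Re (cis (real (n j + 1) * x) * ?H p) / pi))"
    unfolding trig_split[symmetric] sum_distrib_left Re_sum sum_divide_distrib of_real_sum ..
  ultimately have "cmod (fourier_partial_sum (n j) total x + of_real (Re (cis (real (n j + 1) * x) * (P M j x + Q M j x + R M j x)) / pi))
    = cmod (\<Sum>p\<in>II. ?S p + of_real (Re (cis (real (n j + 1) * x) * ?H p) / pi))"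
    by (simp only: sum.distrib)
  also have "cmod (\<Sum>p\<in>II. ?S p + of_real (Re (cis (real (n j + 1) * x) * ?H p) / pi))
     \<le> (\<Sum>p\<in>II. lam * (8 * snd p * (snd p / ((snd p)^2 + (?d p)^2))) + lam / M * (64 / (snd p)^2))"
  proof (rule sum_norm_le)
    fix p assume p: "p \<in> II"
    have l: "0 < snd p" by (rule II(1)[OF p])
    have "cmod (?S p + of_real (Re (cis (real (n j + 1) * x) * ?H p) / pi))
       \<le> (2 * snd p / ((snd p)^2 + (?d p)^2) + 16 / snd p ^ 3 / M) * (l1_int (b p))"
      unfolding \<beta>_def using near_far[OF near p] II[OF p] M b_int[OF p] b_supp[OF p]
      by (intro partial_sum_off_interval) (auto simp: iv_def)
    also have "\<dots> \<le> (2 * snd p / ((snd p)^2 + (?d p)^2) + 16 / snd p ^ 3 / M) * (4 * lam * snd p)"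
      using b_norm[OF p] l by (intro mult_left_mono) auto
    also have "\<dots> = lam * (8 * snd p * (snd p / ((snd p)^2 + (?d p)^2))) + lam / M * (64 / (snd p)^2)"
    proof -
      have "16 / snd p ^ 3 / M * (4 * lam * snd p) = lam / M * (64 / (snd p)^2)"
        using l by (simp add: power2_eq_square power3_eq_cube mult_ac)
      moreover have "2 * snd p / D * (4 * lam * snd p) = lam * (8 * snd p * (snd p / D))" for D
        by simp
      ultimately show ?thesis unfolding distrib_right by (simp only:)
    qed
    finally show "cmod (?S p + of_real (Re (cis (real (n j + 1) * x) * ?H p) / pi)) \<le> lam * (8 * snd p * (snd p / ((snd p)^2 + (?d p)^2))) + lam / M * (64 / (snd p)^2)" .
  qed
  also have "\<dots> = lam * near x + lam / M * (\<Sum>p\<in>II. 64 / (snd p)^2)"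
    unfolding near_def sum.distrib sum_distrib_left ..
  also have "\<dots> \<le> lam * 1 + lam / M * M"
    using near M lam by (intro add_mono mult_left_mono) auto
  also have "\<dots> = 2 * lam" using M by simp
  finally show ?thesis .
qed

text \<open>\<open>V\<close> adds up all quantities that must be small; where it is below 1, each of
  them is. The squares are of order \<open>lam^2 * \<Lambda>\<close>, so after division by
  \<open>lam^2\<close> only \<Lambda> is left. The constant rounds up 48 + 20 * 256 + 9216.\<close>

lemma bad_part_maximal:
  obtains V where "integrable torusM V" "(LINT x|torusM. V x) \<le> 15000 * pi^2 * \<Lambda>" "\<And>x. 0 \<le> V x"
    "\<And>x N. V x < 1 \<Longrightarrow> 1 \<le> N \<Longrightarrow> N \<le> N0 \<Longrightarrow> cmod ((\<Sum>j=1..N. fourier_partial_sum (n j) total x) / of_nat N) \<le> 3 * lam"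
proof -
  \<comment> \<open>Adapted to the shortest intervals; the bounds for \<open>P\<close>,
    \<open>Q\<close> and \<open>R\<close> do not see its size.\<close>
  define M where "M = nat \<lceil>\<Sum>p\<in>II. 64 / (snd p)^2\<rceil> + 1"
  have M: "M > 0" "(\<Sum>p\<in>II. 64 / (snd p)^2) \<le> real M"
    using real_nat_ceiling_ge[of "\<Sum>p\<in>II. 64 / (snd p)^2"] unfolding M_def by simp_all
  have "\<exists>Z. integrable torusM Z \<and> (LINT x|torusM. Z x) \<le> 20 * (256 * pi^2 * lam^2 * \<Lambda>) \<and> (\<forall>x. Z x \<ge> 0) \<and>
    (\<forall>x N. 1 \<le> N \<longrightarrow> N \<le> N0 \<longrightarrow> (cmod ((\<Sum>j=1..N. G M j x) / of_nat N))^2 \<le> Z x)"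
  proof (rule orthogonal_averages_maximal[where G = "G M" and ?N0.0 = N0, OF G_orthogonal])
    fix Z assume a: "integrable torusM Z" "integral\<^sup>L torusM Z \<le> 20 * (256 * pi^2 * lam^2 * \<Lambda>)" "\<And>x. 0 \<le> Z x"
      "\<And>x N. \<lbrakk>1 \<le> N; N \<le> N0\<rbrakk> \<Longrightarrow> (cmod ((\<Sum>j = 1..N. G M j x) / complex_of_nat N))^2 \<le> Z x"
    show ?thesis
      by (rule exI[of _ Z]) (intro conjI allI impI a; assumption)
  qed
  then obtain Z where Z0: "integrable torusM Z \<and> (LINT x|torusM. Z x) \<le> 20 * (256 * pi^2 * lam^2 * \<Lambda>) \<and> (\<forall>x. Z x \<ge> 0) \<and>
    (\<forall>x N. 1 \<le> N \<longrightarrow> N \<le> N0 \<longrightarrow> (cmod ((\<Sum>j=1..N. G M j x) / of_nat N))^2 \<le> Z x)"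
    by (rule exE)
  note Z = Z0[THEN conjunct1] Z0[THEN conjunct2, THEN conjunct1] Z0[THEN conjunct2, THEN conjunct2, THEN conjunct1, rule_format]
    Z0[THEN conjunct2, THEN conjunct2, THEN conjunct2, rule_format]
  define SP where "SP x = (\<Sum>j=1..N0. (1 / real j) * (cmod (P M j x))^2)" for x
  define SR where "SR x = (\<Sum>j=1..N0. (1 / real j) * (cmod (R M j x))^2)" for x
  have Pi: "integrable torusM (\<lambda>x. (cmod (P M j x))^2)" for j
    unfolding P_def by (rule integrable_trig_square) simp
  have Ri: "integrable torusM (\<lambda>x. (cmod (R M j x))^2)" for j
    unfolding R_def by (rule integrable_trig_square) simp
  have SPi: "integrable torusM SP" unfolding SP_def [abs_def] by (intro Bochner_Integration.integrable_sum integrable_mult_right Pi)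
  have SRi: "integrable torusM SR" unfolding SR_def [abs_def] by (intro Bochner_Integration.integrable_sum integrable_mult_right Ri)
  have SP0: "SP x \<ge> 0" for x unfolding SP_def by (intro sum_nonneg) auto
  have SR0: "SR x \<ge> 0" for x unfolding SR_def by (intro sum_nonneg) auto
  have near0: "near x \<ge> 0" for x unfolding near_def using II(1) by (intro sum_nonneg mult_nonneg_nonneg divide_nonneg_nonneg) (auto intro: less_imp_le)
  have PR: "(LINT x|torusM. SP x) + (LINT x|torusM. SR x) \<le> 9216 * pi^2 * lam^2 * \<Lambda>"
  proof -
    have "(LINT x|torusM. SP x) = (\<Sum>j=1..N0. (1 / real j) * (l2_int (P M j)))"
      unfolding SP_def by (subst Bochner_Integration.integral_sum) (auto intro!: integrable_mult_right Pi)
    moreover have "(LINT x|torusM. SR x) = (\<Sum>j=1..N0. (1 / real j) * (l2_int (R M j)))"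
      unfolding SR_def by (subst Bochner_Integration.integral_sum) (auto intro!: integrable_mult_right Ri)
    ultimately show ?thesis using PR_square_sum[where N = N0 and M = M] by (simp only: distrib_left sum.distrib)
  qed
  define V where "V x = near x + (1 / lam^2) * (Z x + (SP x + SR x))" for x
  show ?thesis
  proof (rule that)
    show "integrable torusM V"
      unfolding V_def [abs_def] by (intro Bochner_Integration.integrable_add integrable_mult_right near_integrable Z SPi SRi)
    have "(LINT x|torusM. V x) = (LINT x|torusM. near x) + (1 / lam^2) * ((LINT x|torusM. Z x) + ((LINT x|torusM. SP x) + (LINT x|torusM. SR x)))"
      unfolding V_def
      by (simp only: Bochner_Integration.integral_add integral_mult_right_zero Bochner_Integration.integrable_add integrable_mult_right near_integrable Z(1) SPi SRi)
    also have "\<dots> \<le> 48 * pi * \<Lambda> + (1 / lam^2) * (20 * (256 * pi^2 * lam^2 * \<Lambda>) + 9216 * pi^2 * lam^2 * \<Lambda>)"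
      by (intro add_mono mult_left_mono near_integral Z(2) PR) auto
    also have "\<dots> = 48 * pi * \<Lambda> + 14336 * pi^2 * \<Lambda>" using lam by (simp add: field_simps)
    also have "48 * pi * \<Lambda> \<le> 48 * pi^2 * \<Lambda>"
      using pi_gt3 Lambda_nonneg by (intro mult_right_mono mult_left_mono) (auto simp: power2_eq_square)
    also have "48 * pi^2 * \<Lambda> + 14336 * pi^2 * \<Lambda> = 14384 * (pi^2 * \<Lambda>)" by simp
    also have "\<dots> \<le> 15000 * (pi^2 * \<Lambda>)" using Lambda_nonneg by (intro mult_right_mono) auto
    finally show "(LINT x|torusM. V x) \<le> 15000 * pi^2 * \<Lambda>" by simp
    show "0 \<le> V x" for x unfolding V_def using near0 Z(3) SP0 SR0 by simp
    fix x N assume V1: "V x < 1" and N: "1 \<le> N" "N \<le> N0"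
    have nonneg: "0 \<le> (1 / lam^2) * (Z x + (SP x + SR x))" using Z(3) SP0 SR0 by (intro mult_nonneg_nonneg add_nonneg_nonneg) auto
    have near1: "near x < 1" using V1 nonneg unfolding V_def by linarith
    have "(1 / lam^2) * (Z x + (SP x + SR x)) \<le> 1" using V1 near0[of x] unfolding V_def by linarith
    hence "Z x + (SP x + SR x) \<le> lam^2" using lam by (simp add: pos_divide_le_eq)
    hence sq: "Z x \<le> lam^2" "SP x \<le> lam^2" "SR x \<le> lam^2"
      using Z(3)[of x] SP0[of x] SR0[of x] by linarith+
    let ?w = "\<lambda>j. cis (real (n j + 1) * x)"
    define A where "A X = (\<Sum>j=1..N. X j) / complex_of_nat N" for X
    have A_add: "A (\<lambda>j. X j + Y j) = A X + A Y" for X Y by (simp add: A_def sum.distrib add_divide_distrib)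
    have "(cmod (A (\<lambda>j. ?w j * Q M j x)))^2 \<le> lam^2"
      using order.trans[OF Z(4)[OF N] sq(1)] unfolding A_def G_def .
    hence AG: "cmod (A (\<lambda>j. ?w j * Q M j x)) \<le> lam" by (rule power2_le_imp_le) (use lam in simp)
    have "(cmod (A (\<lambda>j. ?w j * P M j x)))^2 \<le> (\<Sum>j=1..N0. (1 / real j) * (cmod (?w j * P M j x))^2)"
      unfolding A_def by (rule average_square_le[OF N])
    also have "\<dots> = SP x" by (simp add: SP_def norm_mult)
    also note sq(2)
    finally have AP: "cmod (A (\<lambda>j. ?w j * P M j x)) \<le> lam" by (rule power2_le_imp_le) (use lam in simp)
    have "(cmod (A (\<lambda>j. ?w j * R M j x)))^2 \<le> (\<Sum>j=1..N0. (1 / real j) * (cmod (?w j * R M j x))^2)"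
      unfolding A_def by (rule average_square_le[OF N])
    also have "\<dots> = SR x" by (simp add: SR_def norm_mult)
    also note sq(3)
    finally have AR: "cmod (A (\<lambda>j. ?w j * R M j x)) \<le> lam" by (rule power2_le_imp_le) (use lam in simp)
    define T where "T j = ?w j * (P M j x + Q M j x + R M j x)" for j
    have "T = (\<lambda>j. (?w j * P M j x + ?w j * Q M j x) + ?w j * R M j x)" by (simp add: T_def fun_eq_iff distrib_left)
    hence "A T = A (\<lambda>j. ?w j * P M j x) + A (\<lambda>j. ?w j * Q M j x) + A (\<lambda>j. ?w j * R M j x)" by (simp only: A_add)
    hence AT: "cmod (A T) \<le> 3 * lam"
      using norm_triangle_ineq[of "A (\<lambda>j. ?w j * P M j x) + A (\<lambda>j. ?w j * Q M j x)" "A (\<lambda>j. ?w j * R M j x)"]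
        norm_triangle_ineq[of "A (\<lambda>j. ?w j * P M j x)" "A (\<lambda>j. ?w j * Q M j x)"] AG AP AR by simp
    define D where "D j = fourier_partial_sum (n j) total x + of_real (Re (T j) / pi)" for j
    have "cmod (D j) \<le> 2 * lam" for j
      unfolding D_def T_def by (rule partial_sum_total_approx[OF near1 M])
    hence "cmod (\<Sum>j=1..N. D j) \<le> (\<Sum>j=1..N. 2 * lam)" by (intro sum_norm_le) auto
    hence AD: "cmod (A D) \<le> 2 * lam" using N by (simp add: A_def norm_divide field_simps)
    have "A (\<lambda>j. of_real (Re (T j) / pi)) = of_real (Re (A T) / pi)"
      by (simp add: A_def sum_divide_distrib mult.commute)
    moreover have "A D = A (\<lambda>j. fourier_partial_sum (n j) total x) + A (\<lambda>j. of_real (Re (T j) / pi))"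
      unfolding A_add[symmetric] D_def [abs_def] ..
    ultimately have "A (\<lambda>j. fourier_partial_sum (n j) total x) = A D - of_real (Re (A T) / pi)" by simp
    hence "cmod (A (\<lambda>j. fourier_partial_sum (n j) total x)) \<le> cmod (A D) + cmod (complex_of_real (Re (A T) / pi))"
      by (metis norm_triangle_ineq4)
    \<comment> \<open>Three pieces of size \<open>lam\<close>, divided by pi > 3.\<close>
    also have "cmod (complex_of_real (Re (A T) / pi)) \<le> lam"
    proof -
      have "\<bar>Re (A T)\<bar> \<le> 3 * lam" using AT abs_Re_le_cmod order.trans by blast
      also have "\<dots> \<le> pi * lam" using pi_gt3 lam by (intro mult_right_mono) auto
      finally show ?thesis by (simp add: norm_divide pos_divide_le_eq mult.commute)
    qed
    finally show "cmod ((\<Sum>j=1..N. fourier_partial_sum (n j) total x) / of_nat N) \<le> 3 * lam"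
      using AD by (simp add: A_def)
  qed
qed

end

section \<open>Weak type estimate for continuous functions\<close>

lemma iv_subset_bounds:
  assumes "iv p \<subseteq> {a..<b}" "0 < snd p"
  shows "a \<le> fst p" "fst p + snd p \<le> b"
proof -
  have f: "fst p \<in> iv p" using assms(2) by (auto simp: iv_def)
  thus "a \<le> fst p" using assms(1) by auto
  show "fst p + snd p \<le> b"
  proof (rule ccontr)
    assume n: "\<not> fst p + snd p \<le> b"
    have "fst p < b" using f assms(1) by auto
    hence "b \<in> iv p" using n by (auto simp: iv_def)
    thus False using assms(1) by auto
  qed
qed

context sparse_sequence
begin

definition cesaro :: "nat \<Rightarrow> (real \<Rightarrow> complex) \<Rightarrow> real \<Rightarrow> complex" where
  "cesaro N f x = (\<Sum>j=1..N. fourier_partial_sum (n j) f x) / of_nat N"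

lemma cesaro_add:
  "integrable torusM f \<Longrightarrow> integrable torusM g \<Longrightarrow> cesaro N (\<lambda>t. f t + g t) x = cesaro N f x + cesaro N g x"
  by (simp add: cesaro_def fourier_partial_sum_add sum.distrib add_divide_distrib)

lemma measurable_cesaro [measurable]: "cesaro N f \<in> borel_measurable torusM"
  unfolding cesaro_def [abs_def] fourier_partial_sum_eq by measurable

text \<open>The Fejer means are bounded by 2 \<open>lam\<close> at every point, so an exceptional
  set is needed only for the averages of \<open>fejer_rest\<close>.\<close>

lemma good_part_maximal:
  assumes g [measurable]: "g \<in> borel_measurable torusM" and B: "\<And>t. t \<in> torus \<Longrightarrow> cmod (g t) \<le> 2 * lam" and lam: "0 < lam"
  obtains W where "integrable torusM W" "(LINT x|torusM. W x) \<le> 2 * (l2_int g) / lam^2" "\<And>x. 0 \<le> W x"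
    "\<And>x N. W x < 1 \<Longrightarrow> 1 \<le> N \<Longrightarrow> N \<le> N0 \<Longrightarrow> cmod (cesaro N g x) \<le> 3 * lam"
proof -
  define GS where "GS x = (\<Sum>j=1..N0. (1 / real j) * (cmod (fejer_rest (n j) g x))^2)" for x
  have Fi: "integrable torusM (\<lambda>x. (cmod (fejer_rest q g x))^2)" for q
    unfolding fejer_rest_def by (rule integrable.intros[OF parseval_trig]) simp
  have GSi: "integrable torusM GS" unfolding GS_def [abs_def] by (intro Bochner_Integration.integrable_sum integrable_mult_right Fi)
  have GS0: "0 \<le> GS x" for x unfolding GS_def by (intro sum_nonneg) auto
  have "(LINT x|torusM. GS x) = (\<Sum>j=1..N0. (1 / real j) * (l2_int (fejer_rest (n j) g)))"
    unfolding GS_def by (subst Bochner_Integration.integral_sum) (auto intro!: integrable_mult_right Fi)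
  hence GSI: "(LINT x|torusM. GS x) \<le> 2 * (l2_int g)"
    using fejer_rest_square_sum[OF g B, of N0] by simp
  show ?thesis
  proof (rule that[of "\<lambda>x. GS x / lam^2"])
    show "integrable torusM (\<lambda>x. GS x / lam^2)" using GSi by simp
    show "(LINT x|torusM. GS x / lam^2) \<le> 2 * (l2_int g) / lam^2"
      using GSI by (simp add: divide_right_mono)
    show "0 \<le> GS x / lam^2" for x using GS0 by simp
    fix x N assume 1: "GS x / lam^2 < 1" and N: "1 \<le> N" "N \<le> N0"
    have GSx: "GS x \<le> lam^2" using 1 lam by (simp add: pos_divide_less_eq)
    let ?r = "\<lambda>j. fejer_rest (n j) g x"
    have "(cmod ((\<Sum>j=1..N. ?r j) / of_nat N))^2 \<le> GS x"
      unfolding GS_def by (rule average_square_le[OF N])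
    from order.trans[OF this GSx] have r: "cmod ((\<Sum>j=1..N. ?r j) / of_nat N) \<le> lam"
      by (rule power2_le_imp_le) (use lam in simp)
    have "cmod (\<Sum>j=1..N. fourier_partial_sum (n j) g x - ?r j) \<le> (\<Sum>j=1..N. 2 * lam)"
      by (rule sum_norm_le) (rule fejer_mean_bound[OF g B])
    hence s: "cmod ((\<Sum>j=1..N. fourier_partial_sum (n j) g x - ?r j) / of_nat N) \<le> 2 * lam"
      using N by (simp add: norm_divide field_simps)
    have "cesaro N g x = (\<Sum>j=1..N. fourier_partial_sum (n j) g x - ?r j) / of_nat N + (\<Sum>j=1..N. ?r j) / of_nat N"
      by (simp add: cesaro_def sum_subtractf diff_divide_distrib)
    thus "cmod (cesaro N g x) \<le> 3 * lam"
      using norm_triangle_ineq[of "(\<Sum>j=1..N. fourier_partial_sum (n j) g x - ?r j) / of_nat N" "(\<Sum>j=1..N. ?r j) / of_nat N"] r s by simp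
  qed
qed

text \<open>On a selected interval the good part is the mean of f, at most 2 \<open>lam\<close>.
  Elsewhere it is f itself, controlled by uniform continuity in the place of Lebesgue
  differentiation. The hypothesis \<open>small\<close> starts the stopping time: the torus itself is
  not selected.\<close>

lemma calderon_zygmund_decomposition:
  fixes f :: "real \<Rightarrow> real"
  assumes cont: "continuous_on UNIV f" and lam: "0 < lam" and small: "(l1_int f) \<le> lam * (2 * pi)"
  obtains II b where "bad_part n \<delta> II b lam"
    "\<And>t. t \<in> torus \<Longrightarrow> \<bar>f t - (\<Sum>p\<in>II. b p t)\<bar> \<le> 2 * lam"
    "(LINT t|torusM. \<bar>f t - (\<Sum>p\<in>II. b p t)\<bar>) \<le> 3 * (l1_int f)"
    "(\<Sum>p\<in>II. snd p) \<le> (l1_int f) / lam"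
proof -
  have contT: "continuous_on {-pi..pi} f" using cont by (rule continuous_on_subset) auto
  have fi: "integrable torusM f" by (rule integrable_torusM_continuous[OF cont])
  have ind_meas: "indicator (iv p) \<in> borel_measurable torusM" for p
    by (rule borel_measurable_torusM) (simp add: iv_def)
  note [measurable] = ind_meas
  have indf: "integrable torusM (\<lambda>t. indicator (iv p) t * h t)" if "integrable torusM h" for h :: "real \<Rightarrow> real" and p
    using integrable_mult_bounded[OF that ind_meas[of p], where B = 1] by (simp add: mult.commute indicator_def)
  define m where "m p = (LINT t|torusM. indicator (iv p) t * \<bar>f t\<bar>)" for p
  have m_mono: "m p \<le> m q" if "iv p \<subseteq> iv q" for p q
    unfolding m_def using that fi by (intro integral_mono indf) (auto simp: indicator_def)
  \<comment> \<open>At the final mesh h < d, f varies by less than \<open>lam\<close> on each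
    interval.\<close>
  obtain d where d: "d > 0" "\<And>s t. s \<in> {-pi..pi} \<Longrightarrow> t \<in> {-pi..pi} \<Longrightarrow> \<bar>s - t\<bar> < d \<Longrightarrow> \<bar>f s - f t\<bar> < lam"
    using compact_uniformly_continuous[OF contT compact_Icc] lam
    unfolding uniformly_continuous_on_def dist_real_def by metis
  obtain K where K: "2 * pi / d < 2 ^ K" using real_arch_pow[of 2 "2 * pi / d"] by auto
  define h where "h = 2 * pi / 2 ^ K"
  have h: "0 < h" "h < d" using K d by (auto simp: h_def field_simps)
  have "m (- pi, 2 * pi) = (l1_int f)"
    unfolding m_def by (intro Bochner_Integration.integral_cong) (auto simp: iv_def)
  hence "m (- pi, 2 * pi) \<le> lam * (2 * pi)" using small by simp
  from calderon_zygmund_selection[of m "2 * pi", OF m_mono _ this, of K]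
  obtain II where fin: "finite II" and sel: "\<forall>p\<in>II. 0 < snd p \<and> iv p \<subseteq> {- pi..<- pi + 2 * pi} \<and> lam * snd p < m p \<and> m p \<le> 2 * lam * snd p"
    and disj: "pairwise (\<lambda>p q. iv p \<inter> iv q = {}) II"
    and rest: "\<forall>x\<in>{- pi..<- pi + 2 * pi} - (\<Union>p\<in>II. iv p). \<exists>c. x \<in> iv (c, h) \<and> iv (c, h) \<subseteq> {- pi..<- pi + 2 * pi} \<and> m (c, h) \<le> lam * h"
    unfolding h_def by auto
  have II: "0 < snd p" "iv p \<subseteq> torus" "lam * snd p < m p" "m p \<le> 2 * lam * snd p" if "p \<in> II" for p
    using sel that by auto
  have ind: "has_bochner_integral torusM (indicator (iv p) :: real \<Rightarrow> real) (snd p)" if "p \<in> II" for p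
    using II[OF that] by (intro indicator_iv_integral) auto
  define av where "av p = (LINT t|torusM. indicator (iv p) t * f t) / snd p" for p
  have av: "\<bar>av p\<bar> * snd p \<le> m p" if "p \<in> II" for p
  proof -
    have "\<bar>LINT t|torusM. indicator (iv p) t * f t\<bar> \<le> (LINT t|torusM. \<bar>indicator (iv p) t * f t\<bar>)"
      by (rule integral_abs_bound)
    thus ?thesis using II(1)[OF that] by (simp add: av_def m_def abs_mult)
  qed
  define b where "b p t = indicator (iv p) t * f t - av p * indicator (iv p) t" for p t
  have b_int: "integrable torusM (b p)" if "p \<in> II" for p
    unfolding b_def [abs_def] by (intro Bochner_Integration.integrable_diff indf fi integrable_mult_right integrable.intros[OF ind[OF that]])
  have b_norm: "(l1_int (b p)) \<le> 2 * m p" if p: "p \<in> II" for p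
  proof -
    have "(l1_int (b p)) \<le> (LINT t|torusM. indicator (iv p) t * \<bar>f t\<bar> + \<bar>av p\<bar> * indicator (iv p) t)"
    proof (rule integral_mono)
      show "integrable torusM (\<lambda>t. \<bar>b p t\<bar>)" using b_int[OF p] by simp
      show "integrable torusM (\<lambda>t. indicator (iv p) t * \<bar>f t\<bar> + \<bar>av p\<bar> * indicator (iv p) t)"
        using fi by (intro Bochner_Integration.integrable_add indf integrable_mult_right integrable.intros[OF ind[OF p]]) auto
      show "\<bar>b p t\<bar> \<le> indicator (iv p) t * \<bar>f t\<bar> + \<bar>av p\<bar> * indicator (iv p) t" for t
        unfolding b_def by (cases "t \<in> iv p") auto
    qed
    also have "\<dots> = m p + \<bar>av p\<bar> * snd p"
    proof -
      have 1: "integrable torusM (\<lambda>t. indicator (iv p) t * \<bar>f t\<bar>)" using fi by (intro indf) auto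
      have 2: "has_bochner_integral torusM (\<lambda>t. \<bar>av p\<bar> * indicator (iv p) t) (\<bar>av p\<bar> * snd p)"
        by (rule has_bochner_integral_mult_right[OF ind[OF p]])
      show ?thesis unfolding m_def
        using has_bochner_integral_integral_eq[OF has_bochner_integral_add[OF has_bochner_integral_integrable[OF 1] 2]] .
    qed
    also have "\<dots> \<le> 2 * m p" using av[OF p] by simp
    finally show ?thesis .
  qed
  have bp: "bad_part n \<delta> II b lam"
  proof (unfold_locales)
    fix p t assume p: "p \<in> II"
    show "- pi \<le> fst p" "fst p + snd p \<le> pi" using iv_subset_bounds[OF II(2)[OF p] II(1)[OF p]] by auto
    show "0 < snd p" by (rule II(1)[OF p])
    show "integrable torusM (b p)" by (rule b_int[OF p])
    show "t \<notin> iv p \<Longrightarrow> b p t = 0" by (simp add: b_def)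
    show "(l1_int (b p)) \<le> 4 * lam * snd p" using b_norm[OF p] II(4)[OF p] by simp
    have "has_bochner_integral torusM (b p) ((LINT t|torusM. indicator (iv p) t * f t) - av p * snd p)"
      unfolding b_def [abs_def]
      by (intro has_bochner_integral_diff has_bochner_integral_integrable indf fi has_bochner_integral_mult_right ind[OF p])
    thus "(LINT t|torusM. b p t) = 0" using II(1)[OF p] by (simp add: has_bochner_integral_iff av_def)
  qed (use fin disj lam in auto)
  have sum_ind: "(\<Sum>p\<in>II. indicator (iv p) t :: real) \<le> 1" for t
  proof (cases "\<exists>p\<in>II. t \<in> iv p")
    case True
    then obtain p where p: "p \<in> II" "t \<in> iv p" by blast
    have "t \<notin> iv q" if "q \<in> II" "q \<noteq> p" for q using disj p that by (auto simp: pairwise_def)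
    hence "(\<Sum>q\<in>II - {p}. indicator (iv q) t :: real) = 0" by (intro sum.neutral) auto
    thus ?thesis using p fin by (subst sum.remove[of _ p]) auto
  next
    case False
    thus ?thesis by (subst sum.neutral) auto
  qed
  have sum_m: "(\<Sum>p\<in>II. m p) \<le> (l1_int f)"
  proof -
    have i: "integrable torusM (\<lambda>t. indicator (iv p) t * \<bar>f t\<bar>)" for p using fi by (intro indf) auto
    have "(\<Sum>p\<in>II. m p) = (LINT t|torusM. (\<Sum>p\<in>II. indicator (iv p) t * \<bar>f t\<bar>))"
      unfolding m_def by (rule Bochner_Integration.integral_sum[symmetric]) (rule i)
    also have "\<dots> \<le> (l1_int f)"
    proof (rule integral_mono)
      show "integrable torusM (\<lambda>t. \<Sum>p\<in>II. indicator (iv p) t * \<bar>f t\<bar>)" by (intro Bochner_Integration.integrable_sum i)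
      show "(\<Sum>p\<in>II. indicator (iv p) t * \<bar>f t\<bar>) \<le> \<bar>f t\<bar>" for t
        using mult_right_mono[OF sum_ind[of t], of "\<bar>f t\<bar>"] by (simp add: sum_distrib_right)
    qed (use fi in simp)
    finally show ?thesis .
  qed
  define g where "g t = f t - (\<Sum>p\<in>II. b p t)" for t
  have gi: "integrable torusM g" unfolding g_def [abs_def] using fi b_int by auto
  show ?thesis
  proof (rule that[OF bp])
    fix t assume t: "t \<in> torus"
    show "\<bar>f t - (\<Sum>p\<in>II. b p t)\<bar> \<le> 2 * lam"
    proof (cases "\<exists>p\<in>II. t \<in> iv p")
      case True
      then obtain p where p: "p \<in> II" "t \<in> iv p" by blast
      have "t \<notin> iv q" if "q \<in> II" "q \<noteq> p" for q using disj p that by (auto simp: pairwise_def)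
      hence "(\<Sum>q\<in>II - {p}. b q t) = 0" by (intro sum.neutral) (auto simp: b_def)
      hence "(\<Sum>q\<in>II. b q t) = f t - av p" using p fin by (subst sum.remove[of _ p]) (auto simp: b_def)
      moreover have "\<bar>av p\<bar> * snd p \<le> (2 * lam) * snd p" using av[OF p(1)] II(4)[OF p(1)] by simp
      hence "\<bar>av p\<bar> \<le> 2 * lam" using II(1)[OF p(1)] by (rule mult_right_le_imp_le)
      ultimately show ?thesis by simp
    next
      case False
      hence "(\<Sum>q\<in>II. b q t) = 0" by (intro sum.neutral) (auto simp: b_def)
      moreover have "\<bar>f t\<bar> \<le> 2 * lam"
      proof -
        have "t \<in> {- pi..<- pi + 2 * pi} - (\<Union>p\<in>II. iv p)" using False t by auto
        from bspec[OF rest this] obtain c where c: "t \<in> iv (c, h)" "iv (c, h) \<subseteq> torus" "m (c, h) \<le> lam * h" by auto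
        have indc: "has_bochner_integral torusM (indicator (iv (c, h)) :: real \<Rightarrow> real) h"
          using indicator_iv_integral[of "(c, h)"] c h by auto
        \<comment> \<open>On the last interval |f| stays above |f t| - lam, while its mean is at
          most \<open>lam\<close>.\<close>
        have "(\<bar>f t\<bar> - lam) * h \<le> m (c, h)"
        proof -
          have "(LINT s|torusM. (\<bar>f t\<bar> - lam) * indicator (iv (c, h)) s) \<le> m (c, h)"
            unfolding m_def
          proof (rule integral_mono)
            show "integrable torusM (\<lambda>s. (\<bar>f t\<bar> - lam) * indicator (iv (c, h)) s)"
              by (rule integrable_mult_right[OF integrable.intros[OF indc]])
            show "integrable torusM (\<lambda>s. indicator (iv (c, h)) s * \<bar>f s\<bar>)" using fi by (intro indf) auto
            fix s
            show "(\<bar>f t\<bar> - lam) * indicator (iv (c, h)) s \<le> indicator (iv (c, h)) s * \<bar>f s\<bar>"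
            proof (cases "s \<in> iv (c, h)")
              case True
              hence "s \<in> torus" using c(2) by blast
              moreover have "\<bar>s - t\<bar> < d" using True c(1) h by (auto simp: iv_def)
              ultimately have "\<bar>f s - f t\<bar> < lam" using t by (intro d(2)) auto
              thus ?thesis using True by simp
            qed simp
          qed
          thus ?thesis using has_bochner_integral_integral_eq[OF indc] by simp
        qed
        hence "(\<bar>f t\<bar> - lam) * h \<le> lam * h" using c(3) by simp
        hence "\<bar>f t\<bar> - lam \<le> lam" using h(1) by (rule mult_right_le_imp_le)
        thus ?thesis by simp
      qed
      ultimately show ?thesis by simp
    qed
  next
    have "(l1_int g) \<le> (LINT t|torusM. \<bar>f t\<bar> + (\<Sum>p\<in>II. \<bar>b p t\<bar>))"
    proof (rule integral_mono)
      show "integrable torusM (\<lambda>t. \<bar>g t\<bar>)" using gi by simp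
      show "integrable torusM (\<lambda>t. \<bar>f t\<bar> + (\<Sum>p\<in>II. \<bar>b p t\<bar>))" using fi b_int by auto
      show "\<bar>g t\<bar> \<le> \<bar>f t\<bar> + (\<Sum>p\<in>II. \<bar>b p t\<bar>)" for t
        unfolding g_def using sum_abs[of "\<lambda>p. b p t" II] by linarith
    qed
    also have "\<dots> = (l1_int f) + (\<Sum>p\<in>II. (l1_int (b p)))"
      using fi b_int by (subst Bochner_Integration.integral_add) (auto intro!: Bochner_Integration.integral_sum)
    also have "\<dots> \<le> (l1_int f) + (\<Sum>p\<in>II. 2 * m p)" by (intro add_left_mono sum_mono b_norm)
    also have "\<dots> \<le> 3 * (l1_int f)" using sum_m by (simp add: sum_distrib_left[symmetric])
    finally show "(LINT t|torusM. \<bar>f t - (\<Sum>p\<in>II. b p t)\<bar>) \<le> 3 * (l1_int f)" by (simp add: g_def)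
    have "lam * (\<Sum>p\<in>II. snd p) \<le> (\<Sum>p\<in>II. m p)"
      unfolding sum_distrib_left by (intro sum_mono less_imp_le II)
    hence "lam * (\<Sum>p\<in>II. snd p) \<le> (l1_int f)" using sum_m by simp
    thus "(\<Sum>p\<in>II. snd p) \<le> (l1_int f) / lam" using lam by (simp add: field_simps)
  qed
qed

text \<open>Where V + W < 1, both parts have averages at most 3 \<open>lam\<close>, hence 6; the
  exceptional set is measured by Markov's inequality at height 1.\<close>

lemma weak_type_continuous:
  fixes f :: "real \<Rightarrow> real"
  assumes cont: "continuous_on UNIV f" and lam: "0 < lam"
  shows "measure torusM {x \<in> torus. \<exists>N\<in>{1..N0}. 6 * lam < cmod (cesaro N (\<lambda>t. of_real (f t)) x)}
    \<le> 16000 * pi^2 / lam * (l1_int f)" (is "measure torusM ?E \<le> _ * ?I")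
proof -
  interpret T: finite_measure torusM by (rule finite_measure_torusM)
  have I0: "0 \<le> ?I" by simp
  have "1 \<le> pi^2" using pi_gt3 by (intro one_le_power) simp
  hence pi2: "1 \<le> 16000 * pi^2" by simp
  show ?thesis
  proof (cases "?I \<le> lam * (2 * pi)")
    \<comment> \<open>Here the right-hand side exceeds 2 pi, the measure of the whole torus.\<close>
    case False
    have "measure torusM ?E \<le> measure torusM (space torusM)" by (rule T.bounded_measure)
    also have "\<dots> = 2 * pi" by (rule measure_torusM)
    also have "\<dots> \<le> 1 / lam * ?I" using False lam by (simp add: field_simps)
    also have "\<dots> \<le> 16000 * pi^2 / lam * ?I"
      using lam pi2 I0 by (intro mult_right_mono divide_right_mono) auto
    finally show ?thesis .
  next
    case True
    show ?thesis
    proof (rule calderon_zygmund_decomposition[OF cont lam True])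
      fix II b assume
        bp: "bad_part n \<delta> II b lam" and g2: "\<And>t. t \<in> torus \<Longrightarrow> \<bar>f t - (\<Sum>p\<in>II. b p t)\<bar> \<le> 2 * lam"
        and gI: "(LINT t|torusM. \<bar>f t - (\<Sum>p\<in>II. b p t)\<bar>) \<le> 3 * ?I"
        and \<Lambda>: "(\<Sum>p\<in>II. snd p) \<le> ?I / lam"
      interpret bad_part n \<delta> II b lam by (rule bp)
      have f_meas: "f \<in> borel_measurable torusM" by (rule continuous_measurable_torusM[OF cont])
      define g where "g t = f t - (\<Sum>p\<in>II. b p t)" for t
      define gc where "gc t = complex_of_real (g t)" for t
      have g_meas [measurable]: "g \<in> borel_measurable torusM"
        unfolding g_def [abs_def] using f_meas b_int by (auto intro!: borel_measurable_sum borel_measurable_diff)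
      have gc_meas: "gc \<in> borel_measurable torusM" unfolding gc_def [abs_def] by measurable
      have gc2: "cmod (gc t) \<le> 2 * lam" if "t \<in> torus" for t using g2[OF that] unfolding gc_def g_def norm_of_real .
      have gi: "integrable torusM g" by (rule integrable_torusM_bounded[OF g_meas, of "2 * lam"]) (use g2 in \<open>auto simp: g_def\<close>)
      show ?thesis
      proof (rule bad_part_maximal[of N0], rule good_part_maximal[OF gc_meas gc2 lam, of N0], assumption)
        fix V W assume V: "integrable torusM V" "(LINT x|torusM. V x) \<le> 15000 * pi^2 * \<Lambda>" "\<And>x. 0 \<le> V x"
          "\<And>x N. V x < 1 \<Longrightarrow> 1 \<le> N \<Longrightarrow> N \<le> N0 \<Longrightarrow> cmod ((\<Sum>j=1..N. fourier_partial_sum (n j) total x) / of_nat N) \<le> 3 * lam"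
        and W: "integrable torusM W" "(LINT x|torusM. W x) \<le> 2 * (l2_int gc) / lam^2" "\<And>x. 0 \<le> W x"
          "\<And>x N. W x < 1 \<Longrightarrow> 1 \<le> N \<Longrightarrow> N \<le> N0 \<Longrightarrow> cmod (cesaro N gc x) \<le> 3 * lam"
        have gc_sq: "norm ((cmod (gc t))^2) \<le> (2 * lam)^2" if "t \<in> torus" for t
          using power_mono[OF gc2[OF that] norm_ge_zero, of 2] by simp
        \<comment> \<open>The sup bound 2 \<open>lam\<close> turns the L^2 norm of the good part
          into its L^1 norm.\<close>
        have "(l2_int gc) \<le> (LINT x|torusM. 2 * lam * \<bar>g x\<bar>)"
        proof (rule integral_mono)
          show "integrable torusM (\<lambda>x. (cmod (gc x))^2)"
            by (rule integrable_torusM_bounded[OF _ gc_sq]) (use gc_meas in measurable)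
          show "integrable torusM (\<lambda>x. 2 * lam * \<bar>g x\<bar>)" using gi by simp
          fix x assume "x \<in> space torusM"
          hence "\<bar>g x\<bar> \<le> 2 * lam" using g2 by (auto simp: g_def)
          from mult_right_mono[OF this, of "\<bar>g x\<bar>"] show "(cmod (gc x))^2 \<le> 2 * lam * \<bar>g x\<bar>"
            unfolding gc_def norm_of_real power2_eq_square by simp
        qed
        also have "\<dots> = 2 * lam * (l1_int g)" by (rule integral_mult_right_zero)
        also have "\<dots> \<le> 2 * lam * (3 * ?I)" using gI lam by (intro mult_left_mono) (auto simp: g_def)
        finally have "2 * (l2_int gc) / lam^2 \<le> 2 * (2 * lam * (3 * ?I)) / lam^2"
          by (intro divide_right_mono) auto
        also have "\<dots> = 12 * ?I / lam" using lam by (simp add: power2_eq_square)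
        finally have WI: "(LINT x|torusM. W x) \<le> 12 * ?I / lam" using W(2) by simp
        have VI: "(LINT x|torusM. V x) \<le> 15000 * pi^2 * (?I / lam)"
        proof -
          have "15000 * pi^2 * \<Lambda> \<le> 15000 * pi^2 * (?I / lam)"
            unfolding \<Lambda>_def by (rule mult_left_mono[OF \<Lambda>]) simp
          thus ?thesis using V(2) by simp
        qed
        define U where "U x = V x + W x" for x
        have Ui: "integrable torusM U" unfolding U_def [abs_def] using V W by simp
        have sub: "?E \<subseteq> {x \<in> space torusM. 1 \<le> U x}"
        proof (intro subsetI CollectI conjI)
          fix x assume x: "x \<in> ?E"
          then obtain N where N: "1 \<le> N" "N \<le> N0" "6 * lam < cmod (cesaro N (\<lambda>t. of_real (f t)) x)" by auto
          show "x \<in> space torusM" using x by simp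
          show "1 \<le> U x"
          proof (rule ccontr)
            assume "\<not> 1 \<le> U x"
            hence *: "V x < 1" "W x < 1" using V(3)[of x] W(3)[of x] by (auto simp: U_def)
            have "(\<lambda>t. complex_of_real (f t)) = (\<lambda>t. gc t + total t)" by (auto simp: gc_def g_def total_def)
            moreover have "integrable torusM gc" unfolding gc_def [abs_def] using gi by simp
            moreover have "integrable torusM total" unfolding total_def [abs_def] using b_int by auto
            ultimately have "cesaro N (\<lambda>t. of_real (f t)) x = cesaro N gc x + cesaro N total x" by (simp add: cesaro_add)
            hence "cmod (cesaro N (\<lambda>t. of_real (f t)) x) \<le> 3 * lam + 3 * lam"
              using norm_triangle_ineq[of "cesaro N gc x" "cesaro N total x"] V(4)[OF *(1) N(1,2)] W(4)[OF *(2) N(1,2)]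
              by (simp add: cesaro_def)
            thus False using N(3) by simp
          qed
        qed
        have "measure torusM ?E \<le> measure torusM {x \<in> space torusM. 1 \<le> U x}"
          by (rule T.finite_measure_mono[OF sub]) (use Ui in measurable)
        also have "\<dots> \<le> (LINT x|torusM. U x) / 1"
          by (rule integral_Markov_inequality_measure[OF Ui, of "{}"]) (use V(3) W(3) in \<open>auto simp: U_def\<close>)
        also have "\<dots> = (LINT x|torusM. V x) + (LINT x|torusM. W x)" unfolding U_def using V(1) W(1) by simp
        also have "\<dots> \<le> 15000 * pi^2 * (?I / lam) + 12 * ?I / lam" using VI WI by simp
        also have "\<dots> = (15000 * pi^2 + 12) * (?I / lam)" by (simp add: algebra_simps)
        also have "\<dots> \<le> 16000 * pi^2 * (?I / lam)"
        proof (rule mult_right_mono)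
          have "9 \<le> pi^2" using power_mono[of 3 pi 2] pi_gt3 by simp
          thus "15000 * pi^2 + 12 \<le> 16000 * pi^2" by simp
        qed (use lam in simp)
        finally show ?thesis by simp
      qed
    qed
  qed
qed

end

section \<open>A dense class of functions\<close>

text \<open>Truncating f at height k costs little by dominated convergence. Continuous functions
  converging to f almost everywhere, clamped at the same height, then converge boundedly to the
  truncation.\<close>

lemma continuous_dense_torus:
  fixes f :: "real \<Rightarrow> real"
  assumes f: "integrable torusM f" and e: "0 < e"
  obtains h where "continuous_on UNIV h" "(LINT t|torusM. \<bar>f t - h t\<bar>) < e"
proof -
  define clamp where "clamp k y = max (- k) (min k y)" for k y :: real
  have f_meas [measurable]: "f \<in> borel_measurable torusM" using f by simp
  have clamp_meas: "(\<lambda>t. clamp k (h t)) \<in> borel_measurable torusM" if "h \<in> borel_measurable torusM" for k h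
    unfolding clamp_def using that by measurable
  have clamp_bound: "\<bar>clamp k y\<bar> \<le> k" if "0 \<le> k" for k y using that by (auto simp: clamp_def)
  have "(\<lambda>k. (LINT t|torusM. \<bar>f t - clamp (real k) (f t)\<bar>)) \<longlonglongrightarrow> (LINT t|torusM. 0)"
  proof (rule integral_dominated_convergence[where w = "\<lambda>t. \<bar>f t\<bar>"])
    show "AE t in torusM. (\<lambda>k. \<bar>f t - clamp (real k) (f t)\<bar>) \<longlonglongrightarrow> 0"
    proof (rule AE_I2)
      fix t
      obtain k0 :: nat where k0: "\<bar>f t\<bar> \<le> real k0" using real_arch_simple by blast
      have "\<forall>\<^sub>F k in sequentially. \<bar>f t - clamp (real k) (f t)\<bar> = 0"
        using eventually_ge_at_top[of k0]
      proof eventually_elim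
        case (elim k)
        hence "\<bar>f t\<bar> \<le> real k" using k0 by linarith
        thus ?case by (auto simp: clamp_def)
      qed
      thus "(\<lambda>k. \<bar>f t - clamp (real k) (f t)\<bar>) \<longlonglongrightarrow> 0" by (rule tendsto_eventually)
    qed
    show "AE t in torusM. norm \<bar>f t - clamp (real k) (f t)\<bar> \<le> \<bar>f t\<bar>" for k
      by (rule AE_I2) (auto simp: clamp_def)
    show "integrable torusM (\<lambda>t. \<bar>f t\<bar>)" using f by simp
  qed (use clamp_meas[OF f_meas] in auto)
  hence "\<forall>\<^sub>F k in sequentially. (LINT t|torusM. \<bar>f t - clamp (real k) (f t)\<bar>) < e / 2"
    using e by (intro order_tendstoD(2)) auto
  then obtain k :: nat where k: "(LINT t|torusM. \<bar>f t - clamp (real k) (f t)\<bar>) < e / 2"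
    using eventually_happens'[OF sequentially_bot] by blast
  have "f measurable_on torus" using f_meas by (subst measurable_on_iff_borel_measurable) auto
  then obtain N G where N: "negligible N" and G: "\<And>i. continuous_on UNIV (G i)"
    and lim: "\<And>t. t \<notin> N \<Longrightarrow> (\<lambda>i. G i t) \<longlonglongrightarrow> (if t \<in> torus then f t else 0)"
    unfolding measurable_on_def by metis
  define h where "h i t = clamp (real k) (G i t)" for i t
  have h_cont: "continuous_on UNIV (h i)" for i unfolding h_def clamp_def by (intro continuous_intros G)
  have h_meas: "h i \<in> borel_measurable torusM" for i by (rule continuous_measurable_torusM[OF h_cont])
  have "(\<lambda>i. (LINT t|torusM. \<bar>clamp (real k) (f t) - h i t\<bar>)) \<longlonglongrightarrow> (LINT t|torusM. 0)"
  proof (rule integral_dominated_convergence[where w = "\<lambda>t. 2 * real k"])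
    have "AE t in lebesgue. t \<notin> N" using N by (intro AE_not_in) (simp add: negligible_iff_null_sets)
    hence ae: "AE t in torusM. t \<notin> N" by (subst AE_restrict_space_iff) auto
    show "AE t in torusM. (\<lambda>i. \<bar>clamp (real k) (f t) - h i t\<bar>) \<longlonglongrightarrow> 0"
      using ae AE_space
    proof eventually_elim
      case (elim t)
      hence "(\<lambda>i. G i t) \<longlonglongrightarrow> f t" using lim[of t] by simp
      hence "(\<lambda>i. \<bar>clamp (real k) (f t) - h i t\<bar>) \<longlonglongrightarrow> \<bar>clamp (real k) (f t) - clamp (real k) (f t)\<bar>"
        unfolding h_def clamp_def by (intro tendsto_intros)
      thus ?case by simp
    qed
    show "AE t in torusM. norm \<bar>clamp (real k) (f t) - h i t\<bar> \<le> 2 * real k" for i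
    proof (rule AE_I2)
      fix t
      show "norm \<bar>clamp (real k) (f t) - h i t\<bar> \<le> 2 * real k"
        using clamp_bound[of "real k" "f t"] clamp_bound[of "real k" "G i t"] unfolding h_def by simp
    qed
    show "integrable torusM (\<lambda>t. 2 * real k)" by (rule finite_measure.integrable_const[OF finite_measure_torusM])
  qed (use clamp_meas[OF f_meas] h_meas in auto)
  hence "\<forall>\<^sub>F i in sequentially. (LINT t|torusM. \<bar>clamp (real k) (f t) - h i t\<bar>) < e / 2"
    using e by (intro order_tendstoD(2)) auto
  then obtain i where i: "(LINT t|torusM. \<bar>clamp (real k) (f t) - h i t\<bar>) < e / 2"
    using eventually_happens'[OF sequentially_bot] by blast
  have ci: "integrable torusM (\<lambda>t. clamp (real k) (f t))"
    by (rule integrable_torusM_bounded[OF clamp_meas[OF f_meas], of _ "real k"]) (use clamp_bound in auto)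
  have hi: "integrable torusM (h i)"
    by (rule integrable_torusM_bounded[OF h_meas, of _ "real k"]) (use clamp_bound in \<open>auto simp: h_def\<close>)
  have "(LINT t|torusM. \<bar>f t - h i t\<bar>) \<le> (LINT t|torusM. \<bar>f t - clamp (real k) (f t)\<bar> + \<bar>clamp (real k) (f t) - h i t\<bar>)"
    using f ci hi by (intro integral_mono) auto
  also have "\<dots> = (LINT t|torusM. \<bar>f t - clamp (real k) (f t)\<bar>) + (LINT t|torusM. \<bar>clamp (real k) (f t) - h i t\<bar>)"
    using f ci hi by (intro Bochner_Integration.integral_add) auto
  also have "\<dots> < e" using k i by simp
  finally show ?thesis using that[OF h_cont] by blast
qed

text \<open>These are polynomials in t, which usually jump at the end point of the circle; this is
  why convergence is claimed only in the interior.\<close>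

lemma polynomial_dense_torus:
  fixes f :: "real \<Rightarrow> real"
  assumes f: "integrable torusM f" and e: "0 < e"
  obtains p where "real_polynomial_function p" "(LINT t|torusM. \<bar>f t - p t\<bar>) < e"
proof -
  obtain h where h: "continuous_on UNIV h" "(LINT t|torusM. \<bar>f t - h t\<bar>) < e / 2"
    using continuous_dense_torus[OF f, of "e / 2"] e by auto
  have hT: "continuous_on {-pi..pi} h" using h(1) by (rule continuous_on_subset) auto
  obtain p where p: "real_polynomial_function p" "\<And>x. x \<in> {-pi..pi} \<Longrightarrow> \<bar>h x - p x\<bar> < e / (4 * pi)"
    by (rule Stone_Weierstrass_real_polynomial_function[OF compact_Icc hT, of "e / (4 * pi)"]) (use e in auto)
  have p_cont: "continuous_on UNIV p"
    using p(1) by (intro continuous_on_polymonial_function) (simp add: real_polynomial_function_eq)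
  have hp: "(\<lambda>t. h t - p t) \<in> borel_measurable torusM"
    by (intro continuous_measurable_torusM continuous_intros h p_cont)
  have b: "norm (h t - p t) \<le> e / (4 * pi)" if "t \<in> torus" for t using p(2)[of t] that by auto
  have hpi: "integrable torusM (\<lambda>t. h t - p t)" by (rule integrable_torusM_bounded[OF hp b])
  have hi: "integrable torusM h" by (rule integrable_torusM_continuous[OF h(1)])
  have "(LINT t|torusM. \<bar>f t - p t\<bar>) \<le> (LINT t|torusM. \<bar>f t - h t\<bar> + \<bar>h t - p t\<bar>)"
  proof (rule integral_mono)
    have "integrable torusM (\<lambda>t. h t - (h t - p t))" by (rule Bochner_Integration.integrable_diff[OF hi hpi])
    hence "integrable torusM p" by simp
    thus "integrable torusM (\<lambda>t. \<bar>f t - p t\<bar>)" using f by simp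
    show "integrable torusM (\<lambda>t. \<bar>f t - h t\<bar> + \<bar>h t - p t\<bar>)" using f hi hpi by auto
  qed auto
  also have "\<dots> = (LINT t|torusM. \<bar>f t - h t\<bar>) + (LINT t|torusM. \<bar>h t - p t\<bar>)"
    using f hi hpi by (intro Bochner_Integration.integral_add) auto
  also have "(LINT t|torusM. \<bar>h t - p t\<bar>) \<le> 2 * pi * (e / (4 * pi))"
    using integral_torusM_bound[of "\<lambda>t. \<bar>h t - p t\<bar>" "e / (4 * pi)"] hpi b by simp
  also have "2 * pi * (e / (4 * pi)) = e / 2" by simp
  finally show ?thesis using that[OF p(1)] h(2) by simp
qed

section \<open>Pointwise convergence for polynomials\<close>

lemma real_polynomial_function_lipschitz:
  assumes p: "real_polynomial_function p"
  obtains L where "0 \<le> L" "\<And>s t. s \<in> {-pi..pi} \<Longrightarrow> t \<in> {-pi..pi} \<Longrightarrow> \<bar>p s - p t\<bar> \<le> L * \<bar>s - t\<bar>"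
proof -
  obtain p' where p': "real_polynomial_function p'" "\<And>x. (p has_real_derivative p' x) (at x)"
    using has_real_derivative_polynomial_function[OF p] by blast
  have "continuous_on {-pi..pi} p'"
    using p'(1) by (intro continuous_on_polymonial_function) (simp add: real_polynomial_function_eq)
  from compact_imp_bounded[OF compact_continuous_image[OF this compact_Icc]]
  obtain L where L: "\<forall>t\<in>{-pi..pi}. \<bar>p' t\<bar> \<le> L" unfolding bounded_iff real_norm_def by blast
  show ?thesis
  proof (rule that[of L])
    show "0 \<le> L" using L[THEN bspec, of 0] pi_gt_zero by simp
    fix s t assume "s \<in> {-pi..pi}" "t \<in> {-pi..pi}"
    moreover have "(p has_field_derivative p' z) (at z within {-pi..pi})" for z
      by (rule has_field_derivative_at_within[OF p'(2)])
    ultimately show "\<bar>p s - p t\<bar> \<le> L * \<bar>s - t\<bar>"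
      using field_differentiable_bound[of "{-pi..pi}" p p' L s t] L by simp
  qed
qed

text \<open>Dini's argument: the quotient \<open>u\<close> is bounded, and the error of the partial
  sum is, up to modulation and the factor 1 / pi, the real part of its coefficient at q + 1.\<close>

lemma partial_sums_converge_lipschitz:
  fixes p :: "real \<Rightarrow> real"
  assumes p_meas [measurable]: "p \<in> borel_measurable torusM"
    and L: "0 \<le> L" "\<And>s t. s \<in> {-pi..pi} \<Longrightarrow> t \<in> {-pi..pi} \<Longrightarrow> \<bar>p s - p t\<bar> \<le> L * \<bar>s - t\<bar>"
    and x: "- pi < x" "x < pi"
  shows "(\<lambda>q. fourier_partial_sum q (\<lambda>t. of_real (p t)) x) \<longlonglongrightarrow> of_real (p x)"
proof -
  define u where "u t = of_real (p t - p x) * ckern (x - t)" for t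
  have u_meas: "u \<in> borel_measurable torusM"
  proof -
    have "(\<lambda>t. ckern (x - t)) \<in> borel_measurable torusM" by (rule borel_measurable_torusM) measurable
    thus ?thesis unfolding u_def by measurable
  qed
  \<comment> \<open>The first term serves the t within pi of x, where the chord is at least half of
    |x - t|; the second serves the others, which approach x across the end point.\<close>
  define B where "B = 2 * L + 4 * L * pi / (pi - \<bar>x\<bar>)"
  have xpi: "\<bar>x\<bar> < pi" using x by auto
  have u_bound: "cmod (u t) \<le> B" if t: "t \<in> torus" for t
  proof -
    have pt: "\<bar>p t - p x\<bar> \<le> L * \<bar>t - x\<bar>" using x t by (intro L(2)) auto
    have u: "cmod (u t) = \<bar>p t - p x\<bar> / cmod (cis x - cis t)" by (simp add: u_def norm_mult ckern_chord del: of_real_diff)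
    have B2: "0 \<le> 4 * L * pi / (pi - \<bar>x\<bar>)" using L(1) xpi by simp
    show ?thesis
    proof (cases "\<bar>x - t\<bar> \<le> pi")
      case True
      have "cmod (u t) \<le> 2 * L"
      proof (cases "x = t")
        case False
        have d: "\<bar>x - t\<bar> / 2 \<le> cmod (cis x - cis t)" by (rule chord_ge[OF True])
        have "cmod (u t) \<le> (L * \<bar>t - x\<bar>) / (\<bar>x - t\<bar> / 2)"
          unfolding u using pt d False by (intro frac_le) auto
        also have "\<dots> = 2 * L" using False by (simp add: abs_minus_commute)
        finally show ?thesis .
      qed (use L in \<open>simp add: u_def\<close>)
      thus ?thesis using B2 by (simp add: B_def)
    next
      case False
      \<comment> \<open>After a shift by 2 pi, t lies outside the open torus, at distance at least
        pi - |x| from x.\<close>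
      have d: "(pi - \<bar>x\<bar>) / 2 \<le> cmod (cis x - cis t)"
      proof (cases "x \<ge> t")
        case True
        hence "\<bar>x - (t + 2 * pi)\<bar> \<le> pi" "\<bar>x - (t + 2 * pi)\<bar> \<ge> pi - \<bar>x\<bar>" using False t x by auto
        thus ?thesis using chord_ge[of x "t + 2 * pi"] by (simp add: cis_shift_2pi)
      next
        case F: False
        hence "\<bar>x - (t - 2 * pi)\<bar> \<le> pi" "\<bar>x - (t - 2 * pi)\<bar> \<ge> pi - \<bar>x\<bar>" using False t x by auto
        thus ?thesis using chord_ge[of x "t - 2 * pi"] by (simp add: cis_shift_2pi)
      qed
      have "\<bar>t - x\<bar> \<le> 2 * pi" using t x by auto
      hence "\<bar>p t - p x\<bar> \<le> L * (2 * pi)" using pt mult_left_mono[OF _ L(1)] order.trans by blast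
      hence "cmod (u t) \<le> (L * (2 * pi)) / ((pi - \<bar>x\<bar>) / 2)"
        unfolding u using d xpi L(1) by (intro frac_le) auto
      also have "\<dots> = 4 * L * pi / (pi - \<bar>x\<bar>)" by simp
      finally show ?thesis using L(1) by (simp add: B_def)
    qed
  qed
  obtain Bp where Bp: "\<And>t. t \<in> torus \<Longrightarrow> \<bar>p t\<bar> \<le> Bp"
  proof (rule that[of "\<bar>p x\<bar> + L * (2 * pi)"])
    fix t assume t: "t \<in> torus"
    have "\<bar>p t - p x\<bar> \<le> L * \<bar>t - x\<bar>" using x t by (intro L(2)) auto
    also have "\<dots> \<le> L * (2 * pi)" using L(1) t x by (intro mult_left_mono) auto
    finally show "\<bar>p t\<bar> \<le> \<bar>p x\<bar> + L * (2 * pi)" by linarith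
  qed
  have pi: "integrable torusM p" by (rule integrable_torusM_bounded[OF p_meas, of Bp]) (use Bp in auto)
  have const: "fourier_partial_sum q (\<lambda>t. of_real (p x)) x = of_real (p x)" for q
  proof -
    have tc: "tcoeff (\<lambda>t. of_real (p x)) k = of_real (p x) * (if k = 0 then 2 * of_real pi else 0)" for k
      using has_bochner_integral_integral_eq[OF has_bochner_integral_torusM_cis[of "- k"]]
      by (simp add: tcoeff_def)
    have "(\<Sum>k=-int q..int q. tcoeff (\<lambda>t. of_real (p x)) k * cis (of_int k * x))
      = (\<Sum>k=-int q..int q. if k = 0 then of_real (p x) * (2 * of_real pi) else 0)"
      unfolding tc by (intro sum.cong) auto
    also have "\<dots> = of_real (p x) * (2 * of_real pi)" by simp
    finally show ?thesis by (simp add: fourier_partial_sum_eq)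
  qed
  have eq: "fourier_partial_sum q (\<lambda>t. of_real (p t)) x - of_real (p x) = of_real (Re (cis (real (q + 1) * x) * tcoeff u (int (q + 1))) / pi)" for q
  proof -
    have int: "integrable torusM (\<lambda>t. complex_of_real (p t - p x))"
      using pi finite_measure.integrable_const[OF finite_measure_torusM, of "p x"] by simp
    have c_int: "integrable torusM (\<lambda>t. complex_of_real (p x))" by (rule finite_measure.integrable_const[OF finite_measure_torusM])
    have "fourier_partial_sum q (\<lambda>t. of_real (p t)) x - of_real (p x) = fourier_partial_sum q (\<lambda>t. complex_of_real (p t - p x)) x"
      using fourier_partial_sum_diff[OF _ c_int, of "\<lambda>t. of_real (p t)" q x] pi const[of q] by simp
    also have "\<dots> = (LINT t|torusM. complex_of_real (p t - p x) * dirichlet q (x - t)) / (2 * of_real pi)"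
      by (rule fourier_partial_sum_integral[OF int])
    also have "(LINT t|torusM. complex_of_real (p t - p x) * dirichlet q (x - t))
      = (LINT t|torusM. complex_of_real (2 * Re (cis (real (q + 1) * x) * (u t * cis (- (of_int (int (q + 1)) * t))))))"
    proof (rule Bochner_Integration.integral_cong[OF refl])
      fix t assume "t \<in> space torusM"
      hence t: "- pi \<le> t" "t < pi" by auto
      show "complex_of_real (p t - p x) * dirichlet q (x - t)
        = complex_of_real (2 * Re (cis (real (q + 1) * x) * (u t * cis (- (of_int (int (q + 1)) * t)))))"
      proof (cases "x = t")
        case False
        have "sin ((x - t) / 2) \<noteq> 0"
        proof (cases "x > t")
          case True
          thus ?thesis using sin_gt_zero[of "(x - t) / 2"] t x by auto
        next
          case F: False
          hence "sin ((t - x) / 2) > 0" using sin_gt_zero[of "(t - x) / 2"] t x False by auto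
          moreover have "sin ((x - t) / 2) = - sin ((t - x) / 2)" by (metis minus_diff_eq minus_divide_left sin_minus)
          ultimately show ?thesis by simp
        qed
        hence "cis x \<noteq> cis t" using chord_eq[of x t] by auto
        hence ne: "cis (x - t) \<noteq> 1" using cis_neq_iff[of x t] by auto
        have e: "cis (real (q + 1) * (x - t)) = cis (real (q + 1) * x) * cis (- (of_int (int (q + 1)) * t))"
          by (simp add: cis_mult algebra_simps)
        have "cis (real (q + 1) * x) * (u t * cis (- (of_int (int (q + 1)) * t))) = of_real (p t - p x) * (cis (real (q + 1) * (x - t)) * ckern (x - t))"
          unfolding e u_def by (simp only: mult_ac)
        hence "Re (cis (real (q + 1) * x) * (u t * cis (- (of_int (int (q + 1)) * t)))) = (p t - p x) * Re (cis (real (q + 1) * (x - t)) * ckern (x - t))"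
          by (simp only: Re_complex_of_real Im_complex_of_real times_complex.sel mult_zero_left diff_zero)
        thus ?thesis unfolding dirichlet_kernel_eq_ckern[OF ne] by (simp add: mult_ac del: of_real_diff times_complex.sel)
      qed (simp add: u_def)
    qed
    also have "(LINT t|torusM. complex_of_real (2 * Re (cis (real (q + 1) * x) * (u t * cis (- (of_int (int (q + 1)) * t))))))
      = complex_of_real (2 * Re (cis (real (q + 1) * x) * tcoeff u (int (q + 1))))"
    proof -
      have ui: "integrable torusM u" by (rule integrable_torusM_bounded[OF u_meas u_bound])
      have i: "integrable torusM (\<lambda>t. cis (real (q + 1) * x) * (u t * cis (- (of_int (int (q + 1)) * t))))"
        by (intro integrable_mult_right integrable_tcoeff ui)
      have "cis (real (q + 1) * x) * tcoeff u (int (q + 1)) = (LINT t|torusM. cis (real (q + 1) * x) * (u t * cis (- (of_int (int (q + 1)) * t))))"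
        unfolding tcoeff_def by (rule integral_mult_right_zero[symmetric])
      thus ?thesis
        unfolding integral_complex_of_real by (subst integral_mult_right_zero) (simp only: integral_Re[OF i])
    qed
    also have "complex_of_real (2 * r) / (2 * of_real pi) = of_real (r / pi)" for r by simp
    finally show ?thesis .
  qed
  have "(\<lambda>q. tcoeff u (int (Suc q))) \<longlonglongrightarrow> 0"
    using LIMSEQ_Suc[OF riemann_lebesgue_bounded[OF u_meas u_bound]] .
  hence "(\<lambda>q. cmod (tcoeff u (int (q + 1))) / pi) \<longlonglongrightarrow> 0"
    by (auto intro!: tendsto_divide_zero tendsto_norm_zero)
  hence "(\<lambda>q. fourier_partial_sum q (\<lambda>t. of_real (p t)) x - of_real (p x)) \<longlonglongrightarrow> 0"
  proof (rule Lim_null_comparison[rotated], intro always_eventually allI)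
    fix q
    have "\<bar>Re (cis (real (q + 1) * x) * tcoeff u (int (q + 1)))\<bar> \<le> cmod (cis (real (q + 1) * x) * tcoeff u (int (q + 1)))"
      by (rule abs_Re_le_cmod)
    thus "norm (fourier_partial_sum q (\<lambda>t. of_real (p t)) x - of_real (p x)) \<le> cmod (tcoeff u (int (q + 1))) / pi"
      unfolding eq norm_of_real abs_divide by (simp add: norm_mult divide_right_mono)
  qed
  thus ?thesis by (rule LIM_zero_cancel)
qed

lemma cesaro_means_tendsto:
  fixes a :: "nat \<Rightarrow> 'a::real_normed_field"
  assumes "a \<longlonglongrightarrow> L"
  shows "(\<lambda>N. (\<Sum>j=1..N. a j) / of_nat N) \<longlonglongrightarrow> L"
proof -
  have "(\<lambda>N. norm ((\<Sum>j=1..N. a j) / of_nat N - L)) \<longlonglongrightarrow> 0"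
  proof (rule LIMSEQ_I)
    fix r :: real assume r: "0 < r"
    obtain m where m: "\<And>j. j \<ge> m \<Longrightarrow> norm (a j - L) < r / 2"
      using LIMSEQ_D[OF assms, of "r / 2"] r by auto
    define C where "C = (\<Sum>j=1..m. norm (a j - L))"
    obtain M :: nat where M: "2 * C / r < real M" using reals_Archimedean2 by blast
    show "\<exists>no. \<forall>N\<ge>no. norm (norm ((\<Sum>j=1..N. a j) / of_nat N - L) - 0) < r"
    proof (intro exI[of _ "max (max m M) 1"] allI impI)
      fix N assume "max (max m M) 1 \<le> N"
      hence N: "m \<le> N" "M \<le> N" "1 \<le> N" by auto
      have "(\<Sum>j=1..N. a j) / of_nat N - L = (\<Sum>j=1..N. a j - L) / of_nat N"
        using N by (simp add: sum_subtractf field_simps)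
      hence "norm ((\<Sum>j=1..N. a j) / of_nat N - L) = norm (\<Sum>j=1..N. a j - L) / real N"
        by (simp add: norm_divide)
      also have "\<dots> \<le> (\<Sum>j=1..N. norm (a j - L)) / real N"
        by (intro divide_right_mono norm_sum) auto
      also have "(\<Sum>j=1..N. norm (a j - L)) = C + (\<Sum>j=m+1..N. norm (a j - L))"
      proof -
        have "{1..N} = {1..m} \<union> {m+1..N}" using N by auto
        thus ?thesis unfolding C_def by (simp add: sum.union_disjoint)
      qed
      also have "(\<Sum>j=m+1..N. norm (a j - L)) \<le> (\<Sum>j=m+1..N. r / 2)"
        using m by (intro sum_mono less_imp_le) auto
      also have "\<dots> \<le> r / 2 * real N" using r by simp
      also have "(C + r / 2 * real N) / real N = C / real N + r / 2" using N by (simp add: add_divide_distrib)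
      also have "C / real N < r / 2"
      proof -
        have "2 * C / r < real N" using M N by linarith
        thus ?thesis using r N by (simp add: field_simps)
      qed
      finally show "norm (norm ((\<Sum>j=1..N. a j) / of_nat N - L) - 0) < r"
        by (simp add: divide_right_mono)
    qed
  qed
  thus ?thesis by (rule LIM_zero_cancel[OF tendsto_norm_zero_cancel])
qed

section \<open>Almost everywhere convergence\<close>

lemma fourier_partial_sum_bound:
  assumes "integrable torusM f"
  shows "cmod (fourier_partial_sum q f x) \<le> (2 * real q + 1) * (LINT t|torusM. cmod (f t))"
proof -
  have "cmod (\<Sum>k=-int q..int q. tcoeff f k * cis (of_int k * x)) \<le> (\<Sum>k=-int q..int q. (LINT t|torusM. cmod (f t)))"
    by (rule sum_norm_le) (simp add: norm_mult tcoeff_norm_le)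
  also have "\<dots> = (2 * real q + 1) * (LINT t|torusM. cmod (f t))" by simp
  finally have 1: "cmod (\<Sum>k=-int q..int q. tcoeff f k * cis (of_int k * x)) \<le> (2 * real q + 1) * (LINT t|torusM. cmod (f t))" .
  have "cmod (fourier_partial_sum q f x) = cmod (\<Sum>k=-int q..int q. tcoeff f k * cis (of_int k * x)) / (2 * pi)"
    by (simp add: fourier_partial_sum_eq norm_divide norm_mult)
  also have "\<dots> \<le> cmod (\<Sum>k=-int q..int q. tcoeff f k * cis (of_int k * x)) / 1"
    using pi_gt3 by (intro divide_left_mono) auto
  finally show ?thesis using 1 by simp
qed

section \<open>From continuous to integrable functions\<close>

context sparse_sequence
begin

text \<open>A crude L^1 bound whose constant grows with N0; enough to choose an approximation once
  N0 is fixed.\<close>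

lemma cesaro_bound:
  assumes "integrable torusM f" "1 \<le> N" "N \<le> N0"
  shows "cmod (cesaro N f x) \<le> (\<Sum>j=1..N0. 2 * real (n j) + 1) * (LINT t|torusM. cmod (f t))"
proof -
  let ?I = "LINT t|torusM. cmod (f t)"
  have "cmod (cesaro N f x) = cmod (\<Sum>j=1..N. fourier_partial_sum (n j) f x) / real N"
    by (simp add: cesaro_def norm_divide)
  also have "\<dots> \<le> cmod (\<Sum>j=1..N. fourier_partial_sum (n j) f x) / 1"
    using assms(2) by (intro divide_left_mono) auto
  also have "\<dots> \<le> (\<Sum>j=1..N. (2 * real (n j) + 1) * ?I)"
    by (simp, rule sum_norm_le) (rule fourier_partial_sum_bound[OF assms(1)])
  also have "\<dots> \<le> (\<Sum>j=1..N0. (2 * real (n j) + 1) * ?I)"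
    using assms(3) by (intro sum_mono2) auto
  finally show ?thesis by (simp add: sum_distrib_right)
qed

lemma cesaro_sets:
  "{x \<in> torus. \<exists>N\<in>A. c < cmod (cesaro N f x)} \<in> sets torusM"
proof -
  have "{x \<in> space torusM. \<exists>N\<in>A. c < cmod (cesaro N f x)} \<in> sets torusM" by measurable
  thus ?thesis by simp
qed

lemma weak_type_finite:
  fixes f :: "real \<Rightarrow> real"
  assumes f: "integrable torusM f" and lam: "0 < lam"
  shows "measure torusM {x \<in> torus. \<exists>N\<in>{1..N0}. 7 * lam < cmod (cesaro N (\<lambda>t. of_real (f t)) x)}
    \<le> 16000 * pi^2 / lam * (l1_int f)"
proof (rule field_le_epsilon)
  interpret T: finite_measure torusM by (rule finite_measure_torusM)
  fix e :: real assume e: "0 < e"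
  define C where "C = 16000 * pi^2"
  have C: "0 < C" by (simp add: C_def)
  define A where "A = (\<Sum>j=1..N0. 2 * real (n j) + 1) + 1"
  have A: "0 < A" unfolding A_def by (intro add_nonneg_pos sum_nonneg) auto
  \<comment> \<open>The distance lam / A keeps the averages of f - h below \<open>lam\<close> for
    all N up to N0, whence 7 for 6; e lam / C is the slack on the right-hand side.\<close>
  obtain h where h: "continuous_on UNIV h" "(LINT t|torusM. \<bar>f t - h t\<bar>) < min (lam / A) (e * lam / C)"
    by (rule continuous_dense_torus[OF f, of "min (lam / A) (e * lam / C)"]) (use lam A C e in auto)
  have hi: "integrable torusM h" by (rule integrable_torusM_continuous[OF h(1)])
  define r where "r t = complex_of_real (f t - h t)" for t
  have ri: "integrable torusM r" unfolding r_def [abs_def] using f hi by (intro integrable_of_real Bochner_Integration.integrable_diff)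
  have rI: "(LINT t|torusM. cmod (r t)) = (LINT t|torusM. \<bar>f t - h t\<bar>)" unfolding r_def norm_of_real ..
  have sub: "{x \<in> torus. \<exists>N\<in>{1..N0}. 7 * lam < cmod (cesaro N (\<lambda>t. of_real (f t)) x)}
     \<subseteq> {x \<in> torus. \<exists>N\<in>{1..N0}. 6 * lam < cmod (cesaro N (\<lambda>t. of_real (h t)) x)}"
  proof (intro subsetI CollectI conjI)
    fix x assume x: "x \<in> {x \<in> torus. \<exists>N\<in>{1..N0}. 7 * lam < cmod (cesaro N (\<lambda>t. of_real (f t)) x)}"
    thus "x \<in> torus" by simp
    from x obtain N where N: "1 \<le> N" "N \<le> N0" "7 * lam < cmod (cesaro N (\<lambda>t. of_real (f t)) x)" by auto
    have "cmod (cesaro N r x) \<le> (A - 1) * (LINT t|torusM. \<bar>f t - h t\<bar>)"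
      using cesaro_bound[OF ri N(1,2), of x] by (simp add: rI A_def)
    also have "\<dots> \<le> A * (LINT t|torusM. \<bar>f t - h t\<bar>)" by (intro mult_right_mono) auto
    also have "\<dots> \<le> A * (lam / A)" using h(2) A by (intro mult_left_mono) auto
    also have "\<dots> = lam" using A by simp
    finally have "cmod (cesaro N r x) \<le> lam" .
    moreover have "(\<lambda>t. complex_of_real (f t)) = (\<lambda>t. complex_of_real (h t) + r t)" by (simp add: r_def)
    hence "cesaro N (\<lambda>t. of_real (f t)) x = cesaro N (\<lambda>t. of_real (h t)) x + cesaro N r x"
      using hi ri by (simp add: cesaro_add)
    ultimately have "6 * lam < cmod (cesaro N (\<lambda>t. of_real (h t)) x)"
      using N(3) norm_triangle_ineq[of "cesaro N (\<lambda>t. of_real (h t)) x" "cesaro N r x"] by simp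
    thus "\<exists>N\<in>{1..N0}. 6 * lam < cmod (cesaro N (\<lambda>t. of_real (h t)) x)" using N by auto
  qed
  have "measure torusM {x \<in> torus. \<exists>N\<in>{1..N0}. 7 * lam < cmod (cesaro N (\<lambda>t. of_real (f t)) x)}
     \<le> measure torusM {x \<in> torus. \<exists>N\<in>{1..N0}. 6 * lam < cmod (cesaro N (\<lambda>t. of_real (h t)) x)}"
    by (rule T.finite_measure_mono[OF sub cesaro_sets])
  also have "\<dots> \<le> C / lam * (l1_int h)"
    unfolding C_def by (rule weak_type_continuous[OF h(1) lam])
  also have "\<dots> \<le> C / lam * ((l1_int f) + e * lam / C)"
  proof (rule mult_left_mono)
    have "(l1_int h) \<le> (LINT t|torusM. \<bar>f t\<bar> + \<bar>f t - h t\<bar>)"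
      using f hi by (intro integral_mono) auto
    also have "\<dots> = (l1_int f) + (LINT t|torusM. \<bar>f t - h t\<bar>)"
      using f hi by (intro Bochner_Integration.integral_add) auto
    finally show "(l1_int h) \<le> (l1_int f) + e * lam / C" using h(2) by simp
  qed (use C lam in simp)
  also have "\<dots> = C / lam * (l1_int f) + e" using C lam by (simp add: field_simps)
  finally show "measure torusM {x \<in> torus. \<exists>N\<in>{1..N0}. 7 * lam < cmod (cesaro N (\<lambda>t. of_real (f t)) x)}
    \<le> 16000 * pi^2 / lam * (l1_int f) + e" unfolding C_def .
qed

text \<open>The constant is free of N0, so continuity from below lets N0 tend to infinity.\<close>

lemma weak_type:
  fixes f :: "real \<Rightarrow> real"
  assumes f: "integrable torusM f" and lam: "0 < lam"
  shows "measure torusM {x \<in> torus. \<exists>N\<in>{1..}. 7 * lam < cmod (cesaro N (\<lambda>t. of_real (f t)) x)}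
    \<le> 16000 * pi^2 / lam * (l1_int f)"
proof -
  interpret T: finite_measure torusM by (rule finite_measure_torusM)
  define E where "E N0 = {x \<in> torus. \<exists>N\<in>{1..N0}. 7 * lam < cmod (cesaro N (\<lambda>t. of_real (f t)) x)}" for N0
  have "(\<lambda>i. measure torusM (E i)) \<longlonglongrightarrow> measure torusM (\<Union>i. E i)"
  proof (rule T.finite_Lim_measure_incseq)
    show "range E \<subseteq> sets torusM" unfolding E_def using cesaro_sets by blast
    show "incseq E" unfolding E_def by (intro monoI) force
  qed
  moreover have "(\<Union>i. E i) = {x \<in> torus. \<exists>N\<in>{1..}. 7 * lam < cmod (cesaro N (\<lambda>t. of_real (f t)) x)}"
  proof (intro set_eqI iffI)
    fix x assume "x \<in> {x \<in> torus. \<exists>N\<in>{1..}. 7 * lam < cmod (cesaro N (\<lambda>t. of_real (f t)) x)}"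
    then obtain N where "x \<in> torus" "1 \<le> N" "7 * lam < cmod (cesaro N (\<lambda>t. of_real (f t)) x)" by auto
    hence "x \<in> E N" unfolding E_def by auto
    thus "x \<in> (\<Union>i. E i)" by blast
  qed (auto simp: E_def)
  ultimately show ?thesis
    using weak_type_finite[OF f lam] by (intro LIMSEQ_le_const2[where X = "\<lambda>i. measure torusM (E i)"]) (auto simp: E_def)
qed

lemma filterlim_sparse: "filterlim n at_top sequentially"
proof (rule filterlim_at_top_mono[OF filterlim_ident])
  show "\<forall>\<^sub>F j in sequentially. j \<le> n j" using eventually_ge_at_top[of 1] by eventually_elim (rule growth_ge)
qed

lemma cesaro_polynomial_tendsto:
  assumes p: "real_polynomial_function p" and x: "- pi < x" "x < pi"
  shows "(\<lambda>N. cesaro N (\<lambda>t. of_real (p t)) x) \<longlonglongrightarrow> of_real (p x)"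
proof -
  have "continuous_on UNIV p"
    using p by (intro continuous_on_polymonial_function) (simp add: real_polynomial_function_eq)
  hence pm: "p \<in> borel_measurable torusM" by (rule continuous_measurable_torusM)
  obtain L where L: "0 \<le> L" "\<And>s t. s \<in> {-pi..pi} \<Longrightarrow> t \<in> {-pi..pi} \<Longrightarrow> \<bar>p s - p t\<bar> \<le> L * \<bar>s - t\<bar>"
    using real_polynomial_function_lipschitz[OF p] by blast
  have "(\<lambda>j. fourier_partial_sum (n j) (\<lambda>t. of_real (p t)) x) \<longlonglongrightarrow> of_real (p x)"
    by (rule filterlim_compose[OF partial_sums_converge_lipschitz[OF pm L x] filterlim_sparse])
  thus ?thesis unfolding cesaro_def by (rule cesaro_means_tendsto)
qed

text \<open>9 = 1 + 7 + 1: convergence for the polynomial p, the weak type bound for f - p, and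
  Markov's inequality for |f - p| itself.\<close>

lemma cesaro_bad_set_null:
  fixes f :: "real \<Rightarrow> real"
  assumes f: "integrable torusM f" and lam: "0 < lam"
  shows "AE x in torusM. \<exists>N0. \<forall>N\<ge>N0. cmod (cesaro N (\<lambda>t. of_real (f t)) x - of_real (f x)) \<le> 9 * lam"
proof -
  interpret T: finite_measure torusM by (rule finite_measure_torusM)
  let ?c = "\<lambda>N g x. cesaro N (\<lambda>t. complex_of_real (g t)) x"
  define Bad where "Bad = {x \<in> space torusM. \<forall>N0. \<exists>N\<ge>N0. 9 * lam < cmod (?c N f x - of_real (f x))}"
  have f_meas [measurable]: "f \<in> borel_measurable torusM" using f by simp
  have Bad_sets: "Bad \<in> sets torusM" unfolding Bad_def by measurable
  define C where "C = 16000 * pi^2"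
  have C: "0 < C" by (simp add: C_def)
  have "measure torusM Bad \<le> 0 + e" if e: "0 < e" for e
  proof -
    \<comment> \<open>The exceptional sets have measure at most C I / lam and I / lam, which must
      add up to at most e.\<close>
    obtain p where p: "real_polynomial_function p" "(LINT t|torusM. \<bar>f t - p t\<bar>) < e * lam / (C + 1)"
      by (rule polynomial_dense_torus[OF f, of "e * lam / (C + 1)"]) (use lam C e in auto)
    define I where "I = (LINT t|torusM. \<bar>f t - p t\<bar>)"
    have p_cont: "continuous_on UNIV p"
      using p(1) by (intro continuous_on_polymonial_function) (simp add: real_polynomial_function_eq)
    have pi: "integrable torusM p" by (rule integrable_torusM_continuous[OF p_cont])
    define r where "r t = f t - p t" for t
    have ri: "integrable torusM r" unfolding r_def [abs_def] using f pi by simp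
    define E1 where "E1 = {x \<in> torus. \<exists>N\<in>{1..}. 7 * lam < cmod (?c N r x)}"
    define E2 where "E2 = {x \<in> space torusM. lam \<le> \<bar>r x\<bar>}"
    have E1_sets: "E1 \<in> sets torusM" unfolding E1_def by (rule cesaro_sets)
    have E2_sets: "E2 \<in> sets torusM" unfolding E2_def using ri by measurable
    have E3_sets: "{- pi} \<in> sets torusM" by (auto simp: sets_restrict_space)
    have sub: "Bad \<subseteq> E1 \<union> E2 \<union> {- pi}"
    proof
      fix x assume x: "x \<in> Bad"
      show "x \<in> E1 \<union> E2 \<union> {- pi}"
      proof (rule ccontr)
        assume n: "x \<notin> E1 \<union> E2 \<union> {- pi}"
        have xt: "- pi < x" "x < pi" using x n by (auto simp: Bad_def)
        have 1: "cmod (?c N r x) \<le> 7 * lam" if "N \<ge> 1" for N using n xt that by (force simp: E1_def)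
        have 2: "\<bar>r x\<bar> < lam" using n xt by (auto simp: E2_def)
        obtain N1 where 3: "\<And>N. N \<ge> N1 \<Longrightarrow> cmod (?c N p x - of_real (p x)) < lam"
          using LIMSEQ_D[OF cesaro_polynomial_tendsto[OF p(1) xt] lam] by auto
        obtain N where N: "N \<ge> max N1 1" "9 * lam < cmod (?c N f x - of_real (f x))"
          using x unfolding Bad_def by blast
        have "(\<lambda>t. complex_of_real (f t)) = (\<lambda>t. complex_of_real (p t) + complex_of_real (r t))" by (simp add: r_def)
        hence "?c N f x = ?c N p x + ?c N r x" using pi ri by (simp add: cesaro_add)
        hence "?c N f x - of_real (f x) = (?c N p x - of_real (p x)) + ?c N r x - of_real (r x)"
          by (simp add: r_def)
        hence "cmod (?c N f x - of_real (f x)) \<le> cmod (?c N p x - of_real (p x)) + cmod (?c N r x) + cmod (complex_of_real (r x))"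
          using norm_triangle_ineq4[of "(?c N p x - of_real (p x)) + ?c N r x" "of_real (r x)"]
            norm_triangle_ineq[of "?c N p x - of_real (p x)" "?c N r x"] by simp
        also have "\<dots> \<le> lam + 7 * lam + lam" using 1[of N] 2 3[of N] N(1) by simp
        finally show False using N(2) by simp
      qed
    qed
    have "measure torusM Bad \<le> measure torusM (E1 \<union> E2 \<union> {- pi})"
      by (rule T.finite_measure_mono[OF sub]) (intro sets.Un E1_sets E2_sets E3_sets)
    also have "\<dots> \<le> measure torusM E1 + measure torusM E2 + measure torusM {- pi}"
      using measure_Un_le[of "E1 \<union> E2" torusM "{- pi}"] measure_Un_le[of E1 torusM E2] E1_sets E2_sets E3_sets by auto
    also have "measure torusM {- pi} = 0" by (simp add: measure_restrict_space)
    also have "measure torusM E1 \<le> C / lam * I"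
      unfolding E1_def C_def I_def using weak_type[OF ri lam] by (simp add: r_def)
    also have "measure torusM E2 \<le> I / lam"
    proof -
      have "integrable torusM (\<lambda>x. \<bar>r x\<bar>)" using ri by simp
      from integral_Markov_inequality_measure[OF this, of "{}" lam] lam show ?thesis
        by (simp add: E2_def I_def r_def)
    qed
    finally have "measure torusM Bad \<le> C / lam * I + I / lam" by simp
    also have "\<dots> = (C + 1) / lam * I" by (simp add: field_simps add_divide_distrib)
    also have "\<dots> \<le> (C + 1) / lam * (e * lam / (C + 1))"
      using p(2) C lam unfolding I_def by (intro mult_left_mono) auto
    also have "\<dots> = e" using C lam by simp
    finally show ?thesis by simp
  qed
  hence "measure torusM Bad \<le> 0" by (rule field_le_epsilon)
  hence "emeasure torusM Bad = 0" by (simp add: T.emeasure_eq_measure measure_le_0_iff)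
  hence "Bad \<in> null_sets torusM" using Bad_sets by auto
  hence "AE x in torusM. x \<notin> Bad" by (rule AE_not_in)
  thus ?thesis
  proof (rule AE_mp, intro AE_I2 impI)
    fix x assume "x \<in> space torusM" "x \<notin> Bad"
    thus "\<exists>N0. \<forall>N\<ge>N0. cmod (?c N f x - of_real (f x)) \<le> 9 * lam"
      unfolding Bad_def by (auto simp: not_less)
  qed
qed

lemma cesaro_ae_tendsto_real:
  fixes f :: "real \<Rightarrow> real"
  assumes f: "integrable torusM f"
  shows "AE x in torusM. (\<lambda>N. cesaro N (\<lambda>t. of_real (f t)) x) \<longlonglongrightarrow> of_real (f x)"
proof -
  let ?c = "\<lambda>N x. cesaro N (\<lambda>t. complex_of_real (f t)) x"
  have "AE x in torusM. \<forall>k. \<exists>N0. \<forall>N\<ge>N0. cmod (?c N x - of_real (f x)) \<le> 9 * (1 / (9 * real (Suc k)))"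
    unfolding AE_all_countable by (intro allI cesaro_bad_set_null f) simp
  thus ?thesis
  proof (rule AE_mp, intro AE_I2 impI)
    fix x assume *: "\<forall>k. \<exists>N0. \<forall>N\<ge>N0. cmod (?c N x - of_real (f x)) \<le> 9 * (1 / (9 * real (Suc k)))"
    show "(\<lambda>N. ?c N x) \<longlonglongrightarrow> of_real (f x)"
    proof (rule LIMSEQ_I)
      fix r :: real assume "0 < r"
      then obtain k where k: "1 / real (Suc k) < r" using nat_approx_posE by metis
      obtain N0 where "\<forall>N\<ge>N0. cmod (?c N x - of_real (f x)) \<le> 9 * (1 / (9 * real (Suc k)))" using * by blast
      moreover have "9 * (1 / (9 * a)) = 1 / a" for a :: real by simp
      hence "9 * (1 / (9 * real (Suc k))) < r" using k by (simp only:)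
      ultimately have "\<forall>N\<ge>N0. norm (?c N x - of_real (f x)) < r" by (blast intro: le_less_trans)
      thus "\<exists>no. \<forall>N\<ge>no. norm (?c N x - of_real (f x)) < r" by blast
    qed
  qed
qed

text \<open>The decomposition was carried out for real functions, where partial sums are real parts;
  real and imaginary part are treated separately.\<close>

lemma cesaro_ae_tendsto:
  assumes f: "integrable torusM f"
  shows "AE x in torusM. (\<lambda>N. cesaro N f x) \<longlonglongrightarrow> f x"
proof -
  have r: "integrable torusM (\<lambda>t. Re (f t))" and i: "integrable torusM (\<lambda>t. Im (f t))" using f by auto
  have eq: "cesaro N f x = cesaro N (\<lambda>t. of_real (Re (f t))) x + \<i> * cesaro N (\<lambda>t. of_real (Im (f t))) x" for N x
  proof -
    have "f = (\<lambda>t. of_real (Re (f t)) + \<i> * of_real (Im (f t)))" by (auto simp: complex_eq_iff)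
    hence "cesaro N f x = cesaro N (\<lambda>t. of_real (Re (f t)) + \<i> * of_real (Im (f t))) x" by simp
    also have "\<dots> = cesaro N (\<lambda>t. of_real (Re (f t))) x + cesaro N (\<lambda>t. \<i> * of_real (Im (f t))) x"
      using r i by (intro cesaro_add) auto
    also have "cesaro N (\<lambda>t. \<i> * of_real (Im (f t))) x = \<i> * cesaro N (\<lambda>t. of_real (Im (f t))) x"
      by (simp add: cesaro_def fourier_partial_sum_cmult sum_distrib_left)
    finally show ?thesis .
  qed
  from cesaro_ae_tendsto_real[OF r] cesaro_ae_tendsto_real[OF i] show ?thesis
  proof eventually_elim
    case (elim x)
    have "(\<lambda>N. cesaro N f x) \<longlonglongrightarrow> of_real (Re (f x)) + \<i> * of_real (Im (f x))"
      unfolding eq by (intro tendsto_intros elim)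
    thus ?case by (simp add: complex_eq[symmetric])
  qed
qed

end

theorem theorem1p1:
  fixes f :: "real \<Rightarrow> complex" and n :: "nat \<Rightarrow> nat" and \<delta> :: real
  assumes "set_integrable lebesgue torus f"
    and "\<And>j. j \<ge> 1 \<Longrightarrow> n j > 0"
    and "0 < \<delta>" and "\<delta> < 1 / 2"
    and "\<And>j. j \<ge> 1 \<Longrightarrow> real (n (Suc j)) \<ge> (1 + 1 / real j powr \<delta>) * real (n j)"
  shows "AE y in lebesgue. y \<in> torus \<longrightarrow>
    (\<lambda>N. (1 / of_nat N) * (\<Sum>j = 1..N. fourier_partial_sum (n j) f y)) \<longlonglongrightarrow> f y"
proof -
  interpret sparse_sequence n \<delta> by unfold_locales (use assms in auto)
  have "integrable torusM f"
    using assms(1) unfolding set_integrable_def by (subst integrable_restrict_space) auto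
  from cesaro_ae_tendsto[OF this] show ?thesis
    unfolding cesaro_def by (subst (asm) AE_restrict_space_iff) auto
qed

end
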